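(* Let $T^{obs}$ be a zero-mean Gaussian and isotropic spherical random field with angular power spectrum $\{C_\ell\}$, and let $\lambda>0$. Let $T^{reg}=\sum_\ell T^{reg}_\ell=\sum_{\ell m}a^{reg}_{\ell m}Y_{\ell m}$ and $T^{reg*}=\sum_{\ell m}a^{reg*}_{\ell m}Y^{\mathcal R}_{\ell m}$ be the regularized fields with penalization $\lambda$ under the complex-valued and the real-valued regularization schemes respectively. Then the fields $T^{reg}$ and $T^{reg*}$ are necessarily non-Gaussian and anisotropic. In particular: (1) In the complex-valued scheme, $$E\{(a^{reg}_{\ell0})^2\}=\gamma_0\Big(\tfrac{\lambda}{\sqrt{C_\ell}}\Big):=C_\ell\left\{2\Big(1+\frac{\lambda^2}{C_\ell}\Big)\Big(1-\Phi\big(\tfrac{\lambda}{\sqrt{C_\ell}}\big)\Big)-\exp\Big(-\frac{\lambda^2}{2C_\ell}\Big)\frac{\lambda}{\sqrt{C_\ell}}\sqrt{\frac2\pi}\right\},$$ while for $m\neq0$ $$E\{|a^{reg}_{\ell m}|^2\}=\gamma_1\Big(\tfrac{\lambda}{\sqrt{C_\ell}}\Big):=C_\ell\left\{\exp\Big(-\frac{\lambda^2}{C_\ell}\Big)-2\sqrt\pi\,\frac{\lambda}{\sqrt{C_\ell}}\Big(1-\Phi\big(\tfrac{\sqrt2\lambda}{\sqrt{C_\ell}}\big)\Big)\right\}.$$ (2) Moreover, in the complex-valued scheme, for all $m\ne0$, $$-\lim_{\lambda/\sqrt{C_\ell}\to\infty}\frac{2C_\ell}{\lambda^2}\log\frac{E\{|a^{reg}_{\ell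 m}|^2\}}{E\{|a^{reg}_{\ell0}|^2\}}=1,$$ and $$\lim_{\lambda/\sqrt{C_\ell}\to\infty}\frac{E\{T^{reg}_\ell(\theta,\phi)^2\}}{E\{T^{reg}_\ell(0,0)^2\}P_\ell^2(\cos\theta)}=1,$$ where $P_\ell$ is the Legendre polynomial. (3) Finally, in the real-valued scheme, for all $m=-\ell,\dots,\ell$, $$E\{(a^{reg*}_{\ell0})^2\}=E\{|a^{reg*}_{\ell m}|^2\}=\gamma_0\Big(\tfrac{\lambda}{\sqrt{C_\ell}}\Big).$$
   Context: $\Phi$ is the standard Gaussian cumulative distribution function. $\{Y_{\ell m}\}_{\ell\ge0,\,-\ell\le m\le\ell}$ denotes the standard complex orthonormal basis of spherical harmonics of $L^2(S^2)$, with $Y_{\ell m}=(-1)^m\overline{Y}_{\ell,-m}$; $(\theta,\phi)$ are the spherical coordinates of a point of $S^2$, with North Pole $(0,0)$. A random field on $S^2$ is isotropic if its law is invariant under all rotations $g\in SO(3)$, and anisotropic otherwise. A zero-mean Gaussian isotropic field has the expansion $T^{obs}=\sum_{\ell}\sum_{m=-\ell}^{\ell}a^{obs}_{\ell m}Y_{\ell m}$, where $a^{obs}_{\ell,-m}=(-1)^m\overline{a^{obs}_{\ell m}}$, the coefficients with $m\ge0$ are independent, $a^{obs}_{\ell0}$ is real centred Gaussian with variance $C_\ell$, and for $m\ne0$ the real and imaginary parts of $a^{obs}_{\ell m}$ are independent centred Gaussians with variance $C_\ell/2$. It is assumed that $0<C_\ell<\infty$ for all $\ell\ge0$ and $C_\ell\le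 K\ell^{-\alpha}$ for $\ell\ge 1$, some $K>0$, $\alpha>2$. Complex-valued scheme with penalization $\lambda$: for each realization, over complex arrays and with $|\cdot|$ the complex modulus, $$\{a^{reg}_{\ell m}\}=\arg\min_{\{a_{\ell m}\}}\Big\{\lambda\sum_{\ell m}|a_{\ell m}|+\tfrac12\sum_{\ell m}|a^{obs}_{\ell m}-a_{\ell m}|^2\Big\},\qquad T^{reg}_\ell=\sum_{m=-\ell}^\ell a^{reg}_{\ell m}Y_{\ell m}.$$ Real-valued scheme: put $Y^{\mathcal R}_{\ell0}=Y_{\ell0}$, $Y^{\mathcal R}_{\ell m}=\sqrt2\,\mathrm{Re}(Y_{\ell m})$ for $m>0$, $Y^{\mathcal R}_{\ell m}=\sqrt2\,\mathrm{Im}(Y_{\ell,-m})$ for $m<0$, and $a^{obs;\mathcal R}_{\ell0}=a^{obs}_{\ell0}$, $a^{obs;\mathcal R}_{\ell m}=\sqrt2\,\mathrm{Re}(a^{obs}_{\ell m})$ for $m>0$, $a^{obs;\mathcal R}_{\ell m}=-\sqrt2\,\mathrm{Im}(a^{obs}_{\ell,-m})$ for $m<0$, so that $T^{obs}=\sum_{\ell m}a^{obs;\mathcal R}_{\ell m}Y^{\mathcal R}_{\ell m}$. Then, over real arrays, $$\{a^{reg*}_{\ell m}\}=\arg\min_{\{a_{\ell m}\}}\Big\{\lambda\sum_{\ell m}|a_{\ell m}|+\tfrac12\sum_{\ell m}|a^{obs;\mathcal R}_{\ell m}-a_{\ell m}|^2\Big\}.$$ The notation $\gamma_0(\lambda/\sqrt{C_\ell})$,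 $\gamma_1(\lambda/\sqrt{C_\ell})$ suppresses the prefactor's dependence on $C_\ell$. *)

theory Defs
  imports "HOL-Probability.Probability" "HOL-Computational_Algebra.Polynomial"
begin

text \<open>Rodrigues' formula.\<close>

definition legendre_poly :: "nat \<Rightarrow> real poly" where
  "legendre_poly l = smult (1 / (2 ^ l * fact l)) ((pderiv ^^ l) ([:-1, 0, 1:] ^ l))"

abbreviation legendre :: "nat \<Rightarrow> real \<Rightarrow> real" where
  "legendre l x \<equiv> poly (legendre_poly l) x"

text \<open>The associated Legendre functions carry the Condon-Shortley phase.\<close>

definition assoc_legendre :: "nat \<Rightarrow> nat \<Rightarrow> real \<Rightarrow> real" where
  "assoc_legendre l m x = (-1) ^ m * sqrt (1 - x\<^sup>2) ^ m * poly ((pderiv ^^ m) (legendre_poly l)) x"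

definition sph_harm_nonneg :: "nat \<Rightarrow> nat \<Rightarrow> real \<Rightarrow> real \<Rightarrow> complex" where
  "sph_harm_nonneg l m \<theta> \<phi> =
     of_real (sqrt ((2 * real l + 1) / (4 * pi) * (fact (l - m) / fact (l + m)))
              * assoc_legendre l m (cos \<theta>)) * cis (real m * \<phi>)"

definition sph_harm_angles :: "nat \<Rightarrow> int \<Rightarrow> real \<Rightarrow> real \<Rightarrow> complex" where
  "sph_harm_angles l m \<theta> \<phi> =
     (if 0 \<le> m then sph_harm_nonneg l (nat m) \<theta> \<phi>
      else (-1) ^ nat (- m) * cnj (sph_harm_nonneg l (nat (- m)) \<theta> \<phi>))"

abbreviation S2 :: "(real ^ 3) set" where
  "S2 \<equiv> sphere 0 1"

definition sph_point :: "real \<Rightarrow> real \<Rightarrow> real ^ 3" where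
  "sph_point \<theta> \<phi> = vector [sin \<theta> * cos \<phi>, sin \<theta> * sin \<phi>, cos \<theta>]"

text \<open>Spherical harmonics as functions on the sphere. The longitude is read off in
  \<open>]-\<pi>, \<pi>]\<close>, which is immaterial by periodicity; at the poles it is \<open>Arg 0 = 0\<close>.\<close>

definition sph_harm :: "nat \<Rightarrow> int \<Rightarrow> real ^ 3 \<Rightarrow> complex" where
  "sph_harm l m x = sph_harm_angles l m (arccos (x $ 3)) (Arg (Complex (x $ 1) (x $ 2)))"

definition sph_harm_real :: "nat \<Rightarrow> int \<Rightarrow> real ^ 3 \<Rightarrow> real" where
  "sph_harm_real l m x =
     (if m = 0 then Re (sph_harm l 0 x)
      else if 0 < m then sqrt 2 * Re (sph_harm l m x)
      else sqrt 2 * Im (sph_harm l (- m) x))"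

type_synonym ('w, 'b) field = "real ^ 3 \<Rightarrow> 'w \<Rightarrow> 'b"

definition random_field :: "'w measure \<Rightarrow> ('w, 'b :: euclidean_space) field \<Rightarrow> bool" where
  "random_field M T \<longleftrightarrow> (\<forall>x\<in>S2. T x \<in> borel_measurable M)"

text \<open>Constants count as (degenerate) Gaussian variables.\<close>

definition gaussian_rv :: "'w measure \<Rightarrow> ('w \<Rightarrow> real) \<Rightarrow> bool" where
  "gaussian_rv M X \<longleftrightarrow> X \<in> borel_measurable M \<and>
     ((\<exists>\<mu>. AE \<omega> in M. X \<omega> = \<mu>) \<or>
      (\<exists>\<mu> \<sigma>. 0 < \<sigma> \<and> distributed M lborel X (normal_density \<mu> \<sigma>)))"

text \<open>All finite-dimensional distributions are Gaussian. For a complex-valued field this means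
  that real and imaginary parts are jointly Gaussian; for one that is almost surely real it is
  Gaussianity of the real field.\<close>

definition gaussian_field :: "'w measure \<Rightarrow> ('w, 'b :: euclidean_space) field \<Rightarrow> bool" where
  "gaussian_field M T \<longleftrightarrow>
     (\<forall>J v. finite J \<and> J \<subseteq> S2 \<longrightarrow> gaussian_rv M (\<lambda>\<omega>. \<Sum>x\<in>J. v x \<bullet> T x \<omega>))"

definition zero_mean_field :: "'w measure \<Rightarrow> ('w, 'b :: euclidean_space) field \<Rightarrow> bool" where
  "zero_mean_field M T \<longleftrightarrow> (\<forall>x\<in>S2. integrable M (T x) \<and> (\<integral>\<omega>. T x \<omega> \<partial>M) = 0)"

definition field_law ::
    "'w measure \<Rightarrow> ('w, 'b :: euclidean_space) field \<Rightarrow> (real ^ 3 \<Rightarrow> 'b) measure" where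
  "field_law M T = distr M (PiM S2 (\<lambda>_. borel)) (\<lambda>\<omega>. \<lambda>x\<in>S2. T x \<omega>)"

definition isotropic_field :: "'w measure \<Rightarrow> ('w, 'b :: euclidean_space) field \<Rightarrow> bool" where
  "isotropic_field M T \<longleftrightarrow>
     (\<forall>g :: real ^ 3 ^ 3. rotation_matrix g \<longrightarrow>
        field_law M (\<lambda>x. T (g *v x)) = field_law M T)"

type_synonym 'a harmonic_array = "nat \<Rightarrow> int \<Rightarrow> 'a"

type_synonym 'w random_coeffs = "nat \<Rightarrow> int \<Rightarrow> 'w \<Rightarrow> complex"

definition harmonic_indices :: "(nat \<times> int) set" where
  "harmonic_indices = (SIGMA l:UNIV. {- int l..int l})"

definition admissible_spectrum :: "(nat \<Rightarrow> real) \<Rightarrow> bool" where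
  "admissible_spectrum C \<longleftrightarrow> (\<forall>l. 0 < C l) \<and>
     (\<exists>K \<alpha>. 0 < K \<and> 2 < \<alpha> \<and> (\<forall>l\<ge>1. C l \<le> K * real l powr (- \<alpha>)))"

definition gaussian_coeffs :: "'w measure \<Rightarrow> 'w random_coeffs \<Rightarrow> (nat \<Rightarrow> real) \<Rightarrow> bool" where
  "gaussian_coeffs M a C \<longleftrightarrow>
     (\<forall>(l, m)\<in>harmonic_indices. a l m \<in> borel_measurable M) \<and>
     (\<forall>(l, m)\<in>harmonic_indices. AE \<omega> in M. a l (- m) \<omega> = (-1) ^ nat \<bar>m\<bar> * cnj (a l m \<omega>)) \<and>
     prob_space.indep_vars M (\<lambda>_. borel) (\<lambda>(l, m). a l m) {(l, m) \<in> harmonic_indices. 0 \<le> m} \<and>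
     (\<forall>l. (AE \<omega> in M. a l 0 \<omega> \<in> \<real>) \<and>
          distributed M lborel (\<lambda>\<omega>. Re (a l 0 \<omega>)) (normal_density 0 (sqrt (C l)))) \<and>
     (\<forall>(l, m)\<in>harmonic_indices. m \<noteq> 0 \<longrightarrow>
          prob_space.indep_var M borel (\<lambda>\<omega>. Re (a l m \<omega>)) borel (\<lambda>\<omega>. Im (a l m \<omega>)) \<and>
          distributed M lborel (\<lambda>\<omega>. Re (a l m \<omega>)) (normal_density 0 (sqrt (C l / 2))) \<and>
          distributed M lborel (\<lambda>\<omega>. Im (a l m \<omega>)) (normal_density 0 (sqrt (C l / 2))))"

text \<open>Mean-square convergence of the harmonic series at every point of the sphere.\<close>

definition harmonic_expansion ::
    "'w measure \<Rightarrow> ('w, real) field \<Rightarrow> 'w random_coeffs \<Rightarrow> bool" where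
  "harmonic_expansion M T a \<longleftrightarrow>
     (\<forall>x\<in>S2. (\<lambda>L. \<integral>\<^sup>+\<omega>. ennreal ((cmod (complex_of_real (T x \<omega>) -
          (\<Sum>l\<le>L. \<Sum>m = - int l..int l. a l m \<omega> * sph_harm l m x)))\<^sup>2) \<partial>M) \<longlonglongrightarrow> 0)"

definition gaussian_isotropic_model ::
    "'w measure \<Rightarrow> ('w, real) field \<Rightarrow> 'w random_coeffs \<Rightarrow> (nat \<Rightarrow> real) \<Rightarrow> bool" where
  "gaussian_isotropic_model M T a C \<longleftrightarrow>
     prob_space M \<and> random_field M T \<and> gaussian_field M T \<and> zero_mean_field M T \<and>
     isotropic_field M T \<and> admissible_spectrum C \<and> gaussian_coeffs M a C \<and>
     harmonic_expansion M T a"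

definition real_coeffs :: "complex harmonic_array \<Rightarrow> real harmonic_array" where
  "real_coeffs b l m =
     (if m = 0 then Re (b l 0)
      else if 0 < m then sqrt 2 * Re (b l m)
      else - sqrt 2 * Im (b l (- m)))"

text \<open>The two schemes are the instances for complex and for real arrays. The functional takes the
  value \<open>\<infinity>\<close> where one of its series diverges; arrays vanish outside the index set.\<close>

definition penalized_cost ::
    "real \<Rightarrow> ('a :: real_normed_vector) harmonic_array \<Rightarrow> 'a harmonic_array \<Rightarrow> ennreal" where
  "penalized_cost lam b a =
     ennreal lam * (\<Sum>\<^sub>\<infinity>(l, m)\<in>harmonic_indices. ennreal (norm (a l m))) +
     (\<Sum>\<^sub>\<infinity>(l, m)\<in>harmonic_indices. ennreal ((norm (b l m - a l m))\<^sup>2)) / 2"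

definition regularize ::
    "real \<Rightarrow> ('a :: real_normed_vector) harmonic_array \<Rightarrow> 'a harmonic_array" where
  "regularize lam b =
     (ARG_MIN (penalized_cost lam b) a. \<forall>l m. (l, m) \<notin> harmonic_indices \<longrightarrow> a l m = 0)"

definition reg_coeff :: "real \<Rightarrow> 'w random_coeffs \<Rightarrow> nat \<Rightarrow> int \<Rightarrow> 'w \<Rightarrow> complex" where
  "reg_coeff lam a l m \<omega> = regularize lam (\<lambda>l m. a l m \<omega>) l m"

definition reg_coeff_real :: "real \<Rightarrow> 'w random_coeffs \<Rightarrow> nat \<Rightarrow> int \<Rightarrow> 'w \<Rightarrow> real" where
  "reg_coeff_real lam a l m \<omega> = regularize lam (real_coeffs (\<lambda>l m. a l m \<omega>)) l m"

definition reg_component :: "real \<Rightarrow> 'w random_coeffs \<Rightarrow> nat \<Rightarrow> ('w, complex) field" where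
  "reg_component lam a l x \<omega> = (\<Sum>m = - int l..int l. reg_coeff lam a l m \<omega> * sph_harm l m x)"

definition reg_field :: "real \<Rightarrow> 'w random_coeffs \<Rightarrow> ('w, complex) field" where
  "reg_field lam a x \<omega> = (\<Sum>l. reg_component lam a l x \<omega>)"

definition reg_field_real :: "real \<Rightarrow> 'w random_coeffs \<Rightarrow> ('w, real) field" where
  "reg_field_real lam a x \<omega> =
     (\<Sum>l. \<Sum>m = - int l..int l. reg_coeff_real lam a l m \<omega> * sph_harm_real l m x)"

definition Phi :: "real \<Rightarrow> real" where
  "Phi = cdf std_normal_distribution"

text \<open>The first argument \<open>c\<close> is the prefactor \<open>C\<^sub>l\<close>, the second one \<open>t\<close> the
  ratio \<open>lam / sqrt C\<^sub>l\<close>.\<close>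

definition gamma0 :: "real \<Rightarrow> real \<Rightarrow> real" where
  "gamma0 c t = c * (2 * (1 + t\<^sup>2) * (1 - Phi t) - exp (- t\<^sup>2 / 2) * t * sqrt (2 / pi))"

definition gamma1 :: "real \<Rightarrow> real \<Rightarrow> real" where
  "gamma1 c t = c * (exp (- t\<^sup>2) - 2 * sqrt pi * t * (1 - Phi (sqrt 2 * t)))"

text \<open>The limit \<open>lam / sqrt (C l) \<rightarrow> \<infinity>\<close> is taken jointly over all models, all penalizations
  and all multipoles \<open>l \<in> L\<close>: a property holds eventually iff there is a bound \<open>R\<close> such that it
  holds whenever \<open>lam / sqrt (C l) \<ge> R\<close>.\<close>

definition large_ratio ::
    "nat set \<Rightarrow> ('w measure \<times> ('w, real) field \<times> 'w random_coeffs \<times> (nat \<Rightarrow> real) \<times> real \<times> nat) filter"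
  where
  "large_ratio L =
     inf (filtercomap (\<lambda>(M, T, a, C, lam, l). lam / sqrt (C l)) at_top)
         (principal {(M, T, a, C, lam, l). gaussian_isotropic_model M T a C \<and> 0 < lam \<and> l \<in> L})"

lemma eventually_large_ratio:
  "eventually P (large_ratio L) \<longleftrightarrow>
     (\<exists>R. \<forall>M T a C lam l. gaussian_isotropic_model M T a C \<and> 0 < lam \<and> l \<in> L \<and>
            R \<le> lam / sqrt (C l) \<longrightarrow> P (M, T, a, C, lam, l))"
  unfolding large_ratio_def eventually_inf_principal eventually_filtercomap_at_top_linorder
  by (auto simp: imp_conjL) blast+

text \<open>In particular the limit covers a fixed field with growing penalization.\<close>

lemma large_ratio_fixed_field:
  assumes "gaussian_isotropic_model M T a C" "l \<in> L"
  shows "filterlim (\<lambda>lam. (M, T, a, C, lam, l)) (large_ratio L) at_top"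
proof -
  have pos: "0 < sqrt (C l)"
    using assms by (simp add: gaussian_isotropic_model_def admissible_spectrum_def)
  have "\<forall>\<^sub>F lam in at_top. P (M, T, a, C, lam, l)" if P: "eventually P (large_ratio L)" for P
  proof -
    obtain R where R: "\<And>lam. 0 < lam \<Longrightarrow> R \<le> lam / sqrt (C l) \<Longrightarrow> P (M, T, a, C, lam, l)"
      using P assms unfolding eventually_large_ratio by blast
    show ?thesis
      using eventually_ge_at_top[of "R * sqrt (C l)"] eventually_gt_at_top[of 0]
      by eventually_elim (use pos in \<open>auto intro!: R simp: field_simps\<close>)
  qed
  then show ?thesis
    by (simp add: filterlim_iff)
qed

end

theory Submission
  imports Defs "HOL-Real_Asymp.Real_Asymp"
begin

text \<open>
The minimizer of the penalized functional is the coefficientwise soft threshold, so the moments are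
Gaussian integrals of \<open>(|Z| - t)\<^sub>+\<^sup>2\<close>. For the qualitative statement compare zero sets. At the North
Pole only the coefficients with \<open>m = 0\<close> matter, so there the regularized field vanishes whenever all
\<open>a\<^sub>l\<^sub>0\<close> are below the threshold. At a point \<open>x\<close> where neither \<open>Y\<^sub>1\<^sub>1\<close> nor any \<open>Y\<^sub>l\<^sub>0\<close> vanishes, independence
and absolute continuity show that the field can almost surely vanish only on that same event, from which
the event that \<open>a\<^sub>1\<^sub>1\<close> alone exceeds the threshold, of positive probability, has to be removed. Hence the
probability of the value \<open>0\<close> depends on the point, and at \<open>x\<close> it is neither \<open>0\<close> nor \<open>1\<close>, which excludes
a Gaussian law as well.
\<close>

section \<open>Soft thresholding\<close>

text \<open>Infinitely many coefficients enter at every point, and summability keeps this under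
  control. Degree l contributes 2l+1 coefficients and \<alpha> > 2, so the data are almost surely
  square summable; only finitely many of them exceed the threshold and every regularized series is
  almost surely a finite sum. Through Chebyshev's inequality the tail probabilities are summable
  too, which lets constraints on all coefficients at once keep positive probability. A thresholded
  real Gaussian has an atom at 0 but nowhere else, so a nonzero zonal term cannot be cancelled by
  independent terms: this is why vanishing at \<open>x\<close> forces every zonal term to vanish.
  The point is taken at longitude 0, where the harmonics with m \<ge> 0 are real, so that one real
  series in independent coefficients serves both schemes. The rates in the limits differ because of
  the spread of the variance: for m = 0 it sits in one real Gaussian, with tail of order exp
  (-t^2/2), while for m \<noteq> 0 it is split over two components and the modulus has tail exp
  (-t^2), where t = lam / sqrt C.\<close>

definition soft :: "real \<Rightarrow> 'a \<Rightarrow> 'a :: real_normed_vector" where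
  "soft lam b = max 0 (1 - lam / norm b) *\<^sub>R b"

text \<open>At \<open>b = 0\<close> division by zero yields the factor 1 in \<open>soft\<close>,
  which is harmless since it multiplies the zero vector.\<close>

lemma norm_soft:
  assumes "0 < lam"
  shows "norm (soft lam b) = max 0 (norm b - lam)"
  using assms by (cases "b = 0") (auto simp: soft_def max_def field_simps)

lemma soft_eq_0_iff:
  assumes "0 < lam"
  shows "soft lam b = 0 \<longleftrightarrow> norm b \<le> lam"
  using norm_soft[OF assms, of b] by (auto simp: max_def split: if_splits)

lemma soft_of_real: "soft lam (complex_of_real x) = complex_of_real (soft lam x)"
  by (simp add: soft_def scaleR_conv_of_real)

lemma soft_cnj: "soft lam (cnj z) = cnj (soft lam z)"
  by (simp add: soft_def)

lemma soft_uminus: "soft lam (- z) = - soft lam z"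
  by (simp add: soft_def)

lemma borel_measurable_soft [measurable]:
  "soft lam \<in> borel_measurable (borel :: 'a :: {second_countable_topology, real_normed_vector} measure)"
  unfolding soft_def by measurable

text \<open>The last term on the left, due to strong convexity, makes the minimizer unique.\<close>

lemma soft_minimizes:
  fixes b z :: "'a :: real_inner"
  assumes "0 < lam"
  shows "lam * norm (soft lam b) + (norm (b - soft lam b))\<^sup>2 / 2 + (norm (z - soft lam b))\<^sup>2 / 2
         \<le> lam * norm z + (norm (b - z))\<^sup>2 / 2"
proof -
  define s where "s = soft lam b"
  \<comment> \<open>Optimality condition: the residual \<open>b - s\<close> is \<open>lam\<close>
    times a subgradient of the norm at \<open>s\<close>. The inequality expresses that its norm is
    at most \<open>lam\<close>, the equality that it is aligned with \<open>s\<close>.\<close>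
  have "(b - s) \<bullet> z \<le> lam * norm z \<and> (b - s) \<bullet> s = lam * norm s"
  proof (cases "norm b \<le> lam")
    case True
    then have "s = 0" using soft_eq_0_iff[OF assms, of b] by (simp add: s_def)
    moreover have "b \<bullet> z \<le> lam * norm z"
      using norm_cauchy_schwarz[of b z] True mult_right_mono[OF True, of "norm z"] by simp
    ultimately show ?thesis by simp
  next
    case False
    then have nb: "norm b > lam" "norm b > 0" using assms by auto
    have s: "s = (1 - lam / norm b) *\<^sub>R b" using nb by (simp add: s_def soft_def max_def)
    have bs: "b - s = (lam / norm b) *\<^sub>R b"
      by (simp add: s algebra_simps)
    have "(lam / norm b) * (b \<bullet> z) \<le> (lam / norm b) * (norm b * norm z)"
      using nb assms by (intro mult_left_mono norm_cauchy_schwarz) auto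
    moreover have "(b - s) \<bullet> s = lam * norm s"
      unfolding bs norm_soft[OF assms, of b, folded s_def] using nb
      by (simp add: s max_def dot_square_norm power2_eq_square field_simps)
    ultimately show ?thesis using nb by (simp add: bs)
  qed
  \<comment> \<open>Expanding around \<open>s\<close> leaves a cross term, which the two facts bound
    by \<open>lam * norm z - lam * norm s\<close>.\<close>
  moreover have "(norm (b - z))\<^sup>2 = (norm (b - s))\<^sup>2 + (norm (z - s))\<^sup>2 - 2 * ((b - s) \<bullet> (z - s))"
    by (simp add: power2_norm_eq_inner algebra_simps inner_commute)
  ultimately show ?thesis
    unfolding s_def[symmetric] inner_diff_right by argo
qed

section \<open>Extended-valued series and the penalized cost\<close>

lemma infsum_ennreal_finite_iff:
  assumes "\<And>i. i \<in> A \<Longrightarrow> 0 \<le> f i"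
  shows "(\<Sum>\<^sub>\<infinity>i\<in>A. ennreal (f i)) < \<infinity> \<longleftrightarrow> f summable_on A"
proof
  assume L: "(\<Sum>\<^sub>\<infinity>i\<in>A. ennreal (f i)) < \<infinity>"
  define S where "S = enn2real (\<Sum>\<^sub>\<infinity>i\<in>A. ennreal (f i))"
  have "sum f F \<le> S" if "finite F" "F \<subseteq> A" for F
  proof -
    have "ennreal (sum f F) = (\<Sum>i\<in>F. ennreal (f i))"
      using that assms by (intro sum_ennreal[symmetric]) auto
    also have "\<dots> \<le> (\<Sum>\<^sub>\<infinity>i\<in>A. ennreal (f i))"
      using that by (subst nonneg_infsum_complete) (auto intro!: SUP_upper)
    also have "\<dots> = ennreal S" using L by (simp add: S_def)
    finally show ?thesis
      using L by (simp add: S_def ennreal_le_iff)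
  qed
  then show "f summable_on A"
    using assms by (intro nonneg_bdd_above_summable_on bdd_aboveI2[where M = S]) auto
next
  assume R: "f summable_on A"
  have "(\<Sum>\<^sub>\<infinity>i\<in>A. ennreal (f i)) \<le> ennreal (infsum f A)"
  proof (subst nonneg_infsum_complete, simp, rule SUP_least)
    fix F assume "F \<in> {F. finite F \<and> F \<subseteq> A}"
    then show "(\<Sum>i\<in>F. ennreal (f i)) \<le> ennreal (infsum f A)"
      using assms R by (subst sum_ennreal) (auto intro!: ennreal_leI finite_sum_le_infsum)
  qed
  then show "(\<Sum>\<^sub>\<infinity>i\<in>A. ennreal (f i)) < \<infinity>"
    using order_le_less_trans by fastforce
qed

lemma penalized_cost_finite_iff:
  assumes "0 < lam"
  shows "penalized_cost lam b a < \<infinity> \<longleftrightarrow>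
    (\<lambda>(l, m). norm (a l m)) summable_on harmonic_indices \<and>
    (\<lambda>(l, m). (norm (b l m - a l m))\<^sup>2) summable_on harmonic_indices"
proof -
  have "penalized_cost lam b a < \<infinity> \<longleftrightarrow>
     (\<Sum>\<^sub>\<infinity>i\<in>harmonic_indices. ennreal (case i of (l, m) \<Rightarrow> norm (a l m))) < \<infinity> \<and>
     (\<Sum>\<^sub>\<infinity>i\<in>harmonic_indices. ennreal (case i of (l, m) \<Rightarrow> (norm (b l m - a l m))\<^sup>2)) < \<infinity>"
    using assms unfolding penalized_cost_def
    by (simp add: split_def ennreal_mult_less_top ennreal_divide_eq_top_iff less_top[symmetric]
        ennreal_mult_eq_top_iff)
  also have "\<dots> \<longleftrightarrow> (\<lambda>(l, m). norm (a l m)) summable_on harmonic_indices \<and>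
    (\<lambda>(l, m). (norm (b l m - a l m))\<^sup>2) summable_on harmonic_indices"
    by (subst (1 2) infsum_ennreal_finite_iff) auto
  finally show ?thesis .
qed

lemma infsum_ennreal_eq:
  assumes "f summable_on A" "\<And>i. i \<in> A \<Longrightarrow> 0 \<le> f i"
  shows "(\<Sum>\<^sub>\<infinity>i\<in>A. ennreal (f i)) = ennreal (infsum f A)"
proof -
  have "(\<Sum>i\<in>F. ennreal (f i)) = ennreal (sum f F)" if "F \<subseteq> A" for F
    using assms(2) that by (intro sum_ennreal) auto
  then show ?thesis
    using infsum_nonneg_is_SUPREMUM_ennreal[OF assms]
    by (subst nonneg_infsum_complete) (auto cong: SUP_cong_simp)
qed

text \<open>Where it is finite, the cost becomes one real series with a separate summand for each
  coefficient, so that coefficientwise comparisons can be summed and differences taken.\<close>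

lemma penalized_cost_eq:
  assumes "0 < lam" "penalized_cost lam b a < \<infinity>"
  defines "g \<equiv> (\<lambda>(l, m). lam * norm (a l m) + (norm (b l m - a l m))\<^sup>2 / 2)"
  shows "g summable_on harmonic_indices"
    and "penalized_cost lam b a = ennreal (infsum g harmonic_indices)"
proof -
  have s: "(\<lambda>(l, m). norm (a l m)) summable_on harmonic_indices"
    "(\<lambda>(l, m). (norm (b l m - a l m))\<^sup>2) summable_on harmonic_indices"
    using penalized_cost_finite_iff[OF assms(1)] assms(2) by blast+
  note s1 = summable_on_cmult_right[OF s(1), of lam] and s2 = summable_on_cmult_left[OF s(2), of "1 / 2"]
  have g: "g = (\<lambda>i. lam * (\<lambda>(l, m). norm (a l m)) i + (\<lambda>(l, m). (norm (b l m - a l m))\<^sup>2) i * (1 / 2))"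
    by (auto simp: g_def)
  show "g summable_on harmonic_indices"
    unfolding g by (intro summable_on_add s1 s2)
  have "infsum g harmonic_indices = lam * infsum (\<lambda>(l, m). norm (a l m)) harmonic_indices
     + infsum (\<lambda>(l, m). (norm (b l m - a l m))\<^sup>2) harmonic_indices / 2"
    unfolding g by (subst infsum_add[OF s1 s2]) (simp add: infsum_cmult_right' infsum_cmult_left' del: times_divide_eq_right)
  moreover have "0 \<le> infsum (\<lambda>(l, m). norm (a l m)) harmonic_indices"
    "0 \<le> infsum (\<lambda>(l, m). (norm (b l m - a l m))\<^sup>2) harmonic_indices"
    by (auto intro!: infsum_nonneg)
  moreover have "penalized_cost lam b a = ennreal lam * ennreal (infsum (\<lambda>(l, m). norm (a l m)) harmonic_indices)
     + ennreal (infsum (\<lambda>(l, m). (norm (b l m - a l m))\<^sup>2) harmonic_indices) / 2"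
    unfolding penalized_cost_def
    by (subst (1 2) infsum_ennreal_eq[symmetric]) (use s in \<open>auto simp: split_def\<close>)
  ultimately show "penalized_cost lam b a = ennreal (infsum g harmonic_indices)"
    using assms(1) by (simp add: ennreal_mult'' ennreal_plus divide_ennreal[symmetric] flip: ennreal_numeral)
qed

text \<open>The cost decouples, so minimizing each summand minimizes the whole, provided that costs
  are finite. Square summability of the data gives the zero array finite cost, and the thresholded
  array \<open>s\<close> is termwise no more expensive.\<close>

lemma regularize_soft:
  fixes b :: "'a :: real_inner harmonic_array"
  assumes lam: "0 < lam" and b: "(\<lambda>(l, m). (norm (b l m))\<^sup>2) summable_on harmonic_indices"
  shows "regularize lam b l m = (if (l, m) \<in> harmonic_indices then soft lam (b l m) else 0)"
proof -
  define s where "s = (\<lambda>l m. if (l, m) \<in> harmonic_indices then soft lam (b l m) else 0)"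
  define g where "g a = (\<lambda>(l, m). lam * norm (a l m) + (norm (b l m - a l m))\<^sup>2 / 2)" for a
  let ?P = "\<lambda>a :: 'a harmonic_array. \<forall>l m. (l, m) \<notin> harmonic_indices \<longrightarrow> a l m = 0"
  let ?K = "penalized_cost lam b"
  have le: "g s i + (\<lambda>(l, m). (norm (a l m - s l m))\<^sup>2 / 2) i \<le> g a i" if "i \<in> harmonic_indices" for a i
    using soft_minimizes[OF lam, of "b (fst i) (snd i)" "a (fst i) (snd i)"] that
    by (auto simp: g_def s_def split: prod.splits)
  have "?K (\<lambda>l m. 0) < \<infinity>"
    unfolding penalized_cost_finite_iff[OF lam] using b by (simp add: split_def)
  have gs: "g s summable_on harmonic_indices"
  proof (rule summable_on_comparison_test)
    show "g (\<lambda>l m. 0) summable_on harmonic_indices"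
      using penalized_cost_eq(1)[OF lam \<open>?K (\<lambda>l m. 0) < \<infinity>\<close>] by (simp add: g_def)
    show "g s i \<le> g (\<lambda>l m. 0) i" if "i \<in> harmonic_indices" for i
      using le[OF that, of "\<lambda>l m. 0"] by (auto split: prod.splits intro: order_trans[rotated])
    show "0 \<le> g s i" for i using lam by (auto simp: g_def split: prod.splits)
  qed
  have Ks: "?K s < \<infinity>"
  proof -
    have "(\<lambda>(l, m). norm (s l m)) summable_on harmonic_indices"
      by (rule summable_on_comparison_test[OF summable_on_cmult_right[OF gs, of "1 / lam"]])
         (use lam in \<open>auto simp: g_def field_simps\<close>)
    moreover have "(\<lambda>(l, m). (norm (b l m - s l m))\<^sup>2) summable_on harmonic_indices"
      by (rule summable_on_comparison_test[OF summable_on_cmult_right[OF gs, of 2]])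
         (use lam in \<open>auto simp: g_def field_simps\<close>)
    ultimately show ?thesis
      unfolding penalized_cost_finite_iff[OF lam] by simp
  qed
  \<comment> \<open>The quadratic gain in \<open>soft_minimizes\<close> makes the gap strictly
    positive at an index where \<open>a\<close> differs from \<open>s\<close>; one such index
    already separates the two real series.\<close>
  have less: "?K s < ?K a" if a: "?P a" "a \<noteq> s" for a
  proof (cases "?K a < \<infinity>")
    case True
    have ngs: "(\<lambda>i. - g s i) summable_on harmonic_indices" using gs by (simp add: summable_on_uminus)
    note sa = penalized_cost_eq[OF lam True, folded g_def]
    obtain l m where lm: "a l m \<noteq> s l m" using a(2) by blast
    then have H: "(l, m) \<in> harmonic_indices" using a(1) by (auto simp: s_def split: if_splits)
    have "0 < g a (l, m) - g s (l, m)"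
    proof -
      have "0 < (norm (a l m - s l m))\<^sup>2" using lm by simp
      then show ?thesis using le[OF H, of a] by (simp only: prod.case)
    qed
    also have "\<dots> \<le> infsum (\<lambda>i. g a i + - g s i) harmonic_indices"
    proof -
      have "0 \<le> g a i + - g s i" if "i \<in> harmonic_indices" for i
        using le[OF that, of a] by (auto split: prod.splits intro: order_trans[rotated])
      then show ?thesis
        using finite_sum_le_infsum[OF summable_on_add[OF sa(1) ngs], of "{(l, m)}"] H by simp
    qed
    also have "\<dots> = infsum (g a) harmonic_indices - infsum (g s) harmonic_indices"
      by (subst infsum_add[OF sa(1) ngs]) (simp add: infsum_uminus)
    finally have "infsum (g s) harmonic_indices < infsum (g a) harmonic_indices" by simp
    moreover have "0 \<le> infsum (g s) harmonic_indices"
      using lam by (auto simp: g_def intro!: infsum_nonneg)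
    ultimately show ?thesis
      unfolding sa(2) penalized_cost_eq(2)[OF lam Ks, folded g_def]
      by (simp add: ennreal_less_iff)
  next
    case False
    with Ks show ?thesis by (simp add: less_top)
  qed
  have Ps: "?P s" by (simp add: s_def)
  \<comment> \<open>Uniqueness leaves the choice operator inside \<open>arg_min\<close> with a
    single candidate.\<close>
  have "is_arg_min ?K ?P = (\<lambda>a. a = s)"
  proof (rule ext, rule iffI)
    fix a assume "is_arg_min ?K ?P a"
    then have "?P a" "\<nexists>y. ?P y \<and> ?K y < ?K a" unfolding is_arg_min_def by auto
    then show "a = s" using less[of a] Ps by blast
  next
    fix a assume a: "a = s"
    have "\<not> ?K y < ?K s" if "?P y" for y
      using less[OF that] by (cases "y = s") (auto dest: order.asym)
    with Ps show "is_arg_min ?K ?P a" unfolding is_arg_min_def a by blast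
  qed
  then have "regularize lam b = s"
    unfolding regularize_def arg_min_def by simp
  then show ?thesis by (simp add: s_def)
qed

text \<open>If the data are not square summable, every array costs \<open>\<infinity>\<close>, so the minimizer is an
  arbitrary array that does not depend on the data.\<close>

lemma regularize_not_summable:
  fixes b :: "'a :: real_inner harmonic_array"
  assumes lam: "0 < lam" and b: "\<not> (\<lambda>(l, m). (norm (b l m))\<^sup>2) summable_on harmonic_indices"
  shows "regularize lam b = (SOME a. \<forall>l m. (l, m) \<notin> harmonic_indices \<longrightarrow> a l m = 0)"
proof -
  have "penalized_cost lam b a = \<infinity>" for a
  proof (rule ccontr)
    assume "penalized_cost lam b a \<noteq> \<infinity>"
    then have s1: "(\<lambda>(l, m). norm (a l m)) summable_on harmonic_indices"
      and s2: "(\<lambda>(l, m). (norm (b l m - a l m))\<^sup>2) summable_on harmonic_indices"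
      using penalized_cost_finite_iff[OF lam, of b a] by (auto simp: less_top)
    \<comment> \<open>An array of finite cost is summable, hence bounded by \<open>N\<close> and
      therefore square summable; then \<open>b = (b - a) + a\<close> would be square summable as
      well.\<close>
    define N where "N = infsum (\<lambda>(l, m). norm (a l m)) harmonic_indices"
    have N: "norm (a l m) \<le> N" if "(l, m) \<in> harmonic_indices" for l m
      using finite_sum_le_infsum[OF s1, of "{(l, m)}"] that by (auto simp: N_def)
    have "(\<lambda>(l, m). (norm (b l m))\<^sup>2) summable_on harmonic_indices"
    proof (rule summable_on_comparison_test)
      show "(\<lambda>i. 2 * (\<lambda>(l, m). (norm (b l m - a l m))\<^sup>2) i + 2 * N * (\<lambda>(l, m). norm (a l m)) i)
          summable_on harmonic_indices"
        by (intro summable_on_add summable_on_cmult_right s1 s2)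
      fix i assume i: "i \<in> harmonic_indices"
      obtain l m where [simp]: "i = (l, m)" by (cases i)
      have "norm (b l m) \<le> norm (b l m - a l m) + norm (a l m)"
        by (metis diff_add_cancel norm_triangle_ineq)
      then have "(norm (b l m))\<^sup>2 \<le> (norm (b l m - a l m) + norm (a l m))\<^sup>2"
        by (intro power_mono) auto
      also have "\<dots> \<le> 2 * (norm (b l m - a l m))\<^sup>2 + 2 * (norm (a l m))\<^sup>2"
        using sum_squares_bound[of "norm (b l m - a l m)" "norm (a l m)"] by (simp add: power2_sum)
      also have "(norm (a l m))\<^sup>2 \<le> N * norm (a l m)"
        using N[of l m] i by (simp add: power2_eq_square mult_right_mono)
      finally show "(\<lambda>(l, m). (norm (b l m))\<^sup>2) i
        \<le> 2 * (\<lambda>(l, m). (norm (b l m - a l m))\<^sup>2) i + 2 * N * (\<lambda>(l, m). norm (a l m)) i" by simp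
    qed auto
    with b show False by simp
  qed
  then show ?thesis
    unfolding regularize_def arg_min_def is_arg_min_def by simp
qed

section \<open>Gaussian integrals\<close>

lemma std_normal_density_eq: "std_normal_density x = exp (- x\<^sup>2 / 2) / sqrt (2 * pi)"
  by (simp add: normal_density_def)

lemma DERIV_exp_half_square:
  "DERIV (\<lambda>x. exp (- x\<^sup>2 / 2)) x :> - x * exp (- x\<^sup>2 / 2 :: real)"
  by (auto intro!: derivative_eq_intros)

lemma DERIV_std_normal_density: "DERIV std_normal_density x :> - x * std_normal_density x"
  using DERIV_cdivide[OF DERIV_exp_half_square, of "sqrt (2 * pi)"]
  by (simp add: std_normal_density_eq[abs_def])

text \<open>\<open>Phi\<close> is given as the distribution function of a measure. Integrating over
  half-open intervals shows that it has the same increments as an antiderivative of the density, so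
  the two differ by a constant.\<close>

lemma DERIV_Phi: "DERIV Phi x :> std_normal_density x"
proof -
  interpret real_distribution std_normal_distribution by (rule real_dist_normal_dist)
  obtain F where F: "\<And>x. DERIV F x :> std_normal_density x"
    using einterval_antiderivative[of "-\<infinity>" \<infinity> std_normal_density]
    by (auto simp: has_real_derivative_iff_has_vector_derivative
        intro!: DERIV_isCont[OF DERIV_std_normal_density])
  have eq: "Phi y - Phi a = F y - F a" if "a \<le> y" for a y
  proof (cases "a = y")
    case False
    with that have "a < y" by simp
    have le: "F a \<le> F y"
      by (rule DERIV_nonneg_imp_nondecreasing[OF that]) (use F normal_density_nonneg in blast)
    have "emeasure std_normal_distribution {a<..y}
        = (\<integral>\<^sup>+x. ennreal (std_normal_density x) * indicator {a<..y} x \<partial>lborel)"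
      by (simp add: emeasure_density)
    also have "\<dots> = (\<integral>\<^sup>+x. ennreal (std_normal_density x) * indicator {a..y} x \<partial>lborel)"
      by (intro nn_integral_cong_AE AE_I[where N = "{a}"]) (auto split: split_indicator)
    also have "\<dots> = ennreal (F y - F a)"
      by (rule nn_integral_FTC_Icc) (use that F in auto)
    finally show ?thesis
      unfolding Phi_def cdf_diff_eq[OF \<open>a < y\<close>] using le by (simp add: measure_def)
  qed simp
  have "Phi = (\<lambda>y. F y + (Phi 0 - F 0))"
  proof
    show "Phi y = F y + (Phi 0 - F 0)" for y
      using eq[of 0 y] eq[of y 0] by (cases "0 \<le> y") auto
  qed
  moreover have "DERIV (\<lambda>y. F y + (Phi 0 - F 0)) x :> std_normal_density x"
    using F[of x] by (auto intro!: derivative_eq_intros)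
  ultimately show ?thesis by simp
qed

lemma Phi_at_top: "(Phi \<longlongrightarrow> 1) at_top"
proof -
  interpret real_distribution std_normal_distribution by (rule real_dist_normal_dist)
  show ?thesis unfolding Phi_def by (rule cdf_lim_at_top_prob)
qed

lemma Phi_le_1: "Phi x \<le> 1"
proof -
  interpret real_distribution std_normal_distribution by (rule real_dist_normal_dist)
  show ?thesis unfolding Phi_def by (rule cdf_bounded_prob)
qed

lemma Phi_ge_0: "0 \<le> Phi x"
  by (simp add: Phi_def cdf_def)

text \<open>\<open>L - F t\<close> is the integral of \<open>f\<close> from \<open>t\<close> to
  infinity. The mean value theorem bounds it below by the part over \<open>[t + 1, t + 2]\<close>,
  an interval at distance 1 from \<open>t\<close> because the integrands to come carry a factor
  \<open>(x - t)^2\<close>. With \<open>c = 0\<close> it yields nonnegativity.\<close>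

lemma limit_minus_ge:
  fixes F f :: "real \<Rightarrow> real"
  assumes D: "\<And>x. t \<le> x \<Longrightarrow> DERIV F x :> f x" and f: "\<And>x. t \<le> x \<Longrightarrow> 0 \<le> f x"
    and lim: "(F \<longlongrightarrow> L) at_top" and c: "\<And>x. t + 1 \<le> x \<Longrightarrow> x \<le> t + 2 \<Longrightarrow> c \<le> f x"
  shows "c \<le> L - F t"
proof -
  have mono: "F x \<le> F y" if "t \<le> x" "x \<le> y" for x y
    by (rule DERIV_nonneg_imp_nondecreasing[OF that(2)]) (use D f that in \<open>meson order_trans\<close>)
  have "F (t + 2) \<le> L"
    by (rule tendsto_lowerbound[OF lim])
       (auto intro!: eventually_mono[OF eventually_ge_at_top[of "t + 2"]] mono)
  moreover obtain z where "t + 1 < z" "z < t + 2" "F (t + 2) - F (t + 1) = (t + 2 - (t + 1)) * f z"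
    using MVT2[of "t + 1" "t + 2" F f] D by auto
  moreover have "F t \<le> F (t + 1)" by (rule mono) auto
  ultimately show ?thesis using c[of z] by simp
qed

section \<open>Integrals of even and of radial functions\<close>

lemma nn_integral_even:
  fixes f :: "real \<Rightarrow> ennreal"
  assumes [measurable]: "f \<in> borel_measurable borel" and even: "\<And>x. f (- x) = f x"
  shows "(\<integral>\<^sup>+x. f x \<partial>lborel) = 2 * (\<integral>\<^sup>+x. f x * indicator {0..} x \<partial>lborel)"
proof -
  have "(\<integral>\<^sup>+x. f x \<partial>lborel) = (\<integral>\<^sup>+x. f x * indicator {0..} x + f x * indicator {..<0} x \<partial>lborel)"
    by (intro nn_integral_cong) (auto split: split_indicator)
  also have "\<dots> = (\<integral>\<^sup>+x. f x * indicator {0..} x \<partial>lborel) + (\<integral>\<^sup>+x. f x * indicator {..<0} x \<partial>lborel)"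
    by (rule nn_integral_add) auto
  also have "(\<integral>\<^sup>+x. f x * indicator {..<0} x \<partial>lborel) = (\<integral>\<^sup>+x. f x * indicator {0<..} x \<partial>lborel)"
    by (subst nn_integral_real_affine[where c = "-1" and t = 0])
       (auto simp: even intro!: nn_integral_cong split: split_indicator)
  also have "\<dots> = (\<integral>\<^sup>+x. f x * indicator {0..} x \<partial>lborel)"
    by (intro nn_integral_cong_AE AE_I[where N = "{0}"]) (auto split: split_indicator)
  finally show ?thesis by (simp add: mult_2)
qed

lemma nn_integral_inverse_1_plus_square:
  "(\<integral>\<^sup>+s. ennreal (1 / (1 + s\<^sup>2)) \<partial>lborel) = ennreal pi"
proof -
  have "(\<integral>\<^sup>+s. ennreal (1 / (1 + s\<^sup>2)) * indicator {0..} s \<partial>lborel) = ennreal (pi / 2 - arctan 0)"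
    by (rule nn_integral_FTC_atLeast)
       (auto intro!: derivative_eq_intros tendsto_arctan_at_top simp: inverse_eq_divide)
  then show ?thesis
    by (subst nn_integral_even) (auto simp: ennreal_mult[symmetric] simp flip: ennreal_numeral)
qed

text \<open>Integration in polar coordinates, carried out with affine substitutions only: put
  \<open>y = x s\<close>, exchange the integrals, and rescale \<open>x\<close> by \<open>sqrt (1 + s\<^sup>2)\<close>.\<close>

lemma nn_integral_radial:
  fixes g :: "real \<Rightarrow> ennreal"
  assumes [measurable]: "g \<in> borel_measurable borel"
  shows "(\<integral>\<^sup>+x. \<integral>\<^sup>+y. g (sqrt (x\<^sup>2 + y\<^sup>2)) \<partial>lborel \<partial>lborel)
       = ennreal (2 * pi) * (\<integral>\<^sup>+r. ennreal r * g r * indicator {0..} r \<partial>lborel)"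
proof -
  let ?h = "\<lambda>x s. ennreal \<bar>x\<bar> * g (\<bar>x\<bar> * sqrt (1 + s\<^sup>2))"
  define I where "I = (\<integral>\<^sup>+r. ennreal \<bar>r\<bar> * g \<bar>r\<bar> \<partial>lborel)"
  have "(\<integral>\<^sup>+y. g (sqrt (x\<^sup>2 + y\<^sup>2)) \<partial>lborel) = (\<integral>\<^sup>+s. ?h x s \<partial>lborel)" if "x \<noteq> 0" for x
  proof -
    have *: "sqrt (x\<^sup>2 + (x * s)\<^sup>2) = \<bar>x\<bar> * sqrt (1 + s\<^sup>2)" for s
    proof -
      have "x\<^sup>2 + (x * s)\<^sup>2 = x\<^sup>2 * (1 + s\<^sup>2)" by (simp add: power_mult_distrib algebra_simps)
      then show ?thesis by (simp add: real_sqrt_mult)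
    qed
    show ?thesis
      by (subst nn_integral_real_affine[where c = x and t = 0]) (auto simp: that * nn_integral_cmult)
  qed
  then have "(\<integral>\<^sup>+x. \<integral>\<^sup>+y. g (sqrt (x\<^sup>2 + y\<^sup>2)) \<partial>lborel \<partial>lborel) = (\<integral>\<^sup>+x. \<integral>\<^sup>+s. ?h x s \<partial>lborel \<partial>lborel)"
    by (intro nn_integral_cong_AE AE_I[where N = "{0}"]) auto
  also have "\<dots> = (\<integral>\<^sup>+s. \<integral>\<^sup>+x. ?h x s \<partial>lborel \<partial>lborel)"
    by (rule lborel_pair.Fubini'[symmetric]) auto
  also have "\<dots> = (\<integral>\<^sup>+s. ennreal (1 / (1 + s\<^sup>2)) * I \<partial>lborel)"
  proof (rule nn_integral_cong)
    fix s :: real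
    define w where "w = sqrt (1 + s\<^sup>2)"
    have w: "w > 0" "w\<^sup>2 = 1 + s\<^sup>2"
      by (auto simp: w_def add_pos_nonneg)
    have "I = ennreal w * (\<integral>\<^sup>+x. ennreal \<bar>w * x\<bar> * g \<bar>w * x\<bar> \<partial>lborel)"
      unfolding I_def by (subst nn_integral_real_affine[where c = w and t = 0]) (use w in auto)
    also have "(\<integral>\<^sup>+x. ennreal \<bar>w * x\<bar> * g \<bar>w * x\<bar> \<partial>lborel) = (\<integral>\<^sup>+x. ennreal w * ?h x s \<partial>lborel)"
      by (intro nn_integral_cong) (use w in \<open>simp add: abs_mult ennreal_mult mult.assoc mult.left_commute mult.commute flip: w_def\<close>)
    also have "\<dots> = ennreal w * (\<integral>\<^sup>+x. ?h x s \<partial>lborel)"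
      by (rule nn_integral_cmult) auto
    also have "ennreal w * (ennreal w * (\<integral>\<^sup>+x. ?h x s \<partial>lborel)) = ennreal (w\<^sup>2) * (\<integral>\<^sup>+x. ?h x s \<partial>lborel)"
      using w(1) by (simp only: power2_eq_square ennreal_mult less_imp_le mult.assoc)
    finally have "ennreal (1 / w\<^sup>2) * I = ennreal (1 / w\<^sup>2 * w\<^sup>2) * (\<integral>\<^sup>+x. ?h x s \<partial>lborel)"
      by (simp only: ennreal_mult''[OF zero_le_power2] mult.assoc)
    then show "(\<integral>\<^sup>+x. ?h x s \<partial>lborel) = ennreal (1 / (1 + s\<^sup>2)) * I"
      using w(1) unfolding w(2)[symmetric] by simp
  qed
  \<comment> \<open>The slope \<open>s = y / x\<close> contributes the total variation pi of arctan;
    the two signs of \<open>x\<close> supply the missing factor 2.\<close>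
  also have "\<dots> = ennreal pi * I"
    by (subst nn_integral_multc) (auto simp: nn_integral_inverse_1_plus_square)
  also have "I = 2 * (\<integral>\<^sup>+r. ennreal r * g r * indicator {0..} r \<partial>lborel)"
    unfolding I_def
    by (subst nn_integral_even) (auto intro!: arg_cong[where f = "(*) 2"] nn_integral_cong split: split_indicator)
  finally show ?thesis
    by (simp add: ennreal_mult mult.assoc mult.left_commute mult.commute)
qed

text \<open>Found by writing \<open>(x - t)^2\<close> as
  \<open>(x^2 - 1) - 2 * t * x + (1 + t^2)\<close> and using that the density has derivative
  \<open>- x\<close> times itself. The outer 2 accounts for both tails.\<close>

lemma gaussian_tail_DERIV:
  "DERIV (\<lambda>x. 2 * ((1 + t\<^sup>2) * Phi x - (x - 2 * t) * std_normal_density x)) x :>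
     2 * ((x - t)\<^sup>2 * std_normal_density x)"
  by (rule derivative_eq_intros DERIV_Phi DERIV_std_normal_density refl)+
     (simp add: algebra_simps power2_eq_square)

lemma gaussian_tail_limit:
  "((\<lambda>x. 2 * ((1 + t\<^sup>2) * Phi x - (x - 2 * t) * std_normal_density x)) \<longlongrightarrow> 2 * (1 + t\<^sup>2)) at_top"
proof -
  have "((\<lambda>x. (x - 2 * t) * std_normal_density x) \<longlongrightarrow> 0) at_top"
    unfolding std_normal_density_eq by real_asymp
  from tendsto_mult[OF tendsto_const tendsto_diff[OF tendsto_mult[OF tendsto_const Phi_at_top] this], of 2 "1 + t\<^sup>2"]
  show ?thesis by simp
qed

text \<open>Limit at infinity minus value at \<open>t\<close> of the antiderivative, left
  unsimplified (\<open>t - 2 * t\<close>) so that it matches verbatim both the integral and the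
  lower bound.\<close>

lemma gamma0_1_eq:
  "gamma0 1 t = 2 * (1 + t\<^sup>2) - 2 * ((1 + t\<^sup>2) * Phi t - (t - 2 * t) * std_normal_density t)"
proof -
  have "sqrt (2 / pi) = 2 / sqrt (2 * pi)"
    by (simp add: real_sqrt_divide real_sqrt_mult field_simps)
  then show ?thesis
    unfolding gamma0_def std_normal_density_eq by (simp add: field_simps)
qed

lemma gamma0_ge: "2 * std_normal_density (t + 2) \<le> gamma0 1 t" if "0 \<le> t"
  unfolding gamma0_1_eq
proof (rule limit_minus_ge[OF gaussian_tail_DERIV _ gaussian_tail_limit])
  show "2 * std_normal_density (t + 2) \<le> 2 * ((x - t)\<^sup>2 * std_normal_density x)" if x: "t + 1 \<le> x" "x \<le> t + 2" for x
  proof -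
    have "x\<^sup>2 \<le> (t + 2)\<^sup>2" using x \<open>0 \<le> t\<close> by (intro power_mono) auto
    then have "std_normal_density (t + 2) \<le> std_normal_density x"
      by (simp add: std_normal_density_eq divide_right_mono)
    moreover have "1 * std_normal_density x \<le> (x - t)\<^sup>2 * std_normal_density x"
      using x by (intro mult_right_mono) (auto intro: one_le_power)
    ultimately show ?thesis by simp
  qed
qed simp

lemma nn_integral_std_normal_soft:
  assumes "0 \<le> t"
  shows "(\<integral>\<^sup>+x. ennreal (std_normal_density x) * ennreal ((max 0 (\<bar>x\<bar> - t))\<^sup>2) \<partial>lborel) = ennreal (gamma0 1 t)"
proof -
  have "(\<integral>\<^sup>+x. ennreal (std_normal_density x) * ennreal ((max 0 (\<bar>x\<bar> - t))\<^sup>2) \<partial>lborel)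
     = 2 * (\<integral>\<^sup>+x. ennreal (std_normal_density x) * ennreal ((max 0 (\<bar>x\<bar> - t))\<^sup>2) * indicator {0..} x \<partial>lborel)"
    by (rule nn_integral_even) (auto simp: std_normal_density_eq)
  also have "\<dots> = (\<integral>\<^sup>+x. 2 * (ennreal (std_normal_density x) * ennreal ((max 0 (\<bar>x\<bar> - t))\<^sup>2) * indicator {0..} x) \<partial>lborel)"
    by (rule nn_integral_cmult[symmetric]) auto
  also have "\<dots> = (\<integral>\<^sup>+x. ennreal (2 * ((x - t)\<^sup>2 * std_normal_density x)) * indicator {t..} x \<partial>lborel)"
    by (intro nn_integral_cong)
       (use assms in \<open>auto split: split_indicator simp: max_def ennreal_mult mult.commute\<close>)
  also have "\<dots> = ennreal (gamma0 1 t)"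
    unfolding gamma0_1_eq
    by (rule nn_integral_FTC_atLeast[OF _ gaussian_tail_DERIV _ gaussian_tail_limit]) auto
  finally show ?thesis .
qed

text \<open>\<open>r * exp (- r^2 / 2)\<close> is the Rayleigh density of the modulus of a standard
  planar Gaussian. One integration by parts leaves \<open>2 * (r - s) * exp (- r^2 / 2)\<close>,
  whose part with \<open>s\<close> is the only source of \<open>Phi\<close>.\<close>

lemma rayleigh_tail_DERIV:
  "DERIV (\<lambda>r. - ((r - s)\<^sup>2 + 2) * exp (- r\<^sup>2 / 2) - 2 * s * sqrt (2 * pi) * Phi r) r :>
     r * (r - s)\<^sup>2 * exp (- r\<^sup>2 / 2)"
  by (rule DERIV_exp_half_square DERIV_Phi derivative_eq_intros refl)+
     (simp add: std_normal_density_eq algebra_simps power2_eq_square)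

lemma rayleigh_tail_limit:
  "((\<lambda>r. - ((r - s)\<^sup>2 + 2) * exp (- r\<^sup>2 / 2) - 2 * s * sqrt (2 * pi) * Phi r) \<longlongrightarrow> - 2 * s * sqrt (2 * pi)) at_top"
proof -
  have "((\<lambda>r. - ((r - s)\<^sup>2 + 2) * exp (- r\<^sup>2 / 2)) \<longlongrightarrow> 0) at_top"
    by real_asymp
  from tendsto_diff[OF this tendsto_mult[OF tendsto_const Phi_at_top], of "2 * s * sqrt (2 * pi)"]
  show ?thesis by simp
qed

text \<open>A standard planar Gaussian has total variance 2, whereas \<open>gamma1 1\<close> refers
  to total variance 1. This accounts for the factor 2 and for the threshold \<open>s\<close> being
  \<open>sqrt 2\<close> times the argument of \<open>gamma1 1\<close>.\<close>

lemma gamma1_1_eq: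
  "2 * gamma1 1 (s / sqrt 2) = - 2 * s * sqrt (2 * pi) - (- ((s - s)\<^sup>2 + 2) * exp (- s\<^sup>2 / 2) - 2 * s * sqrt (2 * pi) * Phi s)"
  unfolding gamma1_def by (simp add: power_divide real_sqrt_mult field_simps)

lemma gamma1_ge_0: "0 \<le> s \<Longrightarrow> 0 \<le> gamma1 1 (s / sqrt 2)"
  using limit_minus_ge[OF rayleigh_tail_DERIV _ rayleigh_tail_limit, of s s 0]
  unfolding gamma1_1_eq[symmetric] by simp

lemma gamma1_scaled_ge:
  assumes "0 \<le> s"
  shows "exp (- (s + 2)\<^sup>2 / 2) / 2 \<le> gamma1 1 (s / sqrt 2)"
proof -
  have "exp (- (s + 2)\<^sup>2 / 2) \<le> r * (r - s)\<^sup>2 * exp (- r\<^sup>2 / 2)" if r: "s + 1 \<le> r" "r \<le> s + 2" for r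
  proof -
    have "r\<^sup>2 \<le> (s + 2)\<^sup>2" using r assms by (intro power_mono) auto
    then have "exp (- (s + 2)\<^sup>2 / 2) \<le> 1 * 1 * exp (- r\<^sup>2 / 2)" by simp
    also have "\<dots> \<le> r * (r - s)\<^sup>2 * exp (- r\<^sup>2 / 2)"
      using r assms by (intro mult_mono) (auto intro: one_le_power)
    finally show ?thesis .
  qed
  then have "exp (- (s + 2)\<^sup>2 / 2) \<le> 2 * gamma1 1 (s / sqrt 2)"
    unfolding gamma1_1_eq
    by (intro limit_minus_ge[OF rayleigh_tail_DERIV _ rayleigh_tail_limit]) (use assms in auto)
  then show ?thesis by simp
qed

text \<open>Nonnegativity of \<open>gamma1\<close> is Mills' inequality for the Gaussian tail.\<close>

lemma Phi_tail_le:
  assumes "0 < s"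
  shows "1 - Phi s \<le> exp (- s\<^sup>2 / 2) / (s * sqrt (2 * pi))"
  using gamma1_ge_0[of s] gamma1_1_eq[of s] assms
  by (simp add: field_simps)

text \<open>The product of the two densities is radial, so the double integral reduces to the
  Rayleigh tail, and \<open>2 * pi\<close> cancels against the normalization.\<close>

lemma nn_integral_rayleigh_soft:
  assumes "0 \<le> s"
  shows "(\<integral>\<^sup>+x. \<integral>\<^sup>+y. ennreal (std_normal_density x * std_normal_density y) *
      ennreal ((max 0 (sqrt (x\<^sup>2 + y\<^sup>2) - s))\<^sup>2) \<partial>lborel \<partial>lborel) = ennreal (2 * gamma1 1 (s / sqrt 2))"
proof -
  let ?g = "\<lambda>r. ennreal (exp (- r\<^sup>2 / 2) / (2 * pi) * (max 0 (r - s))\<^sup>2)"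
  have "(\<integral>\<^sup>+x. \<integral>\<^sup>+y. ennreal (std_normal_density x * std_normal_density y) *
      ennreal ((max 0 (sqrt (x\<^sup>2 + y\<^sup>2) - s))\<^sup>2) \<partial>lborel \<partial>lborel)
     = (\<integral>\<^sup>+x. \<integral>\<^sup>+y. ?g (sqrt (x\<^sup>2 + y\<^sup>2)) \<partial>lborel \<partial>lborel)"
  proof (intro nn_integral_cong)
    fix x y :: real
    have "- (x\<^sup>2 + y\<^sup>2) / 2 = - x\<^sup>2 / 2 + - y\<^sup>2 / 2" by simp
    then have "std_normal_density x * std_normal_density y = exp (- (x\<^sup>2 + y\<^sup>2) / 2) / (2 * pi)"
      by (simp only: std_normal_density_eq exp_add) simp
    then show "ennreal (std_normal_density x * std_normal_density y) *
        ennreal ((max 0 (sqrt (x\<^sup>2 + y\<^sup>2) - s))\<^sup>2) = ?g (sqrt (x\<^sup>2 + y\<^sup>2))"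
      by (simp only: ennreal_mult''[symmetric] zero_le_power2) simp
  qed
  also have "\<dots> = ennreal (2 * pi) * (\<integral>\<^sup>+r. ennreal r * ?g r * indicator {0..} r \<partial>lborel)"
    by (rule nn_integral_radial) auto
  also have "\<dots> = (\<integral>\<^sup>+r. ennreal (2 * pi) * (ennreal r * ?g r * indicator {0..} r) \<partial>lborel)"
    by (rule nn_integral_cmult[symmetric]) auto
  also have "\<dots> = (\<integral>\<^sup>+r. ennreal (r * (r - s)\<^sup>2 * exp (- r\<^sup>2 / 2)) * indicator {s..} r \<partial>lborel)"
    by (intro nn_integral_cong)
       (use assms in \<open>auto split: split_indicator simp: max_def ennreal_mult[symmetric]\<close>)
  also have "\<dots> = ennreal (2 * gamma1 1 (s / sqrt 2))"
    unfolding gamma1_1_eq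
    by (rule nn_integral_FTC_atLeast[OF _ rayleigh_tail_DERIV _ rayleigh_tail_limit]) (use assms in auto)
  finally show ?thesis .
qed

section \<open>Bounds on \<open>gamma0\<close> and \<open>gamma1\<close> and the decay of their
  ratio\<close>

lemma gamma0_le:
  assumes "0 < t"
  shows "gamma0 1 t \<le> 2 * (1 + t\<^sup>2) * exp (- t\<^sup>2 / 2) / (t * sqrt (2 * pi))"
proof -
  have "gamma0 1 t \<le> 2 * (1 + t\<^sup>2) * (1 - Phi t)"
    using assms by (simp add: gamma0_def)
  also have "\<dots> \<le> 2 * (1 + t\<^sup>2) * (exp (- t\<^sup>2 / 2) / (t * sqrt (2 * pi)))"
    by (intro mult_left_mono Phi_tail_le assms) auto
  finally show ?thesis by simp
qed

lemma gamma1_le: "0 \<le> t \<Longrightarrow> gamma1 1 t \<le> exp (- t\<^sup>2)"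
  using Phi_le_1 by (simp add: gamma1_def)

lemma gamma0_pos: "0 \<le> t \<Longrightarrow> 0 < gamma0 1 t"
  using gamma0_ge[of t] normal_density_pos[of 1 0 "t + 2"] by (simp add: less_le_trans[rotated])

lemma gamma1_ge: "0 \<le> t \<Longrightarrow> exp (- (sqrt 2 * t + 2)\<^sup>2 / 2) / 2 \<le> gamma1 1 t"
  using gamma1_scaled_ge[of "sqrt 2 * t"] by simp

lemma gamma1_pos: "0 \<le> t \<Longrightarrow> 0 < gamma1 1 t"
  by (rule less_le_trans[OF _ gamma1_ge]) auto

text \<open>Both bounds equal exp (-t^2/2) up to polynomial factors and factors exp (O(t)). Such
  errors disappear after taking logarithms and dividing by t^2, so this precision is enough for the
  limit 1.\<close>

lemma gamma_ratio_bounds: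
  assumes "0 < t"
  shows "exp (- (sqrt 2 * t + 2)\<^sup>2 / 2) / 2 / (2 * (1 + t\<^sup>2) * exp (- t\<^sup>2 / 2) / (t * sqrt (2 * pi)))
      \<le> gamma1 1 t / gamma0 1 t"
    and "gamma1 1 t / gamma0 1 t \<le> exp (- t\<^sup>2) / (2 * std_normal_density (t + 2))"
  using gamma1_ge[of t] gamma0_le[of t] gamma0_pos[of t] gamma1_pos[of t] gamma0_ge[of t] gamma1_le[of t] assms
  by (intro frac_le; simp add: normal_density_pos)+

lemma gamma_ratio_tendsto_0: "((\<lambda>t. gamma1 1 t / gamma0 1 t) \<longlongrightarrow> 0) at_top"
proof (rule tendsto_sandwich[OF _ _ tendsto_const])
  show "\<forall>\<^sub>F t in at_top. 0 \<le> gamma1 1 t / gamma0 1 t"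
    using eventually_ge_at_top[of 0] by eventually_elim (simp add: gamma0_pos gamma1_pos less_imp_le)
  show "\<forall>\<^sub>F t in at_top. gamma1 1 t / gamma0 1 t \<le> exp (- t\<^sup>2) / (2 * std_normal_density (t + 2))"
    using eventually_gt_at_top[of 0] by eventually_elim (rule gamma_ratio_bounds)
  show "((\<lambda>t. exp (- t\<^sup>2) / (2 * std_normal_density (t + 2))) \<longlongrightarrow> 0) at_top"
    unfolding std_normal_density_eq by real_asymp
qed

lemma ln_gamma_ratio_tendsto: "((\<lambda>t. - (2 / t\<^sup>2 * ln (gamma1 1 t / gamma0 1 t))) \<longlongrightarrow> 1) at_top"
proof (rule tendsto_sandwich)
  let ?l = "\<lambda>t. exp (- (sqrt 2 * t + 2)\<^sup>2 / 2) / 2 / (2 * (1 + t\<^sup>2) * exp (- t\<^sup>2 / 2) / (t * sqrt (2 * pi)))"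
  let ?u = "\<lambda>t. exp (- t\<^sup>2) / (2 * std_normal_density (t + 2))"
  show "\<forall>\<^sub>F t in at_top. - (2 / t\<^sup>2 * ln (gamma1 1 t / gamma0 1 t)) \<le> - (2 / t\<^sup>2 * ln (?l t))"
    using eventually_gt_at_top[of 0]
  proof eventually_elim
    case (elim t)
    have "0 < ?l t" using elim by (auto intro!: divide_pos_pos mult_pos_pos add_pos_nonneg)
    with gamma_ratio_bounds(1)[OF elim] have "ln (?l t) \<le> ln (gamma1 1 t / gamma0 1 t)"
      by (rule ln_mono)
    then show ?case by (intro le_imp_neg_le mult_left_mono) auto
  qed
  show "\<forall>\<^sub>F t in at_top. - (2 / t\<^sup>2 * ln (?u t)) \<le> - (2 / t\<^sup>2 * ln (gamma1 1 t / gamma0 1 t))"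
    using eventually_gt_at_top[of 0]
  proof eventually_elim
    case (elim t)
    have "0 < gamma1 1 t / gamma0 1 t" using elim by (simp add: gamma0_pos gamma1_pos)
    with gamma_ratio_bounds(2)[OF elim] have "ln (gamma1 1 t / gamma0 1 t) \<le> ln (?u t)"
      by (rule ln_mono)
    then show ?case by (intro le_imp_neg_le mult_left_mono) auto
  qed
  show "((\<lambda>t. - (2 / t\<^sup>2 * ln (?l t))) \<longlongrightarrow> 1) at_top" by real_asymp
  show "((\<lambda>t. - (2 / t\<^sup>2 * ln (?u t))) \<longlongrightarrow> 1) at_top"
    unfolding std_normal_density_eq by real_asymp
qed

section \<open>Probability\<close>

text \<open>Weierstrass' product inequality; the induction step rests on
  \<open>0 \<le> (1 - P) * (1 - p i)\<close>.\<close>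

lemma prod_one_minus_ge:
  fixes p :: "'i \<Rightarrow> real"
  assumes "finite F" "\<And>i. i \<in> F \<Longrightarrow> 0 \<le> p i" "\<And>i. i \<in> F \<Longrightarrow> p i \<le> 1"
  shows "1 - (\<Sum>i\<in>F. 1 - p i) \<le> (\<Prod>i\<in>F. p i)"
  using assms
proof (induction F rule: finite_induct)
  case (insert i F)
  define P where "P = (\<Prod>i\<in>F. p i)"
  have "0 \<le> P" "P \<le> 1" "0 \<le> p i" "p i \<le> 1"
    using insert.prems by (auto simp: P_def intro!: prod_nonneg prod_le_1)
  then have "0 \<le> (1 - P) * (1 - p i)" by simp
  then have "P + p i - 1 \<le> p i * P" by (simp add: algebra_simps)
  moreover have "1 - (\<Sum>i\<in>F. 1 - p i) \<le> P"
    unfolding P_def using insert by auto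
  ultimately show ?case using insert.hyps by (simp add: P_def[symmetric])
qed simp

text \<open>Choose a finite \<open>J\<close> outside of which the defects \<open>1 - p i\<close> sum
  to less than 1/2. Outside \<open>J\<close> the product inequality leaves at least 1/2, and inside
  \<open>J\<close> there is a fixed positive product, so half of that product serves as the
  bound.\<close>

lemma finite_prods_bounded_below:
  fixes p :: "'i \<Rightarrow> real"
  assumes p: "\<And>i. i \<in> I \<Longrightarrow> 0 < p i" "\<And>i. i \<in> I \<Longrightarrow> p i \<le> 1"
    and s: "(\<lambda>i. 1 - p i) summable_on I"
  obtains c where "0 < c" "\<And>F. finite F \<Longrightarrow> F \<subseteq> I \<Longrightarrow> c \<le> (\<Prod>i\<in>F. p i)"
proof -
  let ?q = "\<lambda>i. 1 - p i"
  define S where "S = infsum ?q I"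
  have le: "sum ?q F \<le> S" if "finite F" "F \<subseteq> I" for F
    unfolding S_def using that p by (intro finite_sum_le_infsum s) auto
  have "(sum ?q \<longlongrightarrow> S) (finite_subsets_at_top I)"
    using has_sum_infsum[OF s] by (simp add: has_sum_def S_def)
  then have "\<forall>\<^sub>F F in finite_subsets_at_top I. S - 1 / 2 < sum ?q F"
    by (rule order_tendstoD) simp
  then obtain J where J: "finite J" "J \<subseteq> I" "S - 1 / 2 < sum ?q J"
    unfolding eventually_finite_subsets_at_top by blast
  show ?thesis
  proof
    show "0 < (\<Prod>i\<in>J. p i) / 2" using p J by (auto intro!: prod_pos)
    fix F assume F: "finite F" "F \<subseteq> I"
    have "sum ?q (F - J) + sum ?q J = sum ?q (F \<union> J)"
      using F J by (subst sum.union_disjoint[symmetric]) (auto intro: sum.cong)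
    then have "sum ?q (F - J) < 1 / 2"
      using le[of "F \<union> J"] F J by auto
    moreover have "1 - sum ?q (F - J) \<le> (\<Prod>i\<in>F - J. p i)"
      using F p by (intro prod_one_minus_ge) (auto intro: less_imp_le)
    ultimately have half: "1 / 2 \<le> (\<Prod>i\<in>F - J. p i)" by simp
    have "(\<Prod>i\<in>J. p i) * (1 / 2) \<le> (\<Prod>i\<in>F \<inter> J. p i) * (\<Prod>i\<in>F - J. p i)"
    proof (rule mult_mono[OF _ half])
      have "(\<Prod>i\<in>J. p i) = (\<Prod>i\<in>F \<inter> J. p i) * (\<Prod>i\<in>J - F. p i)"
        using J by (subst prod.union_disjoint[symmetric]) (auto intro: prod.cong)
      also have "\<dots> \<le> (\<Prod>i\<in>F \<inter> J. p i) * 1"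
        using J F p by (intro mult_left_mono prod_le_1 prod_nonneg) (auto intro: less_imp_le)
      finally show "(\<Prod>i\<in>J. p i) \<le> (\<Prod>i\<in>F \<inter> J. p i)" by simp
    qed (use J p in \<open>auto intro!: prod_nonneg intro: less_imp_le\<close>)
    also have "\<dots> = (\<Prod>i\<in>F. p i)"
      using F by (subst prod.union_disjoint[symmetric]) (auto intro: prod.cong)
    finally show "(\<Prod>i\<in>J. p i) / 2 \<le> (\<Prod>i\<in>F. p i)" by simp
  qed
qed

text \<open>The bound \<open>c\<close> is uniform over finite index sets, so it survives the
  decreasing limit along an enumeration of \<open>I\<close>.\<close>

lemma (in prob_space) prob_all_indep_pos:
  assumes I: "countable I" "I \<noteq> {}" and ind: "indep_vars N X I"
    and B: "\<And>i. i \<in> I \<Longrightarrow> B i \<in> sets (N i)"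
    and pos: "\<And>i. i \<in> I \<Longrightarrow> 0 < prob {\<omega> \<in> space M. X i \<omega> \<in> B i}"
    and s: "(\<lambda>i. 1 - prob {\<omega> \<in> space M. X i \<omega> \<in> B i}) summable_on I"
  shows "0 < prob {\<omega> \<in> space M. \<forall>i\<in>I. X i \<omega> \<in> B i}"
proof -
  define A where "A i = X i -` B i \<inter> space M" for i
  have A_eq: "A i = {\<omega> \<in> space M. X i \<omega> \<in> B i}" for i by (auto simp: A_def)
  have A[measurable]: "A i \<in> events" if "i \<in> I" for i
    using ind B[OF that] that unfolding A_def indep_vars_def by (blast intro: measurable_sets)
  obtain c where c: "0 < c" "\<And>F. finite F \<Longrightarrow> F \<subseteq> I \<Longrightarrow> c \<le> (\<Prod>i\<in>F. prob (A i))"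
    using finite_prods_bounded_below[of I "\<lambda>i. prob (A i)"] pos s unfolding A_eq by auto
  define e where "e = from_nat_into I"
  define D where "D n = (\<Inter>i\<in>e ` {..n}. A i)" for n
  have e: "e n \<in> I" for n unfolding e_def using I by (intro from_nat_into)
  have "c \<le> prob (D n)" for n
  proof -
    have "c \<le> (\<Prod>i\<in>e ` {..n}. prob (A i))" by (rule c) (use e in auto)
    also have "\<dots> = prob (D n)"
      unfolding D_def A_def
      by (rule indep_varsD[OF ind, symmetric]) (use e B in auto)
    finally show ?thesis .
  qed
  moreover have "(\<lambda>n. prob (D n)) \<longlonglongrightarrow> prob (\<Inter>n. D n)"
  proof (rule finite_Lim_measure_decseq)
    show "range D \<subseteq> events" unfolding D_def by (auto intro!: sets.finite_INT A e)
    show "decseq D" unfolding D_def decseq_def by (intro allI impI INT_anti_mono image_mono) auto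
  qed
  ultimately have "c \<le> prob (\<Inter>n. D n)"
    by (intro LIMSEQ_le_const) auto
  also have "(\<Inter>n. D n) = {\<omega> \<in> space M. \<forall>i\<in>I. X i \<omega> \<in> B i}"
  proof -
    have "(\<Inter>n. D n) = (\<Inter>n. A (e n))" unfolding D_def by auto
    also have "\<dots> = (\<Inter>i\<in>I. A i)"
      using range_from_nat_into[OF I(2,1)] unfolding e_def by (metis image_image)
    also have "\<dots> = {\<omega> \<in> space M. \<forall>i\<in>I. X i \<omega> \<in> B i}" using I(2) unfolding A_eq by auto
    finally show ?thesis .
  qed
  finally show ?thesis using c(1) by simp
qed

text \<open>Fubini: for fixed \<open>v\<close> the event \<open>U = - v \<noteq> 0\<close> is null.\<close>

lemma (in prob_space) AE_indep_sum_nonzero: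
  fixes U V :: "'a \<Rightarrow> real"
  assumes ind: "indep_var borel U borel V"
    and U: "\<And>c. c \<noteq> 0 \<Longrightarrow> prob {\<omega> \<in> space M. U \<omega> = c} = 0"
  shows "AE \<omega> in M. U \<omega> + V \<omega> = 0 \<longrightarrow> U \<omega> = 0"
proof -
  have [measurable]: "U \<in> borel_measurable M" "V \<in> borel_measurable M"
    and eq: "distr M borel U \<Otimes>\<^sub>M distr M borel V = distr M (borel \<Otimes>\<^sub>M borel) (\<lambda>\<omega>. (U \<omega>, V \<omega>))"
    using ind unfolding indep_var_distribution_eq by auto
  interpret U: prob_space "distr M borel U" by (rule prob_space_distr) simp
  interpret V: prob_space "distr M borel V" by (rule prob_space_distr) simp
  interpret UV: pair_sigma_finite "distr M borel U" "distr M borel V" ..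
  let ?N = "{p \<in> space (borel \<Otimes>\<^sub>M borel). fst p + snd p = (0::real) \<and> fst p \<noteq> 0}"
  have N: "?N \<in> sets (borel \<Otimes>\<^sub>M borel)" by measurable
  have N': "?N \<in> sets (distr M borel U \<Otimes>\<^sub>M distr M borel V)"
    using N by (simp cong: sets_pair_measure_cong)
  have "emeasure M {\<omega> \<in> space M. U \<omega> + V \<omega> = 0 \<and> U \<omega> \<noteq> 0}
      = emeasure (distr M (borel \<Otimes>\<^sub>M borel) (\<lambda>\<omega>. (U \<omega>, V \<omega>))) ?N"
    by (subst emeasure_distr[OF _ N]) (auto simp: space_pair_measure intro!: arg_cong2[where f = emeasure])
  also have "\<dots> = (\<integral>\<^sup>+v. emeasure (distr M borel U) ((\<lambda>u. (u, v)) -` ?N) \<partial>distr M borel V)"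
    unfolding eq[symmetric] by (rule UV.emeasure_pair_measure_alt2[OF N'])
  also have "\<dots> = (\<integral>\<^sup>+v. 0 \<partial>distr M borel V)"
  proof (rule nn_integral_cong)
    fix v :: real
    \<comment> \<open>For \<open>v = 0\<close> the section is empty, since it would need
      \<open>u = 0\<close>. This is what allows \<open>U\<close> to have an atom at 0.\<close>
    have "(\<lambda>u. (u, v)) -` ?N = (if v = 0 then {} else {- v})"
      by (auto simp: space_pair_measure)
    moreover have "emeasure (distr M borel U) {c} = 0" if "c \<noteq> 0" for c
      using U[OF that] by (subst emeasure_distr) (auto simp: emeasure_eq_measure vimage_def Int_def conj_commute)
    ultimately show "emeasure (distr M borel U) ((\<lambda>u. (u, v)) -` ?N) = 0" by simp
  qed
  finally have "emeasure M {\<omega> \<in> space M. U \<omega> + V \<omega> = 0 \<and> U \<omega> \<noteq> 0} = 0" by simp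
  then show ?thesis by (subst AE_iff_measurable[OF _ refl]) auto
qed

lemma (in prob_space) normal_prob_interval_pos:
  assumes X: "distributed M lborel X (normal_density \<mu> \<sigma>)" and "0 < \<sigma>" "c < d"
  shows "0 < prob {\<omega> \<in> space M. c \<le> X \<omega> \<and> X \<omega> \<le> d}"
proof -
  have eq: "{\<omega> \<in> space M. c \<le> X \<omega> \<and> X \<omega> \<le> d} = X -` {c..d} \<inter> space M" by auto
  have "emeasure M (X -` {c..d} \<inter> space M) = (\<integral>\<^sup>+x. ennreal (normal_density \<mu> \<sigma> x) * indicator {c..d} x \<partial>lborel)"
    by (rule distributed_emeasure[OF X]) simp
  moreover have "(\<integral>\<^sup>+x. ennreal (normal_density \<mu> \<sigma> x) * indicator {c..d} x \<partial>lborel) \<noteq> 0"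
  proof
    assume "(\<integral>\<^sup>+x. ennreal (normal_density \<mu> \<sigma> x) * indicator {c..d} x \<partial>lborel) = 0"
    then have "AE x in lborel. x \<notin> {c..d}"
      using normal_density_pos[OF \<open>0 < \<sigma>\<close>, of \<mu>, unfolded not_le[symmetric]]
      by (subst (asm) nn_integral_0_iff_AE)
         (auto elim!: eventually_mono simp: indicator_def ennreal_eq_0_iff not_le split: if_splits)
    then have "emeasure lborel {c..d} = 0"
      by (subst (asm) AE_iff_measurable[where N = "{c..d}"]) auto
    with \<open>c < d\<close> show False by simp
  qed
  ultimately show ?thesis
    unfolding eq zero_less_measure_iff emeasure_eq_measure by auto
qed

lemma (in prob_space) normal_prob_eq_0:
  assumes X: "distributed M lborel X (normal_density \<mu> \<sigma>)"
  shows "prob {\<omega> \<in> space M. X \<omega> = c} = 0"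
proof -
  have eq: "{\<omega> \<in> space M. X \<omega> = c} = X -` {c} \<inter> space M" by auto
  have "emeasure M (X -` {c} \<inter> space M) = (\<integral>\<^sup>+x. ennreal (normal_density \<mu> \<sigma> x) * indicator {c} x \<partial>lborel)"
    by (rule distributed_emeasure[OF X]) simp
  also have "\<dots> = (\<integral>\<^sup>+x. ennreal (normal_density \<mu> \<sigma> c) * indicator {c} x \<partial>lborel)"
    by (intro nn_integral_cong) (auto split: split_indicator)
  also have "\<dots> = 0" by (subst nn_integral_cmult_indicator) auto
  finally show ?thesis unfolding eq by (simp add: measure_def)
qed

section \<open>Thresholded Gaussians of general variance\<close>

lemma gamma0_scale: "gamma0 c t = c * gamma0 1 t"
  by (simp add: gamma0_def)

lemma gamma1_scale: "gamma1 c t = c * gamma1 1 t"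
  by (simp add: gamma1_def)

lemma (in prob_space) nn_integral_normal_soft:
  assumes X: "distributed M lborel X (normal_density 0 \<sigma>)" and "0 < \<sigma>" "0 \<le> lam"
  shows "(\<integral>\<^sup>+\<omega>. ennreal ((max 0 (\<bar>X \<omega>\<bar> - lam))\<^sup>2) \<partial>M) = ennreal (gamma0 (\<sigma>\<^sup>2) (lam / \<sigma>))"
proof -
  let ?Z = "\<lambda>\<omega>. X \<omega> / \<sigma>"
  have Z: "distributed M lborel ?Z std_normal_density"
    using X normal_standard_normal_convert[OF \<open>0 < \<sigma>\<close>, of X 0] by simp
  note [measurable] = distributed_measurable[OF X, unfolded measurable_lborel1]
  have "(max 0 (\<bar>X \<omega>\<bar> - lam)) = \<sigma> * max 0 (\<bar>?Z \<omega>\<bar> - lam / \<sigma>)" for \<omega>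
    using \<open>0 < \<sigma>\<close> by (simp add: max_def field_simps)
  then have "(\<integral>\<^sup>+\<omega>. ennreal ((max 0 (\<bar>X \<omega>\<bar> - lam))\<^sup>2) \<partial>M)
      = (\<integral>\<^sup>+\<omega>. ennreal (\<sigma>\<^sup>2) * ennreal ((max 0 (\<bar>?Z \<omega>\<bar> - lam / \<sigma>))\<^sup>2) \<partial>M)"
    by (simp only: power_mult_distrib ennreal_mult'' zero_le_power2)
  also have "\<dots> = ennreal (\<sigma>\<^sup>2) * (\<integral>\<^sup>+\<omega>. ennreal ((max 0 (\<bar>?Z \<omega>\<bar> - lam / \<sigma>))\<^sup>2) \<partial>M)"
    by (rule nn_integral_cmult) measurable
  also have "(\<integral>\<^sup>+\<omega>. ennreal ((max 0 (\<bar>?Z \<omega>\<bar> - lam / \<sigma>))\<^sup>2) \<partial>M) = ennreal (gamma0 1 (lam / \<sigma>))"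
    using distributed_nn_integral[OF Z, of "\<lambda>x. ennreal ((max 0 (\<bar>x\<bar> - lam / \<sigma>))\<^sup>2)"]
      nn_integral_std_normal_soft[of "lam / \<sigma>"] assms by simp
  finally show ?thesis
    by (subst gamma0_scale) (simp add: ennreal_mult')
qed

text \<open>\<open>2 * \<sigma>^2\<close> is the variance of the complex variable with parts
  \<open>X\<close> and \<open>Y\<close>; for a coefficient with m \<noteq> 0 it equals
  \<open>C l\<close>.\<close>

lemma (in prob_space) nn_integral_normal2_soft:
  assumes X: "distributed M lborel X (normal_density 0 \<sigma>)" and Y: "distributed M lborel Y (normal_density 0 \<sigma>)"
    and ind: "indep_var borel X borel Y" and "0 < \<sigma>" "0 \<le> lam"
  shows "(\<integral>\<^sup>+\<omega>. ennreal ((max 0 (sqrt ((X \<omega>)\<^sup>2 + (Y \<omega>)\<^sup>2) - lam))\<^sup>2) \<partial>M)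
       = ennreal (gamma1 (2 * \<sigma>\<^sup>2) (lam / sqrt (2 * \<sigma>\<^sup>2)))"
proof -
  let ?Z = "\<lambda>\<omega>. X \<omega> / \<sigma>" and ?W = "\<lambda>\<omega>. Y \<omega> / \<sigma>" and ?t = "lam / \<sigma>"
  have Z: "distributed M lborel ?Z std_normal_density"
    using X normal_standard_normal_convert[OF \<open>0 < \<sigma>\<close>, of X 0] by simp
  have W: "distributed M lborel ?W std_normal_density"
    using Y normal_standard_normal_convert[OF \<open>0 < \<sigma>\<close>, of Y 0] by simp
  note [measurable] = distributed_measurable[OF X, unfolded measurable_lborel1]
    distributed_measurable[OF Y, unfolded measurable_lborel1]
  have "indep_var borel ((\<lambda>x. x / \<sigma>) \<circ> X) borel ((\<lambda>x. x / \<sigma>) \<circ> Y)"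
    by (rule indep_var_compose[OF ind]) auto
  then have "indep_var lborel ?Z lborel ?W"
    unfolding indep_var_eq comp_def by simp
  from distributed_joint_indep[OF _ _ Z W this]
  have ZW: "distributed M (lborel \<Otimes>\<^sub>M lborel) (\<lambda>\<omega>. (?Z \<omega>, ?W \<omega>))
      (\<lambda>(x, y). ennreal (std_normal_density x) * ennreal (std_normal_density y))"
    by (simp add: lborel.sigma_finite_measure_axioms)
  let ?g = "\<lambda>(x, y). ennreal ((max 0 (sqrt (x\<^sup>2 + y\<^sup>2) - ?t))\<^sup>2)"
  have "max 0 (sqrt ((X \<omega>)\<^sup>2 + (Y \<omega>)\<^sup>2) - lam) = \<sigma> * max 0 (sqrt ((?Z \<omega>)\<^sup>2 + (?W \<omega>)\<^sup>2) - ?t)" for \<omega>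
  proof -
    have "(X \<omega>)\<^sup>2 + (Y \<omega>)\<^sup>2 = \<sigma>\<^sup>2 * ((?Z \<omega>)\<^sup>2 + (?W \<omega>)\<^sup>2)"
      using \<open>0 < \<sigma>\<close> by (simp add: power_divide field_simps)
    then have "sqrt ((X \<omega>)\<^sup>2 + (Y \<omega>)\<^sup>2) = \<sigma> * sqrt ((?Z \<omega>)\<^sup>2 + (?W \<omega>)\<^sup>2)"
      using \<open>0 < \<sigma>\<close> by (simp only: real_sqrt_mult real_sqrt_abs abs_of_pos)
    moreover have "lam = \<sigma> * ?t" using \<open>0 < \<sigma>\<close> by simp
    ultimately show ?thesis
      using \<open>0 < \<sigma>\<close> by (metis (no_types, lifting) max_mult_distrib_left mult_zero_right right_diff_distrib less_imp_le)
  qed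
  then have "(\<integral>\<^sup>+\<omega>. ennreal ((max 0 (sqrt ((X \<omega>)\<^sup>2 + (Y \<omega>)\<^sup>2) - lam))\<^sup>2) \<partial>M)
      = (\<integral>\<^sup>+\<omega>. ennreal (\<sigma>\<^sup>2) * ?g (?Z \<omega>, ?W \<omega>) \<partial>M)"
    by (simp only: power_mult_distrib ennreal_mult'' zero_le_power2 prod.case)
  also have "\<dots> = ennreal (\<sigma>\<^sup>2) * (\<integral>\<^sup>+\<omega>. ?g (?Z \<omega>, ?W \<omega>) \<partial>M)"
    by (rule nn_integral_cmult) measurable
  also have "(\<integral>\<^sup>+\<omega>. ?g (?Z \<omega>, ?W \<omega>) \<partial>M) = (\<integral>\<^sup>+p. (\<lambda>(x, y). ennreal (std_normal_density x) * ennreal (std_normal_density y)) p * ?g p \<partial>(lborel \<Otimes>\<^sub>M lborel))"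
    by (rule distributed_nn_integral[OF ZW, symmetric]) measurable
  also have "\<dots> = (\<integral>\<^sup>+x. \<integral>\<^sup>+y. ennreal (std_normal_density x * std_normal_density y) *
      ennreal ((max 0 (sqrt (x\<^sup>2 + y\<^sup>2) - ?t))\<^sup>2) \<partial>lborel \<partial>lborel)"
    by (subst lborel.nn_integral_fst[symmetric]) (auto simp: ennreal_mult)
  also have "\<dots> = ennreal (2 * gamma1 1 (?t / sqrt 2))"
    by (rule nn_integral_rayleigh_soft) (use assms in auto)
  also have "?t / sqrt 2 = lam / sqrt (2 * \<sigma>\<^sup>2)"
    using \<open>0 < \<sigma>\<close> by (simp add: real_sqrt_mult)
  finally show ?thesis
    by (subst gamma1_scale) (simp add: ennreal_mult'[symmetric] mult_ac)
qed

section \<open>The regularized coefficients\<close>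

lemma harmonic_indices_iff [simp]: "(l, m) \<in> harmonic_indices \<longleftrightarrow> \<bar>m\<bar> \<le> int l"
  by (auto simp: harmonic_indices_def)

lemma countable_harmonic_indices: "countable harmonic_indices"
  unfolding harmonic_indices_def by (intro countable_SIGMA) auto

lemma infinite_harmonic_indices: "infinite harmonic_indices"
proof
  assume "finite harmonic_indices"
  then have "finite (fst ` harmonic_indices)" by simp
  moreover have "fst ` harmonic_indices = UNIV"
    by (auto simp: image_iff intro!: bexI[of _ "(_, 0)"])
  ultimately show False by simp
qed

text \<open>Enumerating the index set makes measurability and monotone convergence for ordinary
  series available for sums over \<open>harmonic_indices\<close>.\<close>

lemma infsum_ennreal_eq_suminf:
  fixes f :: "'i \<Rightarrow> ennreal"
  assumes "countable A" "infinite A"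
  shows "infsum f A = (\<Sum>n. f (from_nat_into A n))"
proof -
  have "infsum f A = (\<Sum>\<^sub>\<infinity>n. f (from_nat_into A n))"
    by (rule infsum_reindex_bij_betw[symmetric, OF bij_betw_from_nat_into[OF assms]])
  also have "\<dots> = (\<Sum>n. f (from_nat_into A n))"
    using has_sum_imp_sums[OF has_sum_infsum[OF nonneg_summable_on_complete], of "\<lambda>n. f (from_nat_into A n)"]
    by (simp add: sums_iff)
  finally show ?thesis .
qed

lemma borel_measurable_infsum_ennreal:
  fixes f :: "'i \<Rightarrow> 'w \<Rightarrow> ennreal"
  assumes "countable A" "infinite A" "\<And>i. i \<in> A \<Longrightarrow> f i \<in> borel_measurable M"
  shows "(\<lambda>\<omega>. \<Sum>\<^sub>\<infinity>i\<in>A. f i \<omega>) \<in> borel_measurable M"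
  unfolding infsum_ennreal_eq_suminf[OF assms(1,2)]
  using assms from_nat_into[of A] by (intro borel_measurable_suminf_order) auto

lemma nn_integral_infsum:
  fixes f :: "'i \<Rightarrow> 'w \<Rightarrow> ennreal"
  assumes "countable A" "infinite A" "\<And>i. i \<in> A \<Longrightarrow> f i \<in> borel_measurable M"
  shows "(\<integral>\<^sup>+\<omega>. (\<Sum>\<^sub>\<infinity>i\<in>A. f i \<omega>) \<partial>M) = (\<Sum>\<^sub>\<infinity>i\<in>A. \<integral>\<^sup>+\<omega>. f i \<omega> \<partial>M)"
  unfolding infsum_ennreal_eq_suminf[OF assms(1,2)]
  using assms from_nat_into[of A] by (intro nn_integral_suminf) auto

text \<open>Markov's inequality for counting measure: at most \<open>infsum f A / e\<close> terms
  can reach \<open>e\<close>.\<close>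

lemma finite_large_terms:
  fixes f :: "'i \<Rightarrow> real"
  assumes f: "f summable_on A" "\<And>i. i \<in> A \<Longrightarrow> 0 \<le> f i" and "0 < e"
  shows "finite {i \<in> A. e \<le> f i}"
proof -
  have "finite {i \<in> A. e \<le> f i} \<and> card {i \<in> A. e \<le> f i} \<le> nat \<lceil>infsum f A / e\<rceil>"
  proof (rule finite_if_finite_subsets_card_bdd)
    fix G assume G: "G \<subseteq> {i \<in> A. e \<le> f i}" "finite G"
    have "of_nat (card G) * e \<le> sum f G" using G by (intro sum_bounded_below) auto
    also have "\<dots> \<le> infsum f A" using G f by (intro finite_sum_le_infsum) auto
    finally have "real (card G) \<le> infsum f A / e" using \<open>0 < e\<close> by (simp add: field_simps)
    then show "card G \<le> nat \<lceil>infsum f A / e\<rceil>" by linarith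
  qed
  then show ?thesis by simp
qed

text \<open>Degree l occurs \<open>2 * l + 1\<close> times, so the series behaves like the sum of
  \<open>l powr (1 - \<alpha>)\<close>, which converges because \<alpha> > 2.\<close>

lemma admissible_spectrum_summable:
  assumes "admissible_spectrum C"
  shows "(\<lambda>(l, m). C l) summable_on harmonic_indices"
  unfolding harmonic_indices_def
proof (rule summable_on_SigmaI)
  have C: "0 < C l" for l using assms by (auto simp: admissible_spectrum_def)
  obtain K \<alpha> where K: "0 < K" "2 < \<alpha>" "\<And>l. 1 \<le> l \<Longrightarrow> C l \<le> K * real l powr (- \<alpha>)"
    using assms by (auto simp: admissible_spectrum_def)
  show "((\<lambda>m. case (l, m) of (l, m) \<Rightarrow> C l) has_sum (2 * real l + 1) * C l) {- int l..int l}" for l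
    by (rule has_sum_finiteI) (auto simp: nat_add_distrib nat_mult_distrib)
  have "summable (\<lambda>l. (2 * real l + 1) * C l)"
  proof (rule summable_comparison_test_ev)
    show "summable (\<lambda>l. 3 * K * real l powr (1 - \<alpha>))"
      using K by (intro summable_mult) (simp add: summable_real_powr_iff)
    \<comment> \<open>Only from degree 1 on, where the power bound on \<open>C l\<close> and
      \<open>2 * l + 1 \<le> 3 * l\<close> hold.\<close>
    show "\<forall>\<^sub>F l in sequentially. norm ((2 * real l + 1) * C l) \<le> 3 * K * real l powr (1 - \<alpha>)"
      using eventually_ge_at_top[of 1]
    proof eventually_elim
      case (elim l)
      have "(2 * real l + 1) * C l \<le> (3 * real l) * (K * real l powr (- \<alpha>))"
        using elim K(3)[OF elim] C[of l] by (intro mult_mono) auto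
      also have "\<dots> = 3 * K * (real l powr 1 * real l powr (- \<alpha>))" using elim by simp
      also have "real l powr 1 * real l powr (- \<alpha>) = real l powr (1 - \<alpha>)"
        by (simp only: powr_add[symmetric] add_uminus_conv_diff)
      finally show ?case using C[of l] by simp
    qed
  qed
  then show "(\<lambda>l. (2 * real l + 1) * C l) summable_on UNIV"
    using C by (subst summable_on_UNIV_nonneg_real_iff) (auto intro: less_imp_le)
  show "0 \<le> (case (l, m) of (l, m) \<Rightarrow> C l)" for l m using C[of l] by simp
qed

section \<open>Laws and moments of the observed coefficients\<close>

locale gaussian_harmonics = prob_space M for M :: "'w measure" +
  fixes a :: "'w random_coeffs" and C :: "nat \<Rightarrow> real"
  assumes coeffs: "gaussian_coeffs M a C" and spectrum: "admissible_spectrum C"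
begin

lemma C_pos: "0 < C l"
  using spectrum by (auto simp: admissible_spectrum_def)

lemma borel_measurable_coeff: "\<bar>m\<bar> \<le> int l \<Longrightarrow> a l m \<in> borel_measurable M"
  using bspec[OF coeffs[unfolded gaussian_coeffs_def, THEN conjunct1], of "(l, m)"] by simp

lemma AE_coeff_uminus: "\<bar>m\<bar> \<le> int l \<Longrightarrow> AE \<omega> in M. a l (- m) \<omega> = (-1) ^ nat \<bar>m\<bar> * cnj (a l m \<omega>)"
  using bspec[OF coeffs[unfolded gaussian_coeffs_def, THEN conjunct2, THEN conjunct1], of "(l, m)"] by simp

lemma indep_coeffs: "indep_vars (\<lambda>_. borel) (\<lambda>(l, m). a l m) {(l, m) \<in> harmonic_indices. 0 \<le> m}"
  using coeffs by (simp add: gaussian_coeffs_def)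

lemma AE_coeff_0: "AE \<omega> in M. a l 0 \<omega> = of_real (Re (a l 0 \<omega>))"
proof -
  have "AE \<omega> in M. a l 0 \<omega> \<in> \<real>" using coeffs by (simp add: gaussian_coeffs_def)
  then show ?thesis by eventually_elim simp
qed

lemma distributed_coeff_0: "distributed M lborel (\<lambda>\<omega>. Re (a l 0 \<omega>)) (normal_density 0 (sqrt (C l)))"
  using coeffs by (simp add: gaussian_coeffs_def)

lemma
  assumes "\<bar>m\<bar> \<le> int l" "m \<noteq> 0"
  shows indep_Re_Im: "indep_var borel (\<lambda>\<omega>. Re (a l m \<omega>)) borel (\<lambda>\<omega>. Im (a l m \<omega>))"
    and distributed_Re: "distributed M lborel (\<lambda>\<omega>. Re (a l m \<omega>)) (normal_density 0 (sqrt (C l / 2)))"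
    and distributed_Im: "distributed M lborel (\<lambda>\<omega>. Im (a l m \<omega>)) (normal_density 0 (sqrt (C l / 2)))"
  using bspec[OF coeffs[unfolded gaussian_coeffs_def, THEN conjunct2, THEN conjunct2, THEN conjunct2, THEN conjunct2],
      of "(l, m)"] assms by simp_all

text \<open>The factor \<open>sqrt 2\<close> compensates the variance \<open>C l / 2\<close> of real
  and imaginary parts. All real coefficients of one degree therefore have the same law, which is why
  the real-valued scheme yields \<open>gamma0\<close> for every m.\<close>

lemma distributed_real_coeffs:
  assumes "\<bar>m\<bar> \<le> int l"
  shows "distributed M lborel (\<lambda>\<omega>. real_coeffs (\<lambda>l m. a l m \<omega>) l m) (normal_density 0 (sqrt (C l)))"
proof -
  have s: "sqrt 2 * sqrt (C l / 2) = sqrt (C l)" "0 < sqrt (C l / 2)"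
    using C_pos[of l] by (simp_all flip: real_sqrt_mult)
  consider "m = 0" | "0 < m" | "m < 0" by linarith
  then show ?thesis
  proof cases
    case 1 then show ?thesis using distributed_coeff_0 by (simp add: real_coeffs_def)
  next
    case 2 then show ?thesis
      using normal_density_affine[OF distributed_Re s(2), of m "sqrt 2" 0] assms s(1)
      by (simp add: real_coeffs_def)
  next
    case 3 then show ?thesis
      using normal_density_affine[OF distributed_Im s(2), of "- m" "- sqrt 2" 0] assms s(1)
      by (simp add: real_coeffs_def)
  qed
qed

lemma borel_measurable_real_coeffs:
  "\<bar>m\<bar> \<le> int l \<Longrightarrow> (\<lambda>\<omega>. real_coeffs (\<lambda>l m. a l m \<omega>) l m) \<in> borel_measurable M"
  using distributed_measurable[OF distributed_real_coeffs] by simp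

lemma nn_integral_coeff_soft:
  assumes "\<bar>m\<bar> \<le> int l" "0 \<le> lam"
  shows "(\<integral>\<^sup>+\<omega>. ennreal ((max 0 (norm (a l m \<omega>) - lam))\<^sup>2) \<partial>M)
       = ennreal ((if m = 0 then gamma0 else gamma1) (C l) (lam / sqrt (C l)))"
proof (cases "m = 0")
  case True
  have "(\<integral>\<^sup>+\<omega>. ennreal ((max 0 (norm (a l 0 \<omega>) - lam))\<^sup>2) \<partial>M)
      = (\<integral>\<^sup>+\<omega>. ennreal ((max 0 (\<bar>Re (a l 0 \<omega>)\<bar> - lam))\<^sup>2) \<partial>M)"
  proof (rule nn_integral_cong_AE)
    show "AE \<omega> in M. ennreal ((max 0 (norm (a l 0 \<omega>) - lam))\<^sup>2) = ennreal ((max 0 (\<bar>Re (a l 0 \<omega>)\<bar> - lam))\<^sup>2)"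
      using AE_coeff_0[of l] by eventually_elim (metis norm_of_real)
  qed
  then show ?thesis
    using nn_integral_normal_soft[OF distributed_coeff_0[of l] _ assms(2)] C_pos[of l] True by simp
next
  case False
  then show ?thesis
    using nn_integral_normal2_soft[OF distributed_Re distributed_Im indep_Re_Im _ assms(2), of m l] C_pos[of l] assms
    by (simp add: cmod_def)
qed

lemma nn_integral_real_coeffs_soft:
  assumes "\<bar>m\<bar> \<le> int l" "0 \<le> lam"
  shows "(\<integral>\<^sup>+\<omega>. ennreal ((max 0 (norm (real_coeffs (\<lambda>l m. a l m \<omega>) l m) - lam))\<^sup>2) \<partial>M)
       = ennreal (gamma0 (C l) (lam / sqrt (C l)))"
  using nn_integral_normal_soft[OF distributed_real_coeffs[OF assms(1)] _ assms(2)] C_pos[of l] by simp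

text \<open>With threshold 0 the moment formulas give plain second moments. These equal
  \<open>C l\<close>; the bound with factor 2 avoids evaluating \<open>Phi 0\<close>.\<close>

lemma gamma_at_0_le: "(if m = (0::int) then gamma0 else gamma1) (C l) (0 / sqrt (C l)) \<le> 2 * C l"
  using C_pos[of l] Phi_ge_0[of 0]
  by (simp add: gamma0_def gamma1_def)

lemma nn_integral_coeff_square_le:
  "\<bar>m\<bar> \<le> int l \<Longrightarrow> (\<integral>\<^sup>+\<omega>. ennreal ((norm (a l m \<omega>))\<^sup>2) \<partial>M) \<le> ennreal (2 * C l)"
  using nn_integral_coeff_soft[of m l 0] gamma_at_0_le[of m l] by (simp add: ennreal_leI)

lemma nn_integral_real_coeffs_square_le:
  "\<bar>m\<bar> \<le> int l \<Longrightarrow> (\<integral>\<^sup>+\<omega>. ennreal ((norm (real_coeffs (\<lambda>l m. a l m \<omega>) l m))\<^sup>2) \<partial>M) \<le> ennreal (2 * C l)"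
  using nn_integral_real_coeffs_soft[of m l 0] gamma_at_0_le[of 0 l] by (simp add: ennreal_leI)

section \<open>Both schemes at once: a family \<open>B\<close> with second moments at most
  \<open>2 * C l\<close>\<close>

context
  fixes B :: "nat \<Rightarrow> int \<Rightarrow> 'w \<Rightarrow> 'a :: euclidean_space"
  assumes B: "\<And>l m. \<bar>m\<bar> \<le> int l \<Longrightarrow> B l m \<in> borel_measurable M"
    and B2: "\<And>l m. \<bar>m\<bar> \<le> int l \<Longrightarrow> (\<integral>\<^sup>+\<omega>. ennreal ((norm (B l m \<omega>))\<^sup>2) \<partial>M) \<le> ennreal (2 * C l)"
begin

lemma square_summable_iff:
  "(\<lambda>(l, m). (norm (B l m \<omega>))\<^sup>2) summable_on harmonic_indices \<longleftrightarrow>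
   (\<Sum>\<^sub>\<infinity>i\<in>harmonic_indices. ennreal ((norm (B (fst i) (snd i) \<omega>))\<^sup>2)) < \<infinity>"
  by (subst infsum_ennreal_finite_iff) (auto simp: split_def)

lemma borel_measurable_sum_square:
  "(\<lambda>\<omega>. \<Sum>\<^sub>\<infinity>i\<in>harmonic_indices. ennreal ((norm (B (fst i) (snd i) \<omega>))\<^sup>2)) \<in> borel_measurable M"
proof (rule borel_measurable_infsum_ennreal[OF countable_harmonic_indices infinite_harmonic_indices])
  fix i assume "i \<in> harmonic_indices"
  then have [measurable]: "B (fst i) (snd i) \<in> borel_measurable M" by (cases i) (auto intro: B)
  show "(\<lambda>\<omega>. ennreal ((norm (B (fst i) (snd i) \<omega>))\<^sup>2)) \<in> borel_measurable M" by measurable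
qed

lemma square_summable_event [measurable]:
  "Measurable.pred M (\<lambda>\<omega>. (\<lambda>(l, m). (norm (B l m \<omega>))\<^sup>2) summable_on harmonic_indices)"
  unfolding square_summable_iff using borel_measurable_sum_square by measurable

text \<open>The expected sum of all squares is at most twice the sum of \<open>C l\<close> over the
  index set, hence finite.\<close>

lemma AE_square_summable:
  "AE \<omega> in M. (\<lambda>(l, m). (norm (B l m \<omega>))\<^sup>2) summable_on harmonic_indices"
proof -
  have "(\<integral>\<^sup>+\<omega>. (\<Sum>\<^sub>\<infinity>i\<in>harmonic_indices. ennreal ((norm (B (fst i) (snd i) \<omega>))\<^sup>2)) \<partial>M)
      = (\<Sum>\<^sub>\<infinity>i\<in>harmonic_indices. \<integral>\<^sup>+\<omega>. ennreal ((norm (B (fst i) (snd i) \<omega>))\<^sup>2) \<partial>M)"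
  proof (rule nn_integral_infsum[OF countable_harmonic_indices infinite_harmonic_indices])
    fix i assume "i \<in> harmonic_indices"
    then have [measurable]: "B (fst i) (snd i) \<in> borel_measurable M" by (cases i) (auto intro: B)
    show "(\<lambda>\<omega>. ennreal ((norm (B (fst i) (snd i) \<omega>))\<^sup>2)) \<in> borel_measurable M" by measurable
  qed
  also have "\<dots> \<le> (\<Sum>\<^sub>\<infinity>i\<in>harmonic_indices. ennreal (2 * C (fst i)))"
    by (rule infsum_mono) (auto intro!: B2 nonneg_summable_on_complete)
  also have "\<dots> < \<infinity>"
    using summable_on_cmult_right[OF admissible_spectrum_summable[OF spectrum], of 2] C_pos
    by (subst infsum_ennreal_finite_iff) (auto simp: split_def intro: less_imp_le)
  finally have "AE \<omega> in M. (\<Sum>\<^sub>\<infinity>i\<in>harmonic_indices. ennreal ((norm (B (fst i) (snd i) \<omega>))\<^sup>2)) \<noteq> \<infinity>"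
    by (intro nn_integral_PInf_AE borel_measurable_sum_square) auto
  then show ?thesis
    by eventually_elim (simp add: square_summable_iff less_top)
qed

lemma AE_regularize:
  assumes "0 < lam"
  shows "AE \<omega> in M. \<forall>l m. regularize lam (\<lambda>l m. B l m \<omega>) l m = (if \<bar>m\<bar> \<le> int l then soft lam (B l m \<omega>) else 0)"
  using AE_square_summable by eventually_elim (simp add: regularize_soft[OF assms])

text \<open>Almost sure equality with the soft threshold would give measurability only for complete
  \<open>M\<close>. On the exceptional event the minimizer is the fixed array \<open>J\<close>, so a
  case distinction on a measurable event settles every outcome.\<close>

lemma borel_measurable_regularize:
  assumes "0 < lam"
  shows "(\<lambda>\<omega>. regularize lam (\<lambda>l m. B l m \<omega>) l m) \<in> borel_measurable M"
proof -
  define J :: "'a harmonic_array" where "J = (SOME a. \<forall>l m. (l, m) \<notin> harmonic_indices \<longrightarrow> a l m = 0)"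
  have "(\<lambda>\<omega>. regularize lam (\<lambda>l m. B l m \<omega>) l m) =
     (\<lambda>\<omega>. if (\<lambda>(l, m). (norm (B l m \<omega>))\<^sup>2) summable_on harmonic_indices
           then (if \<bar>m\<bar> \<le> int l then soft lam (B l m \<omega>) else 0) else J l m)"
    by (auto simp: regularize_soft[OF assms] regularize_not_summable[OF assms] J_def fun_eq_iff)
  also have "\<dots> \<in> borel_measurable M"
  proof (cases "\<bar>m\<bar> \<le> int l")
    case True
    note [measurable] = B[OF True]
    from True show ?thesis by simp
  next
    case False
    then show ?thesis by (simp only: if_False) measurable
  qed
  finally show ?thesis .
qed

text \<open>Beyond a random degree the threshold annihilates every coefficient, so the harmonic
  series of the regularized fields terminate almost surely.\<close>

lemma AE_eventually_small:
  assumes "0 < e"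
  shows "AE \<omega> in M. \<exists>L. \<forall>l\<ge>L. \<forall>m. \<bar>m\<bar> \<le> int l \<longrightarrow> norm (B l m \<omega>) \<le> e"
  using AE_square_summable
proof eventually_elim
  case (elim \<omega>)
  let ?F = "{i \<in> harmonic_indices. e\<^sup>2 \<le> (\<lambda>(l, m). (norm (B l m \<omega>))\<^sup>2) i}"
  have "finite ?F"
    by (rule finite_large_terms[OF elim]) (use assms in auto)
  then obtain L where L: "\<forall>l\<in>fst ` ?F. l < L"
    using finite_nat_set_iff_bounded[of "fst ` ?F"] by auto
  have "norm (B l m \<omega>) \<le> e" if "L \<le> l" "\<bar>m\<bar> \<le> int l" for l m
  proof (rule ccontr)
    assume "\<not> norm (B l m \<omega>) \<le> e"
    then have "e\<^sup>2 \<le> (norm (B l m \<omega>))\<^sup>2" using assms by (intro power_mono) auto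
    then have "(l, m) \<in> ?F" using that by simp
    then have "l < L" using L by force
    with that show False by simp
  qed
  then show ?case by blast
qed

end

section \<open>Thresholded coefficients of the two schemes and their second moments\<close>

lemma AE_reg_coeff:
  "0 < lam \<Longrightarrow> AE \<omega> in M. \<forall>l m. reg_coeff lam a l m \<omega> = (if \<bar>m\<bar> \<le> int l then soft lam (a l m \<omega>) else 0)"
  unfolding reg_coeff_def using AE_regularize[of a, OF borel_measurable_coeff nn_integral_coeff_square_le] by simp

lemma AE_coeff_eventually_small:
  "0 < e \<Longrightarrow> AE \<omega> in M. \<exists>L. \<forall>l\<ge>L. \<forall>m. \<bar>m\<bar> \<le> int l \<longrightarrow> cmod (a l m \<omega>) \<le> e"
  using AE_eventually_small[of a, OF borel_measurable_coeff nn_integral_coeff_square_le] by simp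

lemma borel_measurable_reg_coeff: "0 < lam \<Longrightarrow> reg_coeff lam a l m \<in> borel_measurable M"
  unfolding reg_coeff_def[abs_def]
  using borel_measurable_regularize[of a, OF borel_measurable_coeff nn_integral_coeff_square_le] by simp

lemma AE_reg_coeff_real:
  "0 < lam \<Longrightarrow> AE \<omega> in M. \<forall>l m. reg_coeff_real lam a l m \<omega> =
     (if \<bar>m\<bar> \<le> int l then soft lam (real_coeffs (\<lambda>l m. a l m \<omega>) l m) else 0)"
  unfolding reg_coeff_real_def
  using AE_regularize[of "\<lambda>l m \<omega>. real_coeffs (\<lambda>l m. a l m \<omega>) l m",
      OF borel_measurable_real_coeffs nn_integral_real_coeffs_square_le] by simp

lemma borel_measurable_reg_coeff_real:
  "0 < lam \<Longrightarrow> reg_coeff_real lam a l m \<in> borel_measurable M"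
  unfolding reg_coeff_real_def[abs_def]
  using borel_measurable_regularize[of "\<lambda>l m \<omega>. real_coeffs (\<lambda>l m. a l m \<omega>) l m",
      OF borel_measurable_real_coeffs nn_integral_real_coeffs_square_le] by simp

lemma has_bochner_integral_reg_coeff:
  assumes "0 < lam" "\<bar>m\<bar> \<le> int l"
  shows "has_bochner_integral M (\<lambda>\<omega>. (cmod (reg_coeff lam a l m \<omega>))\<^sup>2)
     ((if m = 0 then gamma0 else gamma1) (C l) (lam / sqrt (C l)))"
proof (rule has_bochner_integral_nn_integral)
  note [measurable] = borel_measurable_reg_coeff[OF assms(1)]
  show "(\<lambda>\<omega>. (cmod (reg_coeff lam a l m \<omega>))\<^sup>2) \<in> borel_measurable M" by measurable
  show "0 \<le> (if m = 0 then gamma0 else gamma1) (C l) (lam / sqrt (C l))"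
    using assms C_pos[of l] gamma0_pos[of "lam / sqrt (C l)"] gamma1_pos[of "lam / sqrt (C l)"]
    by (auto simp: gamma0_scale[of "C l"] gamma1_scale[of "C l"] intro!: mult_nonneg_nonneg intro: less_imp_le)
  have "(\<integral>\<^sup>+\<omega>. ennreal ((cmod (reg_coeff lam a l m \<omega>))\<^sup>2) \<partial>M)
      = (\<integral>\<^sup>+\<omega>. ennreal ((max 0 (norm (a l m \<omega>) - lam))\<^sup>2) \<partial>M)"
  proof (rule nn_integral_cong_AE)
    show "AE \<omega> in M. ennreal ((cmod (reg_coeff lam a l m \<omega>))\<^sup>2) = ennreal ((max 0 (norm (a l m \<omega>) - lam))\<^sup>2)"
      using AE_reg_coeff[OF assms(1)] by eventually_elim (use assms in \<open>simp add: norm_soft\<close>)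
  qed
  then show "(\<integral>\<^sup>+\<omega>. ennreal ((cmod (reg_coeff lam a l m \<omega>))\<^sup>2) \<partial>M)
      = ennreal ((if m = 0 then gamma0 else gamma1) (C l) (lam / sqrt (C l)))"
    using nn_integral_coeff_soft[of m l lam] assms by simp
qed simp

text \<open>The square is taken without modulus in the complex numbers; it agrees with the squared
  modulus because \<open>a l 0\<close> is almost surely real and thresholding keeps it real.\<close>

lemma integral_reg_coeff_0:
  assumes "0 < lam"
  shows "(\<integral>\<omega>. (reg_coeff lam a l 0 \<omega>)\<^sup>2 \<partial>M) = complex_of_real (gamma0 (C l) (lam / sqrt (C l)))"
proof -
  note [measurable] = borel_measurable_reg_coeff[OF assms]
  have "AE \<omega> in M. (reg_coeff lam a l 0 \<omega>)\<^sup>2 = complex_of_real ((cmod (reg_coeff lam a l 0 \<omega>))\<^sup>2)"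
    using AE_reg_coeff[OF assms] AE_coeff_0[of l]
  proof eventually_elim
    case (elim \<omega>)
    have "reg_coeff lam a l 0 \<omega> = of_real (soft lam (Re (a l 0 \<omega>)))"
      using elim soft_of_real[of lam "Re (a l 0 \<omega>)"] by simp
    then show ?case by (simp add: power2_eq_square flip: of_real_mult)
  qed
  then have "(\<integral>\<omega>. (reg_coeff lam a l 0 \<omega>)\<^sup>2 \<partial>M) = (\<integral>\<omega>. complex_of_real ((cmod (reg_coeff lam a l 0 \<omega>))\<^sup>2) \<partial>M)"
    by (intro integral_cong_AE) auto
  also have "\<dots> = complex_of_real (\<integral>\<omega>. (cmod (reg_coeff lam a l 0 \<omega>))\<^sup>2 \<partial>M)"
    by (rule integral_complex_of_real)
  finally show ?thesis
    using has_bochner_integral_integral_eq[OF has_bochner_integral_reg_coeff[OF assms, of 0 l]] by simp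
qed

lemma integral_reg_coeff_real:
  assumes "0 < lam" "\<bar>m\<bar> \<le> int l"
  shows "(\<integral>\<omega>. (reg_coeff_real lam a l m \<omega>)\<^sup>2 \<partial>M) = gamma0 (C l) (lam / sqrt (C l))"
proof -
  note [measurable] = borel_measurable_reg_coeff_real[OF assms(1)]
  have "has_bochner_integral M (\<lambda>\<omega>. (reg_coeff_real lam a l m \<omega>)\<^sup>2) (gamma0 (C l) (lam / sqrt (C l)))"
  proof (rule has_bochner_integral_nn_integral)
    show "(\<lambda>\<omega>. (reg_coeff_real lam a l m \<omega>)\<^sup>2) \<in> borel_measurable M" by measurable
    show "0 \<le> gamma0 (C l) (lam / sqrt (C l))"
      using assms C_pos[of l] gamma0_pos[of "lam / sqrt (C l)"]
      by (subst gamma0_scale) (auto intro: less_imp_le)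
    have "(\<integral>\<^sup>+\<omega>. ennreal ((reg_coeff_real lam a l m \<omega>)\<^sup>2) \<partial>M)
        = (\<integral>\<^sup>+\<omega>. ennreal ((max 0 (norm (real_coeffs (\<lambda>l m. a l m \<omega>) l m) - lam))\<^sup>2) \<partial>M)"
    proof (rule nn_integral_cong_AE)
      show "AE \<omega> in M. ennreal ((reg_coeff_real lam a l m \<omega>)\<^sup>2)
          = ennreal ((max 0 (norm (real_coeffs (\<lambda>l m. a l m \<omega>) l m) - lam))\<^sup>2)"
        using AE_reg_coeff_real[OF assms(1)]
      proof eventually_elim
        case (elim \<omega>)
        then show ?case using assms norm_soft[OF assms(1), of "real_coeffs (\<lambda>l m. a l m \<omega>) l m"]
          by (metis power2_abs real_norm_def)
      qed
    qed
    then show "(\<integral>\<^sup>+\<omega>. ennreal ((reg_coeff_real lam a l m \<omega>)\<^sup>2) \<partial>M) = ennreal (gamma0 (C l) (lam / sqrt (C l)))"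
      using nn_integral_real_coeffs_soft[of m l lam] assms by simp
  qed simp
  then show ?thesis by (rule has_bochner_integral_integral_eq)
qed

end

section \<open>Spherical harmonics and zero sets\<close>

text \<open>At a zero of order n, only the term in which all n derivatives fall on the power
  survives. The cofactor \<open>q\<close> is arbitrary because each derivative changes it.\<close>

lemma poly_iterated_pderiv_root_power:
  "poly ((pderiv ^^ n) ([:- c, 1:] ^ n * q)) c = fact n * poly q (c :: real)"
proof (induction n arbitrary: q)
  case (Suc n)
  have "pderiv ([:- c, 1:] ^ Suc n * q) = [:- c, 1:] ^ n * (smult (of_nat (Suc n)) q + [:- c, 1:] * pderiv q)"
    by (simp only: pderiv_mult pderiv_power_Suc) (simp add: pderiv_pCons algebra_simps)
  then have "poly ((pderiv ^^ Suc n) ([:- c, 1:] ^ Suc n * q)) c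
      = fact n * poly (smult (of_nat (Suc n)) q + [:- c, 1:] * pderiv q) c"
    by (simp only: funpow_Suc_right comp_apply Suc.IH)
  then show ?case by (simp add: algebra_simps)
qed simp

text \<open>In Rodrigues' formula \<open>x^2 - 1\<close> factors as
  \<open>(x - 1) * (x + 1)\<close>; at 1 the cofactor gives \<open>2 ^ l\<close>, the derivatives
  give \<open>fact l\<close>, and both cancel.\<close>

lemma legendre_1: "legendre l 1 = 1"
proof -
  have "[:-1, 0, 1:] ^ l = [:- 1, 1:] ^ l * [:1, 1 :: real:] ^ l"
    by (simp flip: power_mult_distrib)
  then show ?thesis
    unfolding legendre_poly_def by (simp add: poly_iterated_pderiv_root_power)
qed

lemma sph_point_0_0: "sph_point 0 0 = axis 3 1"
  by (simp add: vec_eq_iff forall_3 axis_def sph_point_def)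

lemma sph_point_in_S2: "sph_point \<theta> \<phi> \<in> S2"
proof -
  have "(norm (sph_point \<theta> \<phi>))\<^sup>2 = (sin \<theta> * cos \<phi>)\<^sup>2 + (sin \<theta> * sin \<phi>)\<^sup>2 + (cos \<theta>)\<^sup>2"
    unfolding power2_norm_eq_inner by (simp add: sph_point_def inner_vec_def sum_3 power2_eq_square)
  also have "\<dots> = (sin \<theta>)\<^sup>2 * ((cos \<phi>)\<^sup>2 + (sin \<phi>)\<^sup>2) + (cos \<theta>)\<^sup>2"
    by (simp only: power_mult_distrib distrib_left)
  finally have "(norm (sph_point \<theta> \<phi>))\<^sup>2 = 1" by simp
  then show ?thesis by (simp add: norm_eq_1 power2_norm_eq_inner)
qed

lemma sph_point_3: "sph_point \<theta> \<phi> $ 3 = cos \<theta>"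
  by (simp add: sph_point_def)

lemma sph_harm_0:
  "sph_harm l 0 (sph_point \<theta> \<phi>) = of_real (sqrt ((2 * real l + 1) / (4 * pi)) * legendre l (cos \<theta>))"
  by (simp add: sph_harm_def sph_harm_angles_def sph_harm_nonneg_def assoc_legendre_def sph_point_3)

text \<open>The associated Legendre function of order m contains a power of
  \<open>sqrt (1 - x^2)\<close>, which vanishes at \<open>x = 1\<close>.\<close>

lemma sph_harm_north_pole: "m \<noteq> 0 \<Longrightarrow> sph_harm l m (sph_point 0 0) = 0"
  by (simp add: sph_harm_def sph_harm_angles_def sph_harm_nonneg_def assoc_legendre_def sph_point_3)

lemma sph_harm_uminus: "0 < m \<Longrightarrow> sph_harm l (- m) x = (-1) ^ nat m * cnj (sph_harm l m x)"
  by (simp add: sph_harm_def sph_harm_angles_def)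

text \<open>Away from the poles sin \<theta> is positive, so the longitude is read off as 0 and the
  phase factor is 1.\<close>

lemma sph_harm_zero_longitude:
  assumes "0 < \<theta>" "\<theta> < pi" "0 \<le> m"
  shows "sph_harm l m (sph_point \<theta> 0) = of_real (Re (sph_harm l m (sph_point \<theta> 0)))"
proof -
  have "Complex (sin \<theta>) 0 = of_real (sin \<theta>)" by (simp add: complex_eq_iff)
  moreover have "Arg (of_real (sin \<theta>)) = 0"
    using sin_gt_zero[OF assms(1,2)] by (simp add: Arg_of_real)
  ultimately show ?thesis
    using assms(3) by (simp add: sph_harm_def sph_harm_angles_def sph_harm_nonneg_def sph_point_def)
qed

lemma sph_harm_1_1_nonzero:
  assumes "0 < \<theta>" "\<theta> < pi"
  shows "sph_harm 1 1 (sph_point \<theta> 0) \<noteq> 0"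
proof -
  have "legendre_poly 1 = [:0, 1:]" by (simp add: legendre_poly_def pderiv_pCons)
  then have "assoc_legendre 1 1 (cos \<theta>) = - sqrt (1 - (cos \<theta>)\<^sup>2)"
    by (simp add: assoc_legendre_def pderiv_pCons)
  moreover have "1 - (cos \<theta>)\<^sup>2 = (sin \<theta>)\<^sup>2" by (simp add: sin_squared_eq)
  ultimately have "assoc_legendre 1 1 (cos \<theta>) \<noteq> 0"
    using sin_gt_zero[OF assms] by simp
  then show ?thesis
    using assms by (simp add: sph_harm_def sph_harm_angles_def sph_harm_nonneg_def sph_point_3 arccos_cos)
qed

text \<open>Countably many nonzero polynomials have countably many roots in total, and the value 1
  at the point 1 shows that no Legendre polynomial is zero.\<close>

lemma legendre_nonzero_angle:
  obtains \<theta> where "0 < \<theta>" "\<theta> < pi" "\<And>l. legendre l (cos \<theta>) \<noteq> 0"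
proof -
  have "legendre_poly l \<noteq> 0" for l using legendre_1[of l] by auto
  then have "countable (\<Union>l. {x. legendre l x = 0})"
    by (intro countable_UN) (auto intro!: countable_finite poly_roots_finite)
  moreover have "uncountable {-1<..<1::real}" by (simp add: uncountable_open_interval)
  ultimately have "\<not> {-1<..<1} \<subseteq> (\<Union>l. {x. legendre l x = 0})"
    using countable_subset by blast
  then obtain x where "x \<in> {-1<..<1}" "x \<notin> (\<Union>l. {x. legendre l x = 0})" by blast
  then have x: "-1 < x" "x < 1" "\<And>l. legendre l x \<noteq> 0" by auto
  show ?thesis
  proof
    show "0 < arccos x" "arccos x < pi" using arccos_lt_bounded[of x] x by auto
    show "legendre l (cos (arccos x)) \<noteq> 0" for l using x by (simp add: cos_arccos)
  qed
qed

text \<open>Each nonzero value of the soft threshold has a single preimage, so thresholding a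
  continuous law creates no atom other than the one at 0.\<close>

lemma soft_real_eq:
  fixes r d :: real
  assumes "0 < lam" "soft lam r = d" "d \<noteq> 0"
  shows "r = d + lam * sgn d"
proof -
  have "lam < \<bar>r\<bar>" using soft_eq_0_iff[OF assms(1), of r] assms by force
  then have "0 < 1 - lam / \<bar>r\<bar>" using assms(1) by (auto simp: field_simps)
  then have d: "d = (1 - lam / \<bar>r\<bar>) * r" using assms(2) by (simp add: soft_def)
  have "sgn d = sgn r"
    unfolding d sgn_mult using \<open>0 < 1 - lam / \<bar>r\<bar>\<close> by simp
  then show ?thesis
    unfolding d using \<open>lam < \<bar>r\<bar>\<close> by (cases "0 < r") (auto simp: sgn_if field_simps)
qed

section \<open>Events of positive probability and the zero set at a generic point\<close>

context gaussian_harmonics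
begin

abbreviation half_indices :: "(nat \<times> int) set" where
  "half_indices \<equiv> {(l, m) \<in> harmonic_indices. 0 \<le> m}"

lemma prob_coeff_small_pos:
  assumes "\<bar>m\<bar> \<le> int l" "0 < e"
  shows "0 < prob {\<omega> \<in> space M. cmod (a l m \<omega>) \<le> e}"
proof (cases "m = 0")
  case True
  note [measurable] = borel_measurable_coeff[of 0 l, simplified]
  have "0 < prob {\<omega> \<in> space M. - e \<le> Re (a l 0 \<omega>) \<and> Re (a l 0 \<omega>) \<le> e}"
    by (rule normal_prob_interval_pos[OF distributed_coeff_0]) (use assms C_pos[of l] in auto)
  also have "\<dots> = prob {\<omega> \<in> space M. cmod (a l 0 \<omega>) \<le> e}"
  proof (rule measure_eq_AE)
    show "AE \<omega> in M. \<omega> \<in> {\<omega> \<in> space M. - e \<le> Re (a l 0 \<omega>) \<and> Re (a l 0 \<omega>) \<le> e}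
        \<longleftrightarrow> \<omega> \<in> {\<omega> \<in> space M. cmod (a l 0 \<omega>) \<le> e}"
      using AE_coeff_0[of l]
    proof eventually_elim
      case (elim \<omega>)
      then have "cmod (a l 0 \<omega>) = \<bar>Re (a l 0 \<omega>)\<bar>" by (metis norm_of_real)
      then show ?case by auto
    qed
  qed measurable
  finally show ?thesis using True by simp
next
  case False
  note [measurable] = borel_measurable_coeff[OF assms(1)]
  \<comment> \<open>Half the radius for each part suffices, since the modulus is at most the sum of
    the absolute values of the parts.\<close>
  have pos: "0 < sqrt (C l / 2)" "- (e / 2) < e / 2" using assms C_pos[of l] by auto
  let ?X = "\<lambda>\<omega>. Re (a l m \<omega>)" and ?Y = "\<lambda>\<omega>. Im (a l m \<omega>)" and ?J = "{- (e / 2)..e / 2}"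
  have "0 < prob (?X -` ?J \<inter> space M) * prob (?Y -` ?J \<inter> space M)"
    using normal_prob_interval_pos[OF distributed_Re[OF assms(1) False] pos]
      normal_prob_interval_pos[OF distributed_Im[OF assms(1) False] pos]
    by (intro mult_pos_pos) (simp_all add: vimage_def Int_def conj_commute)
  also have "\<dots> = prob ((\<lambda>\<omega>. (?X \<omega>, ?Y \<omega>)) -` (?J \<times> ?J) \<inter> space M)"
    by (rule indep_varD[OF indep_Re_Im[OF assms(1) False], symmetric]) auto
  also have "\<dots> \<le> prob {\<omega> \<in> space M. cmod (a l m \<omega>) \<le> e}"
  proof (rule finite_measure_mono)
    have "cmod z \<le> e" if "\<bar>Re z\<bar> \<le> e / 2" "\<bar>Im z\<bar> \<le> e / 2" for z
      using cmod_le[of z] that by linarith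
    then show "(\<lambda>\<omega>. (?X \<omega>, ?Y \<omega>)) -` (?J \<times> ?J) \<inter> space M \<subseteq> {\<omega> \<in> space M. cmod (a l m \<omega>) \<le> e}"
      by auto
  qed measurable
  finally show ?thesis .
qed

text \<open>Chebyshev's inequality; the bound is summable over the index set, as required for the
  infinite intersection.\<close>

lemma prob_coeff_large_le:
  assumes "\<bar>m\<bar> \<le> int l" "0 < e"
  shows "1 - prob {\<omega> \<in> space M. cmod (a l m \<omega>) \<le> e} \<le> 2 / e\<^sup>2 * C l"
proof -
  note [measurable] = borel_measurable_coeff[OF assms(1)]
  let ?E = "{\<omega> \<in> space M. \<not> cmod (a l m \<omega>) \<le> e}"
  have "emeasure M ?E = (\<integral>\<^sup>+\<omega>. indicator ?E \<omega> \<partial>M)" by simp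
  also have "\<dots> \<le> (\<integral>\<^sup>+\<omega>. ennreal (1 / e\<^sup>2) * ennreal ((cmod (a l m \<omega>))\<^sup>2) \<partial>M)"
  proof (rule nn_integral_mono)
    fix \<omega>
    show "indicator ?E \<omega> \<le> ennreal (1 / e\<^sup>2) * ennreal ((cmod (a l m \<omega>))\<^sup>2)"
    proof (cases "\<omega> \<in> ?E")
      case True
      then have "e\<^sup>2 \<le> (cmod (a l m \<omega>))\<^sup>2" using assms by (intro power_mono) auto
      then have "1 \<le> 1 / e\<^sup>2 * (cmod (a l m \<omega>))\<^sup>2" using assms by (simp add: field_simps)
      then show ?thesis using True
        by (simp only: indicator_simps ennreal_mult''[symmetric] zero_le_power2 ennreal_1[symmetric] ennreal_leI)
    qed simp
  qed
  also have "\<dots> = ennreal (1 / e\<^sup>2) * (\<integral>\<^sup>+\<omega>. ennreal ((cmod (a l m \<omega>))\<^sup>2) \<partial>M)"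
    by (rule nn_integral_cmult) measurable
  also have "\<dots> \<le> ennreal (1 / e\<^sup>2) * ennreal (2 * C l)"
    by (intro mult_left_mono nn_integral_coeff_square_le assms) simp
  also have "\<dots> = ennreal (2 / e\<^sup>2 * C l)" using C_pos[of l] by (simp add: ennreal_mult'[symmetric])
  finally have "prob ?E \<le> 2 / e\<^sup>2 * C l"
    using C_pos[of l] by (simp add: emeasure_eq_measure)
  then show ?thesis by (subst (asm) prob_neg) auto
qed

text \<open>The index (1, 1) is the lowest one with m > 0. For \<open>D\<close> a small ball every
  coefficient is annihilated, for \<open>D\<close> a half-plane far to the right only
  \<open>a 1 1\<close> survives. Indices with m < 0 are left out because they are determined by the
  others.\<close>

lemma prob_all_coeffs_pos:
  assumes e: "0 < e" and D: "D \<in> sets borel" "0 < prob {\<omega> \<in> space M. a 1 1 \<omega> \<in> D}"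
  shows "0 < prob {\<omega> \<in> space M. \<forall>i\<in>half_indices. (\<lambda>(l, m). a l m) i \<omega> \<in> (if i = (1, 1) then D else cball 0 e)}"
proof (rule prob_all_indep_pos[OF _ _ indep_coeffs])
  let ?p = "\<lambda>i. prob {\<omega> \<in> space M. (\<lambda>(l, m). a l m) i \<omega> \<in> (if i = (1, 1) then D else cball 0 e)}"
  show "countable half_indices"
    by (rule countable_subset[OF _ countable_harmonic_indices]) auto
  have "(1, 1) \<in> half_indices" by simp
  then show "half_indices \<noteq> {}" by blast
  show "(if i = (1, 1) then D else cball 0 e) \<in> sets borel" for i using D by auto
  show "0 < ?p i" if "i \<in> half_indices" for i
    using D prob_coeff_small_pos[OF _ e] that by (cases i) auto
  have "(\<lambda>i. 1 - ?p i) summable_on (half_indices - {(1, 1)})"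
  proof (rule summable_on_comparison_test)
    show "(\<lambda>i. 2 / e\<^sup>2 * (\<lambda>(l, m). C l) i) summable_on (half_indices - {(1, 1)})"
      by (rule summable_on_subset_banach[OF summable_on_cmult_right[OF admissible_spectrum_summable[OF spectrum]]]) auto
    show "1 - ?p i \<le> 2 / e\<^sup>2 * (\<lambda>(l, m). C l) i" if "i \<in> half_indices - {(1, 1)}" for i
      using prob_coeff_large_le[OF _ e] that by (cases i) auto
  qed auto
  \<comment> \<open>Restoring the exceptional index adds one term and does not affect
    summability.\<close>
  then have "(\<lambda>i. 1 - ?p i) summable_on ((half_indices - {(1, 1)}) \<union> {(1, 1)})"
    by (intro summable_on_Un_disjoint) auto
  moreover have "(half_indices - {(1, 1)}) \<union> {(1, 1)} = half_indices" by auto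
  ultimately show "(\<lambda>i. 1 - ?p i) summable_on half_indices" by simp
qed

lemma prob_Re_coeff_large_pos: "0 < prob {\<omega> \<in> space M. a 1 1 \<omega> \<in> {z. c < Re z}}"
proof -
  note [measurable] = borel_measurable_coeff[of 1 1, simplified]
  have "0 < prob {\<omega> \<in> space M. c + 1 \<le> Re (a 1 1 \<omega>) \<and> Re (a 1 1 \<omega>) \<le> c + 2}"
    by (rule normal_prob_interval_pos[OF distributed_Re]) (use C_pos[of 1] in auto)
  also have "\<dots> \<le> prob {\<omega> \<in> space M. a 1 1 \<omega> \<in> {z. c < Re z}}"
    by (intro finite_measure_mono) auto
  finally show ?thesis .
qed

text \<open>\<open>h l m\<close> stands for the joint contribution of the orders m and -m at a fixed
  point, which lets both schemes use the same argument. Almost surely \<open>R = 0\<close> implies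
  that the zonal coefficients are below the threshold (event \<open>E\<close>) but excludes the
  event \<open>F\<close> inside \<open>E\<close> on which only \<open>a 1 1\<close>
  contributes.\<close>

lemma zero_probability:
  fixes h :: "nat \<Rightarrow> int \<Rightarrow> complex \<Rightarrow> real" and R :: "'w \<Rightarrow> real"
  assumes lam: "0 < lam" and R_meas [measurable]: "R \<in> borel_measurable M"
    and h_meas [measurable]: "\<And>l m. h l m \<in> borel_measurable borel"
    and h_0: "\<And>l z. h l 0 z = soft lam (Re z) * y l" and y: "\<And>l. y l \<noteq> 0"
    and h_small: "\<And>l m z. 0 \<le> m \<Longrightarrow> cmod z \<le> lam / sqrt 2 \<Longrightarrow> h l m z = 0"
    and h_large: "\<And>z. lam < Re z \<Longrightarrow> h 1 1 z \<noteq> 0"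
    and R: "AE \<omega> in M. R \<omega> = (\<Sum>l. \<Sum>m = 0..int l. h l m (a l m \<omega>))"
  shows "0 < prob {\<omega> \<in> space M. R \<omega> = 0}" "0 < prob {\<omega> \<in> space M. R \<omega> \<noteq> 0}"
    and "prob {\<omega> \<in> space M. R \<omega> = 0} < prob {\<omega> \<in> space M. \<forall>l. \<bar>Re (a l 0 \<omega>)\<bar> \<le> lam}"
proof -
  \<comment> \<open>The real-valued scheme thresholds \<open>sqrt 2 * Re z\<close>, so the modulus
    has to be below \<open>lam / sqrt 2\<close> to be annihilated in both schemes.\<close>
  define e where "e = lam / sqrt 2"
  have e: "0 < e" "e \<le> lam"
    using lam by (auto simp: e_def field_simps)
  define S where "S l \<omega> = (\<Sum>m = 0..int l. h l m (a l m \<omega>))" for l \<omega>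
  note a_meas [measurable] = borel_measurable_coeff
  have [measurable]: "a l 0 \<in> borel_measurable M" for l by simp
  have [measurable]: "(\<lambda>(l, m). a l m) i \<in> borel_measurable M" if "i \<in> half_indices" for i
    using that by (cases i) auto
  have [measurable]: "S l \<in> borel_measurable M" for l
    unfolding S_def by (intro borel_measurable_sum measurable_compose[OF a_meas h_meas]) auto
  have ctbl [simp]: "countable half_indices"
    by (rule countable_subset[OF _ countable_harmonic_indices]) auto
  have S_small: "S l \<omega> = 0" if "\<And>m. 0 \<le> m \<Longrightarrow> m \<le> int l \<Longrightarrow> cmod (a l m \<omega>) \<le> e" for l \<omega>
    unfolding S_def using that by (intro sum.neutral) (auto simp: h_small e_def)

  define G where "G D = {\<omega> \<in> space M. \<forall>i\<in>half_indices. (\<lambda>(l, m). a l m) i \<omega> \<in> (if i = (1, 1) then D else cball 0 e)}" for D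
  have G_events [measurable]: "G D \<in> events" if [measurable]: "D \<in> sets borel" for D
    unfolding G_def pred_def[symmetric]
  proof (rule pred_intros_countable_bounded(3))
    fix i assume "i \<in> half_indices"
    then have "(\<lambda>(l, m). a l m) i \<in> borel_measurable M" by measurable
    from measurable_sets[OF this, of "if i = (1, 1) then D else cball 0 e"]
    show "Measurable.pred M (\<lambda>\<omega>. (\<lambda>(l, m). a l m) i \<omega> \<in> (if i = (1, 1) then D else cball 0 e))"
      by (simp add: pred_def vimage_def Int_def conj_commute)
  qed
  have GD: "a l m \<omega> \<in> (if (l, m) = (1, 1) then D else cball 0 e)" if "\<omega> \<in> G D" "0 \<le> m" "m \<le> int l" for l m \<omega> D
    using that unfolding G_def by (auto dest!: bspec[of _ _ "(l, m)"])
  have "0 < prob (G (cball 0 e))"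
    unfolding G_def using e(1) prob_coeff_small_pos[of 1 1 e] by (intro prob_all_coeffs_pos) auto
  also have "\<dots> \<le> prob {\<omega> \<in> space M. R \<omega> = 0}"
  proof (rule finite_measure_mono_AE)
    show "AE \<omega> in M. \<omega> \<in> G (cball 0 e) \<longrightarrow> \<omega> \<in> {\<omega> \<in> space M. R \<omega> = 0}"
      using R AE_space
    proof eventually_elim
      case (elim \<omega>)
      have "S l \<omega> = 0" if "\<omega> \<in> G (cball 0 e)" for l
        using GD[OF that, of _ l] by (intro S_small) (auto split: if_splits)
      then show ?case using elim unfolding S_def by simp
    qed
  qed measurable
  finally show "0 < prob {\<omega> \<in> space M. R \<omega> = 0}" .

  define F where "F = G {z. lam < Re z}"
  have [measurable]: "F \<in> events" unfolding F_def by measurable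
  have "0 < prob F"
    unfolding F_def G_def using e(1) prob_Re_coeff_large_pos by (intro prob_all_coeffs_pos) auto
  have F_R: "AE \<omega> in M. \<omega> \<in> F \<longrightarrow> R \<omega> \<noteq> 0"
    using R
  proof eventually_elim
    case (elim \<omega>)
    show ?case
    proof
      assume F: "\<omega> \<in> F"
      have "S l \<omega> = 0" if "l \<noteq> 1" for l
        using GD[OF F[unfolded F_def], of _ l] that by (intro S_small) (auto split: if_splits)
      then have "(\<Sum>l. S l \<omega>) = (\<Sum>l\<in>{1}. S l \<omega>)" by (intro suminf_finite) auto
      also have "\<dots> = S 1 \<omega>" by simp
      also have "\<dots> = h 1 0 (a 1 0 \<omega>) + h 1 1 (a 1 1 \<omega>)"
      proof -
        have "{0..int 1} = {0, 1}" by auto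
        then show ?thesis by (simp add: S_def)
      qed
      also have "h 1 0 (a 1 0 \<omega>) = 0"
        using GD[OF F[unfolded F_def], of 0 1] by (intro h_small) (auto simp: e_def)
      finally show "R \<omega> \<noteq> 0"
        using elim h_large[of "a 1 1 \<omega>"] GD[OF F[unfolded F_def], of 1 1] unfolding S_def by simp
    qed
  qed
  have "prob F \<le> prob {\<omega> \<in> space M. R \<omega> \<noteq> 0}"
    by (rule finite_measure_mono_AE) (use F_R AE_space in \<open>eventually_elim, simp\<close>, measurable)
  with \<open>0 < prob F\<close> show "0 < prob {\<omega> \<in> space M. R \<omega> \<noteq> 0}" by simp

  define E where "E = {\<omega> \<in> space M. \<forall>l. \<bar>Re (a l 0 \<omega>)\<bar> \<le> lam}"
  have [measurable]: "E \<in> events" unfolding E_def by measurable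
  have "F \<subseteq> E"
  proof
    fix \<omega> assume F: "\<omega> \<in> F"
    have "\<bar>Re (a l 0 \<omega>)\<bar> \<le> lam" for l
      using GD[OF F[unfolded F_def], of 0 l] e(2) abs_Re_le_cmod[of "a l 0 \<omega>"] by auto
    moreover have "\<omega> \<in> space M" using F by (simp add: F_def G_def)
    ultimately show "\<omega> \<in> E" by (simp add: E_def)
  qed

  define Y where "Y i \<omega> = (\<lambda>(l, m). h l m (a l m \<omega>)) i" for i \<omega>
  have indep_Y: "indep_vars (\<lambda>_. borel) Y half_indices"
  proof -
    have "indep_vars (\<lambda>_. borel) (\<lambda>i \<omega>. (\<lambda>(l, m). h l m) i ((\<lambda>(l, m). a l m) i \<omega>)) half_indices"
      by (rule indep_vars_compose2[OF indep_coeffs]) auto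
    then show ?thesis unfolding Y_def by (simp add: split_def)
  qed
  \<comment> \<open>Stated for finite partial sums, so that the other terms add up to one variable
    independent of the zonal term of degree \<open>k\<close>.\<close>
  have no_cancel: "AE \<omega> in M. (\<Sum>l<L. S l \<omega>) = 0 \<longrightarrow> Y (k, 0) \<omega> = 0" if "k < L" for k L
  proof -
    define J where "J = Sigma {..<L} (\<lambda>l. {0..int l}) - {(k, 0)}"
    have ins: "insert (k, 0) J = Sigma {..<L} (\<lambda>l. {0..int l})" using that by (auto simp: J_def)
    have J: "finite J" "(k, 0) \<notin> J" by (auto simp: J_def)
    have "indep_var borel (Y (k, 0)) borel (\<lambda>\<omega>. \<Sum>i\<in>J. Y i \<omega>)"
      by (rule indep_vars_sum[OF J]) (rule indep_vars_subset[OF indep_Y], auto simp: ins)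
    \<comment> \<open>Dividing by the nonzero \<open>y k\<close>, a nonzero value of the term pins
      \<open>Re (a k 0)\<close> to one point, a null event for a Gaussian.\<close>
    moreover have "prob {\<omega> \<in> space M. Y (k, 0) \<omega> = c} = 0" if "c \<noteq> 0" for c
    proof -
      have "{\<omega> \<in> space M. Y (k, 0) \<omega> = c} \<subseteq> {\<omega> \<in> space M. Re (a k 0 \<omega>) = c / y k + lam * sgn (c / y k)}"
        using soft_real_eq[OF lam, of "Re (a k 0 _)" "c / y k"] y[of k] that
        by (auto simp: Y_def h_0 field_simps)
      then have "prob {\<omega> \<in> space M. Y (k, 0) \<omega> = c}
          \<le> prob {\<omega> \<in> space M. Re (a k 0 \<omega>) = c / y k + lam * sgn (c / y k)}"
        by (intro finite_measure_mono) measurable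
      also have "\<dots> = 0" by (rule normal_prob_eq_0[OF distributed_coeff_0])
      finally show ?thesis by (simp add: measure_le_0_iff)
    qed
    ultimately have "AE \<omega> in M. Y (k, 0) \<omega> + (\<Sum>i\<in>J. Y i \<omega>) = 0 \<longrightarrow> Y (k, 0) \<omega> = 0"
      by (rule AE_indep_sum_nonzero)
    moreover have "Y (k, 0) \<omega> + (\<Sum>i\<in>J. Y i \<omega>) = (\<Sum>l<L. S l \<omega>)" for \<omega>
      unfolding sum.insert[OF J, of "\<lambda>i. Y i \<omega>", symmetric] ins S_def
      by (subst sum.Sigma) (auto simp: Y_def split_def)
    ultimately show ?thesis by simp
  qed
  have "prob {\<omega> \<in> space M. R \<omega> = 0} \<le> prob (E - F)"
  proof (rule finite_measure_mono_AE)
    \<comment> \<open>There are countably many pairs, so one null set covers the random cut-off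
      chosen below.\<close>
    have "AE \<omega> in M. \<forall>L. \<forall>k<L. (\<Sum>l<L. S l \<omega>) = 0 \<longrightarrow> Y (k, 0) \<omega> = 0"
      using no_cancel by (simp add: AE_all_countable)
    then show "AE \<omega> in M. \<omega> \<in> {\<omega> \<in> space M. R \<omega> = 0} \<longrightarrow> \<omega> \<in> E - F"
      using R F_R AE_coeff_eventually_small[OF e(1)]
    proof eventually_elim
      case (elim \<omega>)
      show ?case
      proof
        assume \<omega>: "\<omega> \<in> {\<omega> \<in> space M. R \<omega> = 0}"
        obtain L0 where L0: "\<And>l m. L0 \<le> l \<Longrightarrow> \<bar>m\<bar> \<le> int l \<Longrightarrow> cmod (a l m \<omega>) \<le> e"
          using elim(4) by auto
        have "\<bar>Re (a k 0 \<omega>)\<bar> \<le> lam" for k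
        proof -
          \<comment> \<open>Large enough that the tail vanishes and that degree \<open>k\<close> is
            among the summands.\<close>
          define L where "L = max L0 (Suc k)"
          have "S l \<omega> = 0" if "l \<notin> {..<L}" for l
            using that by (intro S_small L0) (auto simp: L_def)
          then have "(\<Sum>l. S l \<omega>) = (\<Sum>l<L. S l \<omega>)" by (intro suminf_finite) auto
          then have "(\<Sum>l<L. S l \<omega>) = 0" using elim(2) \<omega> unfolding S_def by simp
          moreover have "k < L" by (simp add: L_def)
          ultimately have "Y (k, 0) \<omega> = 0" using elim(1) by blast
          then have "soft lam (Re (a k 0 \<omega>)) = 0" using y[of k] by (simp add: Y_def h_0)
          then show ?thesis using soft_eq_0_iff[OF lam, of "Re (a k 0 \<omega>)"] by simp
        qed
        then show "\<omega> \<in> E - F" using \<omega> elim(3) by (auto simp: E_def)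
      qed
    qed
  qed measurable
  also have "\<dots> = prob E - prob F"
    using \<open>F \<subseteq> E\<close> by (intro finite_measure_Diff) auto
  also have "\<dots> < prob E" using \<open>0 < prob F\<close> by simp
  finally show "prob {\<omega> \<in> space M. R \<omega> = 0} < prob {\<omega> \<in> space M. \<forall>l. \<bar>Re (a l 0 \<omega>)\<bar> \<le> lam}"
    by (simp add: E_def)
qed

end

section \<open>The regularized fields\<close>

lemma soft_minus_one_power: "soft lam ((-1) ^ n * z) = (-1) ^ n * soft lam (z :: complex)"
  by (cases "even n") (simp_all add: soft_uminus)

lemma sum_symmetric_interval:
  fixes f :: "int \<Rightarrow> 'b :: comm_monoid_add"
  shows "(\<Sum>m = - int l..int l. f m) = f 0 + (\<Sum>m = 1..int l. f m + f (- m))"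
proof -
  have img: "uminus ` {1..int l} = {- int l..- 1}" by simp
  have eq: "{- int l..int l} = insert 0 ({1..int l} \<union> uminus ` {1..int l})"
    unfolding img by auto
  have "(\<Sum>m\<in>uminus ` {1..int l}. f m) = (\<Sum>m = 1..int l. f (- m))"
    by (subst sum.reindex) auto
  moreover have "{1..int l} \<inter> uminus ` {1..int l} = {}" "0 \<notin> {1..int l} \<union> uminus ` {1..int l}"
    unfolding img by auto
  ultimately show ?thesis
    unfolding eq by (simp add: sum.union_disjoint sum.distrib del: image_uminus_atLeastAtMost)
qed

lemma sum_nonneg_interval:
  fixes f :: "int \<Rightarrow> 'b :: comm_monoid_add"
  shows "(\<Sum>m = 0..int l. f m) = f 0 + (\<Sum>m = 1..int l. f m)"
proof -
  have "{0..int l} = insert 0 {1..int l}" by auto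
  then show ?thesis by simp
qed

text \<open>A Gaussian variable, degenerate or not, takes the value 0 with probability 0 or 1; one
  point and one direction \<open>v\<close> suffice for a contradiction.\<close>

lemma (in prob_space) not_gaussian_field:
  fixes T :: "('a, 'b :: euclidean_space) field"
  assumes T: "random_field M T" and x: "x \<in> S2"
    and z: "0 < prob {\<omega> \<in> space M. v \<bullet> T x \<omega> = 0}" and nz: "0 < prob {\<omega> \<in> space M. v \<bullet> T x \<omega> \<noteq> 0}"
  shows "\<not> gaussian_field M T"
proof
  define R where "R \<omega> = v \<bullet> T x \<omega>" for \<omega>
  have [measurable]: "T x \<in> borel_measurable M" using T x by (simp add: random_field_def)
  have [measurable]: "R \<in> borel_measurable M" unfolding R_def by measurable
  assume "gaussian_field M T"
  from this[unfolded gaussian_field_def, rule_format, of "{x}" "\<lambda>_. v"] x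
  have "gaussian_rv M R" by (simp add: R_def[abs_def])
  then consider \<mu> where "AE \<omega> in M. R \<omega> = \<mu>"
    | \<mu> \<sigma> where "0 < \<sigma>" "distributed M lborel R (normal_density \<mu> \<sigma>)"
    unfolding gaussian_rv_def by blast
  then show False
  proof cases
    case 1
    have "prob {\<omega> \<in> space M. R \<omega> \<noteq> 0} = 0 \<or> prob {\<omega> \<in> space M. R \<omega> = 0} = 0"
    proof (cases "\<mu> = 0")
      case True
      have "AE \<omega> in M. \<omega> \<notin> {\<omega> \<in> space M. R \<omega> \<noteq> 0}"
        using 1 by eventually_elim (simp add: True)
      then show ?thesis using prob_eq_0[of "{\<omega> \<in> space M. R \<omega> \<noteq> 0}"] by simp
    next
      case False
      have "AE \<omega> in M. \<omega> \<notin> {\<omega> \<in> space M. R \<omega> = 0}"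
        using 1 by eventually_elim (simp add: False)
      then show ?thesis using prob_eq_0[of "{\<omega> \<in> space M. R \<omega> = 0}"] by simp
    qed
    with z nz show False by (auto simp: R_def)
  next
    case 2
    with z normal_prob_eq_0[OF 2(2), of 0] show False by (simp add: R_def)
  qed
qed

text \<open>A rotation carrying the pole to \<open>x\<close> equates the probabilities of the value
  0 at these points, and projecting onto \<open>v\<close> can only enlarge the zero event at
  \<open>x\<close>.\<close>

lemma (in prob_space) not_isotropic_field:
  fixes T :: "('a, 'b :: euclidean_space) field"
  assumes T: "random_field M T" and x: "x \<in> S2"
    and less: "prob {\<omega> \<in> space M. v \<bullet> T x \<omega> = 0} < prob {\<omega> \<in> space M. T (axis 3 1) \<omega> = 0}"
  shows "\<not> isotropic_field M T"
proof
  let ?p = "axis 3 1 :: real ^ 3" and ?P = "PiM S2 (\<lambda>_. borel) :: (real ^ 3 \<Rightarrow> 'b) measure"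
  let ?A = "{f \<in> space ?P. f ?p = 0}"
  assume iso: "isotropic_field M T"
  obtain g :: "real ^ 3 ^ 3" where g: "rotation_matrix g" "g *v ?p = x"
    by (rule rotation_matrix_exists_basis[of x 3]) (use x in simp_all)
  have p: "?p \<in> S2" by simp
  have "orthogonal_transformation ((*v) g)"
    using g(1) by (simp add: rotation_matrix_def orthogonal_transformation_matrix)
  then have gS: "g *v q \<in> S2" if "q \<in> S2" for q
    using that by (simp add: orthogonal_transformation)
  have "(\<lambda>f. f ?p) \<in> ?P \<rightarrow>\<^sub>M borel" by (rule measurable_component_singleton[OF p])
  from measurable_sets[OF this, of "{0}"] have A: "?A \<in> sets ?P"
    by (simp add: vimage_def Int_def conj_commute)
  have law: "emeasure (field_law M U) ?A = emeasure M {\<omega> \<in> space M. U ?p \<omega> = 0}"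
    if U: "random_field M U" for U :: "('a, 'b) field"
  proof -
    have [measurable]: "(\<lambda>\<omega>. \<lambda>q\<in>S2. U q \<omega>) \<in> M \<rightarrow>\<^sub>M ?P"
      using U by (intro measurable_restrict) (auto simp: random_field_def)
    have "(\<lambda>\<omega>. \<lambda>q\<in>S2. U q \<omega>) -` ?A \<inter> space M = {\<omega> \<in> space M. U ?p \<omega> = 0}"
      by (auto simp: space_PiM)
    then show ?thesis
      unfolding field_law_def by (subst emeasure_distr[OF _ A]) simp_all
  qed
  have [measurable]: "T x \<in> borel_measurable M" "T ?p \<in> borel_measurable M"
    using T x p by (auto simp: random_field_def)
  have "emeasure M {\<omega> \<in> space M. T ?p \<omega> = 0} = emeasure (field_law M T) ?A"
    by (rule law[OF T, symmetric])
  also have "\<dots> = emeasure (field_law M (\<lambda>q. T (g *v q))) ?A"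
    by (simp only: iso[unfolded isotropic_field_def, rule_format, OF g(1)])
  also have "\<dots> = emeasure M {\<omega> \<in> space M. T x \<omega> = 0}"
    using T gS by (subst law) (auto simp: random_field_def g(2))
  finally have "prob {\<omega> \<in> space M. T ?p \<omega> = 0} = prob {\<omega> \<in> space M. T x \<omega> = 0}"
    by (simp add: measure_def)
  also have "\<dots> \<le> prob {\<omega> \<in> space M. v \<bullet> T x \<omega> = 0}"
    by (intro finite_measure_mono) auto
  finally show False using less by simp
qed

section \<open>The two regularized fields at longitude 0 and at the North Pole\<close>

context gaussian_harmonics
begin

lemma random_field_reg: "0 < lam \<Longrightarrow> random_field M (reg_field lam a)"
  unfolding random_field_def reg_field_def[abs_def] reg_component_def
  by (intro ballI borel_measurable_suminf borel_measurable_sum borel_measurable_times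
      borel_measurable_reg_coeff borel_measurable_const)

lemma random_field_reg_real: "0 < lam \<Longrightarrow> random_field M (reg_field_real lam a)"
  unfolding random_field_def reg_field_real_def[abs_def]
  by (intro ballI borel_measurable_suminf borel_measurable_sum borel_measurable_times
      borel_measurable_reg_coeff_real borel_measurable_const)

lemma AE_all_coeff_uminus:
  "AE \<omega> in M. \<forall>l m. \<bar>m\<bar> \<le> int l \<longrightarrow> a l (- m) \<omega> = (-1) ^ nat \<bar>m\<bar> * cnj (a l m \<omega>)"
  unfolding AE_all_countable by (intro allI AE_impI AE_coeff_uminus)

lemma AE_all_coeff_0: "AE \<omega> in M. \<forall>l. a l 0 \<omega> = of_real (Re (a l 0 \<omega>))"
  unfolding AE_all_countable by (intro allI AE_coeff_0)

text \<open>Thresholding commutes with conjugation and signs, so the terms of orders m and -m remain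
  conjugate and combine to twice a real part. The real part passes through the series because the
  series is almost surely finite.\<close>

lemma AE_Re_reg_field:
  assumes lam: "0 < lam" and \<theta>: "0 < \<theta>" "\<theta> < pi"
  defines "x \<equiv> sph_point \<theta> 0"
  shows "AE \<omega> in M. Re (reg_field lam a x \<omega>) =
    (\<Sum>l. \<Sum>m = 0..int l. if m = 0 then soft lam (Re (a l m \<omega>)) * Re (sph_harm l m x)
                        else 2 * (Re (soft lam (a l m \<omega>)) * Re (sph_harm l m x)))"
  using AE_reg_coeff[OF lam] AE_all_coeff_uminus AE_all_coeff_0 AE_coeff_eventually_small[OF lam]
proof eventually_elim
  case (elim \<omega>)
  have Y: "sph_harm l m x = of_real (Re (sph_harm l m x))" if "0 \<le> m" for l m
    unfolding x_def by (rule sph_harm_zero_longitude[OF \<theta> that])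
  obtain L where L: "\<And>l m. L \<le> l \<Longrightarrow> \<bar>m\<bar> \<le> int l \<Longrightarrow> cmod (a l m \<omega>) \<le> lam"
    using elim(4) by auto
  have "reg_component lam a l x \<omega> = 0" if "l \<notin> {..<L}" for l
    unfolding reg_component_def
  proof (intro sum.neutral ballI)
    fix m assume "m \<in> {- int l..int l}"
    then have "\<bar>m\<bar> \<le> int l" by auto
    then have "soft lam (a l m \<omega>) = 0" using L[of l m] that lam by (simp add: soft_eq_0_iff)
    then show "reg_coeff lam a l m \<omega> * sph_harm l m x = 0" using elim(1) by simp
  qed
  then have "summable (\<lambda>l. reg_component lam a l x \<omega>)" by (intro summable_finite[of "{..<L}"]) auto
  then have "Re (reg_field lam a x \<omega>) = (\<Sum>l. Re (reg_component lam a l x \<omega>))"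
    unfolding reg_field_def by (rule bounded_linear.suminf[OF bounded_linear_Re])
  moreover have "Re (reg_component lam a l x \<omega>) = (\<Sum>m = 0..int l. if m = 0 then soft lam (Re (a l m \<omega>)) * Re (sph_harm l m x)
                        else 2 * (Re (soft lam (a l m \<omega>)) * Re (sph_harm l m x)))" for l
  proof -
    have "reg_coeff lam a l 0 \<omega> = of_real (soft lam (Re (a l 0 \<omega>)))"
      using elim(1,3) soft_of_real[of lam "Re (a l 0 \<omega>)"] by simp
    then have "Re (reg_coeff lam a l 0 \<omega> * sph_harm l 0 x) = soft lam (Re (a l 0 \<omega>)) * Re (sph_harm l 0 x)"
      by simp
    moreover have "Re (reg_coeff lam a l m \<omega> * sph_harm l m x + reg_coeff lam a l (- m) \<omega> * sph_harm l (- m) x)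
        = 2 * (Re (soft lam (a l m \<omega>)) * Re (sph_harm l m x))" if m: "m \<in> {1..int l}" for m
    proof -
      have 1: "reg_coeff lam a l m \<omega> = soft lam (a l m \<omega>)" using elim(1) m by simp
      have "reg_coeff lam a l (- m) \<omega> = soft lam ((-1) ^ nat m * cnj (a l m \<omega>))"
        using elim(1,2) m by simp
      also have "\<dots> = (-1) ^ nat m * cnj (soft lam (a l m \<omega>))"
        by (simp only: soft_minus_one_power soft_cnj)
      finally have "reg_coeff lam a l (- m) \<omega> * sph_harm l (- m) x
          = ((-1) ^ nat m * (-1) ^ nat m) * cnj (soft lam (a l m \<omega>) * sph_harm l m x)"
        using m by (simp add: sph_harm_uminus)
      also have "(-1) ^ nat m * (-1) ^ nat m = (1 :: complex)"
        by (simp flip: power_mult_distrib)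
      finally have 2: "reg_coeff lam a l (- m) \<omega> * sph_harm l (- m) x = cnj (soft lam (a l m \<omega>) * sph_harm l m x)"
        by simp
      have "Im (sph_harm l m x) = 0" using Y[of m l] m by (metis Im_complex_of_real atLeastAtMost_iff order_trans zero_le_one)
      then show ?thesis unfolding 1 2 by simp
    qed
    ultimately show ?thesis
      unfolding reg_component_def sum_symmetric_interval sum_nonneg_interval
      by (simp add: Re_sum)
  qed
  ultimately show ?case by simp
qed

text \<open>The harmonics of negative order are imaginary parts, which vanish at longitude
  0.\<close>

lemma AE_reg_field_real:
  assumes lam: "0 < lam" and \<theta>: "0 < \<theta>" "\<theta> < pi"
  defines "x \<equiv> sph_point \<theta> 0"
  shows "AE \<omega> in M. reg_field_real lam a x \<omega> =
    (\<Sum>l. \<Sum>m = 0..int l. if m = 0 then soft lam (Re (a l m \<omega>)) * Re (sph_harm l m x)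
                        else soft lam (sqrt 2 * Re (a l m \<omega>)) * (sqrt 2 * Re (sph_harm l m x)))"
  using AE_reg_coeff_real[OF lam]
proof eventually_elim
  case (elim \<omega>)
  have "Im (sph_harm l m x) = 0" if "0 \<le> m" for l m
    using sph_harm_zero_longitude[OF \<theta> that, of l] unfolding x_def by (metis Im_complex_of_real)
  then have "sph_harm_real l (- m) x = 0" if "0 < m" for l m
    using that by (simp add: sph_harm_real_def)
  then show ?case
    unfolding reg_field_real_def sum_symmetric_interval sum_nonneg_interval using elim
    by (intro suminf_cong) (simp add: sph_harm_real_def real_coeffs_def)
qed

lemma reg_field_north_pole:
  assumes lam: "0 < lam"
  shows "prob {\<omega> \<in> space M. \<forall>l. \<bar>Re (a l 0 \<omega>)\<bar> \<le> lam} \<le> prob {\<omega> \<in> space M. reg_field lam a (axis 3 1) \<omega> = 0}"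
    and "prob {\<omega> \<in> space M. \<forall>l. \<bar>Re (a l 0 \<omega>)\<bar> \<le> lam} \<le> prob {\<omega> \<in> space M. reg_field_real lam a (axis 3 1) \<omega> = 0}"
proof -
  have "(axis 3 1 :: real ^ 3) \<in> S2" by simp
  then have [measurable]: "reg_field lam a (axis 3 1) \<in> borel_measurable M" "reg_field_real lam a (axis 3 1) \<in> borel_measurable M"
    using random_field_reg[OF lam] random_field_reg_real[OF lam] unfolding random_field_def by blast+
  note Y = sph_harm_north_pole[unfolded sph_point_0_0]
  have small: "soft lam (Re (a l 0 \<omega>)) = 0" if "\<forall>l. \<bar>Re (a l 0 \<omega>)\<bar> \<le> lam" for l \<omega>
    using that lam by (simp add: soft_eq_0_iff)
  show "prob {\<omega> \<in> space M. \<forall>l. \<bar>Re (a l 0 \<omega>)\<bar> \<le> lam} \<le> prob {\<omega> \<in> space M. reg_field lam a (axis 3 1) \<omega> = 0}"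
  proof (rule finite_measure_mono_AE)
    show "AE \<omega> in M. \<omega> \<in> {\<omega> \<in> space M. \<forall>l. \<bar>Re (a l 0 \<omega>)\<bar> \<le> lam}
        \<longrightarrow> \<omega> \<in> {\<omega> \<in> space M. reg_field lam a (axis 3 1) \<omega> = 0}"
      using AE_reg_coeff[OF lam] AE_all_coeff_0
    proof eventually_elim
      case (elim \<omega>)
      show ?case
      proof
        assume \<omega>: "\<omega> \<in> {\<omega> \<in> space M. \<forall>l. \<bar>Re (a l 0 \<omega>)\<bar> \<le> lam}"
        have "reg_coeff lam a l 0 \<omega> = 0" for l
          using elim soft_of_real[of lam "Re (a l 0 \<omega>)"] small[of \<omega> l] \<omega> by simp
        then have "reg_coeff lam a l m \<omega> * sph_harm l m (axis 3 1) = 0" for l m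
          using Y[of m l] by (cases "m = 0") auto
        then show "\<omega> \<in> {\<omega> \<in> space M. reg_field lam a (axis 3 1) \<omega> = 0}"
          using \<omega> unfolding reg_field_def reg_component_def by (simp only: mem_Collect_eq sum.neutral_const suminf_zero simp_thms)
      qed
    qed
  qed measurable
  show "prob {\<omega> \<in> space M. \<forall>l. \<bar>Re (a l 0 \<omega>)\<bar> \<le> lam} \<le> prob {\<omega> \<in> space M. reg_field_real lam a (axis 3 1) \<omega> = 0}"
  proof (rule finite_measure_mono_AE)
    show "AE \<omega> in M. \<omega> \<in> {\<omega> \<in> space M. \<forall>l. \<bar>Re (a l 0 \<omega>)\<bar> \<le> lam}
        \<longrightarrow> \<omega> \<in> {\<omega> \<in> space M. reg_field_real lam a (axis 3 1) \<omega> = 0}"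
      using AE_reg_coeff_real[OF lam]
    proof eventually_elim
      case (elim \<omega>)
      show ?case
      proof
        assume \<omega>: "\<omega> \<in> {\<omega> \<in> space M. \<forall>l. \<bar>Re (a l 0 \<omega>)\<bar> \<le> lam}"
        have "reg_coeff_real lam a l m \<omega> * sph_harm_real l m (axis 3 1) = 0" for l m
          using elim small[of \<omega> l] \<omega> Y[of m l] Y[of "- m" l]
          by (cases "m = 0") (auto simp: sph_harm_real_def real_coeffs_def)
        then show "\<omega> \<in> {\<omega> \<in> space M. reg_field_real lam a (axis 3 1) \<omega> = 0}"
          using \<omega> unfolding reg_field_real_def by (simp only: mem_Collect_eq sum.neutral_const suminf_zero simp_thms)
      qed
    qed
  qed measurable
qed

lemma reg_fields_not_gaussian_not_isotropic:
  assumes lam: "0 < lam"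
  shows "\<not> gaussian_field M (reg_field lam a) \<and> \<not> isotropic_field M (reg_field lam a)"
    and "\<not> gaussian_field M (reg_field_real lam a) \<and> \<not> isotropic_field M (reg_field_real lam a)"
proof -
  obtain \<theta> where \<theta>: "0 < \<theta>" "\<theta> < pi" "\<And>l. legendre l (cos \<theta>) \<noteq> 0"
    using legendre_nonzero_angle by blast
  define x where "x = sph_point \<theta> 0"
  have x: "x \<in> S2" unfolding x_def by (rule sph_point_in_S2)
  have y: "Re (sph_harm l 0 x) \<noteq> 0" for l
    unfolding x_def sph_harm_0 using \<theta>(3)[of l] by simp
  have y11: "Re (sph_harm 1 1 x) \<noteq> 0"
    using sph_harm_1_1_nonzero[OF \<theta>(1,2)] sph_harm_zero_longitude[OF \<theta>(1,2), of 1 1]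
    unfolding x_def by (metis of_real_0 zero_le_one)
  have le: "lam / sqrt 2 \<le> lam" using lam by (simp add: field_simps)
  have small: "soft lam z = 0" "soft lam (Re z) = 0" "soft lam (sqrt 2 * Re z) = 0"
    if "cmod z \<le> lam / sqrt 2" for z
  proof -
    have "\<bar>Re z\<bar> \<le> lam / sqrt 2" using abs_Re_le_cmod[of z] that by simp
    with le have "\<bar>Re z\<bar> \<le> lam" "sqrt 2 * \<bar>Re z\<bar> \<le> lam" by (linarith, simp add: field_simps)
    then show "soft lam z = 0" "soft lam (Re z) = 0" "soft lam (sqrt 2 * Re z) = 0"
      using that le lam by (auto simp: soft_eq_0_iff abs_mult)
  qed
  \<comment> \<open>Thresholding preserves the phase, so \<open>Re (soft lam z)\<close> is a
    positive multiple of \<open>Re z\<close>.\<close>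
  have large: "Re (soft lam z) \<noteq> 0" "soft lam (sqrt 2 * Re z) \<noteq> 0" if z: "lam < Re z" for z
  proof -
    have cz: "lam < cmod z" using complex_Re_le_cmod[of z] z by simp
    moreover have "0 < cmod z" using cz lam by linarith
    ultimately have "0 < 1 - lam / cmod z" by simp
    with cz show "Re (soft lam z) \<noteq> 0" using z lam by (simp add: soft_def)
    have "1 * Re z \<le> sqrt 2 * Re z" using z lam by (intro mult_right_mono) auto
    then have "lam < \<bar>sqrt 2 * Re z\<bar>" using z by simp
    then show "soft lam (sqrt 2 * Re z) \<noteq> 0" using lam by (subst soft_eq_0_iff) auto
  qed
  have [measurable]: "reg_field lam a x \<in> borel_measurable M" "reg_field_real lam a x \<in> borel_measurable M"
    using random_field_reg[OF lam] random_field_reg_real[OF lam] x unfolding random_field_def by blast+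
  define h where "h l m z = (if m = 0 then soft lam (Re z) * Re (sph_harm l m x)
      else 2 * (Re (soft lam z) * Re (sph_harm l m x)))" for l and m :: int and z
  have h_meas: "h l m \<in> borel_measurable borel" for l m
    unfolding h_def[abs_def] by (cases "m = 0") simp_all
  have h_0: "h l 0 z = soft lam (Re z) * Re (sph_harm l 0 x)" for l z by (simp add: h_def)
  have h_small: "h l m z = 0" if "0 \<le> m" "cmod z \<le> lam / sqrt 2" for l m z
    using small[OF that(2)] by (simp add: h_def)
  have h_large: "h 1 1 z \<noteq> 0" if "lam < Re z" for z
    using large[OF that] y11 by (simp add: h_def)
  have R: "AE \<omega> in M. Re (reg_field lam a x \<omega>) = (\<Sum>l. \<Sum>m = 0..int l. h l m (a l m \<omega>))"
    using AE_Re_reg_field[OF lam \<theta>(1,2)] by (simp only: h_def x_def)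
  have "(\<lambda>\<omega>. Re (reg_field lam a x \<omega>)) \<in> borel_measurable M" by measurable
  from zero_probability[OF lam this h_meas h_0 y h_small h_large R]
  have zp: "0 < prob {\<omega> \<in> space M. Re (reg_field lam a x \<omega>) = 0}" "0 < prob {\<omega> \<in> space M. Re (reg_field lam a x \<omega>) \<noteq> 0}"
    "prob {\<omega> \<in> space M. Re (reg_field lam a x \<omega>) = 0} < prob {\<omega> \<in> space M. \<forall>l. \<bar>Re (a l 0 \<omega>)\<bar> \<le> lam}"
    by simp_all
  \<comment> \<open>The test direction 1 extracts the real part of the complex field.\<close>
  have inner: "1 \<bullet> z = Re z" for z :: complex by (simp add: inner_complex_def)
  have c: "0 < prob {\<omega> \<in> space M. 1 \<bullet> reg_field lam a x \<omega> = 0}"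
    "0 < prob {\<omega> \<in> space M. 1 \<bullet> reg_field lam a x \<omega> \<noteq> 0}"
    "prob {\<omega> \<in> space M. 1 \<bullet> reg_field lam a x \<omega> = 0} < prob {\<omega> \<in> space M. reg_field lam a (axis 3 1) \<omega> = 0}"
    unfolding inner using zp(1,2) less_le_trans[OF zp(3) reg_field_north_pole(1)[OF lam]] by simp_all
  show "\<not> gaussian_field M (reg_field lam a) \<and> \<not> isotropic_field M (reg_field lam a)"
    using not_gaussian_field[OF random_field_reg[OF lam] x c(1,2)]
      not_isotropic_field[OF random_field_reg[OF lam] x c(3)] by simp
  define k where "k l m z = (if m = 0 then soft lam (Re z) * Re (sph_harm l m x)
      else soft lam (sqrt 2 * Re z) * (sqrt 2 * Re (sph_harm l m x)))" for l and m :: int and z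
  have k_meas: "k l m \<in> borel_measurable borel" for l m
    unfolding k_def[abs_def] by (cases "m = 0") simp_all
  have k_0: "k l 0 z = soft lam (Re z) * Re (sph_harm l 0 x)" for l z by (simp add: k_def)
  have k_small: "k l m z = 0" if "0 \<le> m" "cmod z \<le> lam / sqrt 2" for l m z
    using small[OF that(2)] by (simp add: k_def)
  have k_large: "k 1 1 z \<noteq> 0" if "lam < Re z" for z
    using large[OF that] y11 by (simp add: k_def)
  have R: "AE \<omega> in M. reg_field_real lam a x \<omega> = (\<Sum>l. \<Sum>m = 0..int l. k l m (a l m \<omega>))"
    using AE_reg_field_real[OF lam \<theta>(1,2)] by (simp only: k_def x_def)
  have "reg_field_real lam a x \<in> borel_measurable M" by measurable
  from zero_probability[OF lam this k_meas k_0 y k_small k_large R]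
  have zp: "0 < prob {\<omega> \<in> space M. reg_field_real lam a x \<omega> = 0}" "0 < prob {\<omega> \<in> space M. reg_field_real lam a x \<omega> \<noteq> 0}"
    "prob {\<omega> \<in> space M. reg_field_real lam a x \<omega> = 0} < prob {\<omega> \<in> space M. \<forall>l. \<bar>Re (a l 0 \<omega>)\<bar> \<le> lam}"
    by simp_all
  have inner: "1 \<bullet> z = z" for z :: real by simp
  have r: "0 < prob {\<omega> \<in> space M. 1 \<bullet> reg_field_real lam a x \<omega> = 0}"
    "0 < prob {\<omega> \<in> space M. 1 \<bullet> reg_field_real lam a x \<omega> \<noteq> 0}"
    "prob {\<omega> \<in> space M. 1 \<bullet> reg_field_real lam a x \<omega> = 0} < prob {\<omega> \<in> space M. reg_field_real lam a (axis 3 1) \<omega> = 0}"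
    unfolding inner using zp(1,2) less_le_trans[OF zp(3) reg_field_north_pole(2)[OF lam]] by simp_all
  show "\<not> gaussian_field M (reg_field_real lam a) \<and> \<not> isotropic_field M (reg_field_real lam a)"
    using not_gaussian_field[OF random_field_reg_real[OF lam] x r(1,2)]
      not_isotropic_field[OF random_field_reg_real[OF lam] x r(3)] by simp
qed

end

section \<open>Limits\<close>

context gaussian_harmonics
begin

lemma integral_reg_component_north_pole:
  assumes "0 < lam"
  shows "(\<integral>\<omega>. (reg_component lam a l (sph_point 0 0) \<omega>)\<^sup>2 \<partial>M)
     = of_real (gamma0 (C l) (lam / sqrt (C l)) * ((2 * real l + 1) / (4 * pi)))"
proof -
  let ?s = "(2 * real l + 1) / (4 * pi)"
  have "reg_component lam a l (sph_point 0 0) \<omega> = of_real (sqrt ?s) * reg_coeff lam a l 0 \<omega>" for \<omega>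
  proof -
    have "reg_component lam a l (sph_point 0 0) \<omega>
        = (\<Sum>m\<in>{0}. reg_coeff lam a l m \<omega> * sph_harm l m (sph_point 0 0))"
      unfolding reg_component_def by (rule sum.mono_neutral_right) (auto simp: sph_harm_north_pole)
    then show ?thesis by (simp add: sph_harm_0 legendre_1 mult.commute)
  qed
  moreover have "(complex_of_real (sqrt ?s))\<^sup>2 = of_real ?s"
    by (simp only: of_real_power[symmetric]) simp
  ultimately have "(reg_component lam a l (sph_point 0 0) \<omega>)\<^sup>2 = of_real ?s * (reg_coeff lam a l 0 \<omega>)\<^sup>2" for \<omega>
    by (simp only: power_mult_distrib)
  then have "(\<integral>\<omega>. (reg_component lam a l (sph_point 0 0) \<omega>)\<^sup>2 \<partial>M) = of_real ?s * (\<integral>\<omega>. (reg_coeff lam a l 0 \<omega>)\<^sup>2 \<partial>M)"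
    by (simp only: integral_mult_right_zero)
  then show ?thesis
    by (simp add: integral_reg_coeff_0[OF assms] mult.commute)
qed

text \<open>With \<open>A\<close> the zonal term and \<open>B\<close> the rest, \<open>(A + B)\<^sup>2 - A\<^sup>2 = 2 A B + B\<^sup>2\<close>, and Young's inequality
  avoids computing any correlation between the coefficients.\<close>

lemma integral_reg_component_near_zonal:
  fixes l :: nat and x :: "real ^ 3"
  assumes lam: "0 < lam" and e: "0 < e"
  defines "K \<equiv> 2 * real l * (\<Sum>m\<in>{- int l..int l} - {0}. (cmod (sph_harm l m x))\<^sup>2)"
    and "t \<equiv> lam / sqrt (C l)"
  shows "cmod ((\<integral>\<omega>. (reg_component lam a l x \<omega>)\<^sup>2 \<partial>M) - gamma0 (C l) t * (sph_harm l 0 x)\<^sup>2)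
     \<le> e * (gamma0 (C l) t * (cmod (sph_harm l 0 x))\<^sup>2) + (1 + 1 / e) * (K * gamma1 (C l) t)"
proof -
  define I where "I = {- int l..int l} - {0}"
  define A where "A \<omega> = reg_coeff lam a l 0 \<omega> * sph_harm l 0 x" for \<omega>
  define B where "B \<omega> = (\<Sum>m\<in>I. reg_coeff lam a l m \<omega> * sph_harm l m x)" for \<omega>
  define Q where "Q = (\<Sum>m\<in>I. (cmod (sph_harm l m x))\<^sup>2)"
  note [measurable] = borel_measurable_reg_coeff[OF lam]
  have [measurable]: "A \<in> borel_measurable M" "B \<in> borel_measurable M"
    unfolding A_def[abs_def] B_def[abs_def] by measurable
  have I: "finite I" "card I = 2 * l"
    by (auto simp: I_def card_Diff_singleton nat_add_distrib nat_mult_distrib)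
  have AB: "reg_component lam a l x \<omega> = A \<omega> + B \<omega>" for \<omega>
    unfolding reg_component_def A_def B_def I_def
    by (subst sum.remove[of _ "0 :: int"]) auto
  have hA: "has_bochner_integral M (\<lambda>\<omega>. (cmod (A \<omega>))\<^sup>2) (gamma0 (C l) t * (cmod (sph_harm l 0 x))\<^sup>2)"
    unfolding A_def norm_mult power_mult_distrib t_def
    using has_bochner_integral_reg_coeff[OF lam, of 0 l] by (intro has_bochner_integral_mult_left) auto
  have hr: "has_bochner_integral M (\<lambda>\<omega>. (cmod (reg_coeff lam a l m \<omega>))\<^sup>2) (gamma1 (C l) t)" if "m \<in> I" for m
    using has_bochner_integral_reg_coeff[OF lam, of m l] that by (auto simp: I_def t_def)
  \<comment> \<open>Cauchy-Schwarz separates the harmonics, collected in \<open>Q\<close>, from the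
    \<open>2 * l\<close> coefficients of equal second moment; their product is the origin of
    \<open>K\<close>.\<close>
  have hB: "has_bochner_integral M (\<lambda>\<omega>. Q * (\<Sum>m\<in>I. (cmod (reg_coeff lam a l m \<omega>))\<^sup>2)) (K * gamma1 (C l) t)"
  proof -
    have "has_bochner_integral M (\<lambda>\<omega>. Q * (\<Sum>m\<in>I. (cmod (reg_coeff lam a l m \<omega>))\<^sup>2)) (Q * (\<Sum>m\<in>I. gamma1 (C l) t))"
      using hr by (intro has_bochner_integral_mult_right has_bochner_integral_sum) auto
    then show ?thesis using I by (simp add: K_def Q_def I_def mult_ac)
  qed
  have B_le: "(cmod (B \<omega>))\<^sup>2 \<le> Q * (\<Sum>m\<in>I. (cmod (reg_coeff lam a l m \<omega>))\<^sup>2)" for \<omega>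
  proof -
    have "cmod (B \<omega>) \<le> (\<Sum>m\<in>I. cmod (reg_coeff lam a l m \<omega>) * cmod (sph_harm l m x))"
      unfolding B_def by (rule order_trans[OF norm_sum]) (simp add: norm_mult)
    then have "(cmod (B \<omega>))\<^sup>2 \<le> (\<Sum>m\<in>I. cmod (reg_coeff lam a l m \<omega>) * cmod (sph_harm l m x))\<^sup>2"
      by (intro power_mono) auto
    also have "\<dots> \<le> (\<Sum>m\<in>I. (cmod (reg_coeff lam a l m \<omega>))\<^sup>2) * (\<Sum>m\<in>I. (cmod (sph_harm l m x))\<^sup>2)"
      by (rule Cauchy_Schwarz_ineq_sum)
    finally show ?thesis by (simp add: Q_def mult.commute)
  qed
  define U where "U \<omega> = e * (cmod (A \<omega>))\<^sup>2 + (1 + 1 / e) * (Q * (\<Sum>m\<in>I. (cmod (reg_coeff lam a l m \<omega>))\<^sup>2))" for \<omega>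
  have hU: "has_bochner_integral M U (e * (gamma0 (C l) t * (cmod (sph_harm l 0 x))\<^sup>2) + (1 + 1 / e) * (K * gamma1 (C l) t))"
    unfolding U_def by (intro has_bochner_integral_add has_bochner_integral_mult_right hA hB)
  have le: "cmod (2 * A \<omega> * B \<omega> + (B \<omega>)\<^sup>2) \<le> U \<omega>" for \<omega>
  proof -
    have "cmod (2 * A \<omega> * B \<omega> + (B \<omega>)\<^sup>2) \<le> 2 * cmod (A \<omega>) * cmod (B \<omega>) + (cmod (B \<omega>))\<^sup>2"
      by (rule order_trans[OF norm_triangle_ineq]) (simp add: norm_mult norm_power)
    also have "2 * cmod (A \<omega>) * cmod (B \<omega>) \<le> e * (cmod (A \<omega>))\<^sup>2 + 1 / e * (cmod (B \<omega>))\<^sup>2"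
    proof -
      have "0 \<le> (e * cmod (A \<omega>) - cmod (B \<omega>))\<^sup>2 / e" using e by simp
      also have "\<dots> = e * (cmod (A \<omega>))\<^sup>2 + 1 / e * (cmod (B \<omega>))\<^sup>2 - 2 * cmod (A \<omega>) * cmod (B \<omega>)"
        using e by (simp add: power2_eq_square field_simps)
      finally show ?thesis by simp
    qed
    also have "e * (cmod (A \<omega>))\<^sup>2 + 1 / e * (cmod (B \<omega>))\<^sup>2 + (cmod (B \<omega>))\<^sup>2
        = e * (cmod (A \<omega>))\<^sup>2 + (1 + 1 / e) * (cmod (B \<omega>))\<^sup>2" by (simp add: algebra_simps)
    also have "\<dots> \<le> U \<omega>"
      unfolding U_def using e by (intro add_left_mono mult_left_mono B_le) auto
    finally show ?thesis by simp
  qed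
  have iU: "integrable M U" using hU by (rule integrable.intros)
  have iD: "integrable M (\<lambda>\<omega>. 2 * A \<omega> * B \<omega> + (B \<omega>)\<^sup>2)"
    by (rule Bochner_Integration.integrable_bound[OF iU]) (use le in \<open>auto intro: order_trans[OF _ abs_ge_self]\<close>)
  have "integrable M (\<lambda>\<omega>. (cmod (A \<omega>))\<^sup>2)" using hA by (rule integrable.intros)
  then have iA: "integrable M (\<lambda>\<omega>. (A \<omega>)\<^sup>2)"
    by (rule Bochner_Integration.integrable_bound) (auto simp: norm_power)
  have "(\<integral>\<omega>. (reg_component lam a l x \<omega>)\<^sup>2 \<partial>M) = (\<integral>\<omega>. (A \<omega>)\<^sup>2 + (2 * A \<omega> * B \<omega> + (B \<omega>)\<^sup>2) \<partial>M)"
    by (simp add: AB power2_sum algebra_simps)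
  also have "\<dots> = (\<integral>\<omega>. (A \<omega>)\<^sup>2 \<partial>M) + (\<integral>\<omega>. 2 * A \<omega> * B \<omega> + (B \<omega>)\<^sup>2 \<partial>M)"
    by (rule Bochner_Integration.integral_add[OF iA iD])
  also have "(\<integral>\<omega>. (A \<omega>)\<^sup>2 \<partial>M) = gamma0 (C l) t * (sph_harm l 0 x)\<^sup>2"
    unfolding A_def power_mult_distrib t_def by (simp add: integral_reg_coeff_0[OF lam])
  finally have "cmod ((\<integral>\<omega>. (reg_component lam a l x \<omega>)\<^sup>2 \<partial>M) - gamma0 (C l) t * (sph_harm l 0 x)\<^sup>2)
      = cmod (\<integral>\<omega>. 2 * A \<omega> * B \<omega> + (B \<omega>)\<^sup>2 \<partial>M)" by simp
  also have "\<dots> \<le> (\<integral>\<omega>. cmod (2 * A \<omega> * B \<omega> + (B \<omega>)\<^sup>2) \<partial>M)"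
    by (rule integral_norm_bound)
  also have "\<dots> \<le> (\<integral>\<omega>. U \<omega> \<partial>M)"
    by (intro integral_mono integrable_norm iD iU le)
  finally show ?thesis
    using has_bochner_integral_integral_eq[OF hU] by simp
qed

text \<open>The parameter in Young's inequality is taken to be \<open>r\<close>, which balances
  \<open>e\<close> against \<open>r^2 / e\<close>. The resulting bound depends on the model and on
  \<open>lam\<close> only through \<open>t\<close>, as a limit taken jointly over all models
  demands.\<close>

lemma reg_component_ratio_near_1:
  fixes l :: nat and \<theta> \<phi> :: real
  assumes lam: "0 < lam" and P: "legendre l (cos \<theta>) \<noteq> 0"
  defines "t \<equiv> lam / sqrt (C l)" and "x \<equiv> sph_point \<theta> \<phi>"
  defines "q \<equiv> 2 * real l * (\<Sum>m\<in>{- int l..int l} - {0}. (cmod (sph_harm l m x))\<^sup>2) / (cmod (sph_harm l 0 x))\<^sup>2"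
    and "r \<equiv> sqrt (gamma1 1 t / gamma0 1 t)"
  shows "cmod ((\<integral>\<omega>. (reg_component lam a l x \<omega>)\<^sup>2 \<partial>M) /
      ((\<integral>\<omega>. (reg_component lam a l (sph_point 0 0) \<omega>)\<^sup>2 \<partial>M) * complex_of_real ((legendre l (cos \<theta>))\<^sup>2)) - 1)
    \<le> r + q * (r\<^sup>2 + r)"
proof -
  define g0 where "g0 = gamma0 (C l) t"
  define Y where "Y = sph_harm l 0 x"
  define K where "K = 2 * real l * (\<Sum>m\<in>{- int l..int l} - {0}. (cmod (sph_harm l m x))\<^sup>2)"
  define J where "J = (\<integral>\<omega>. (reg_component lam a l x \<omega>)\<^sup>2 \<partial>M)"
  define w where "w = sqrt ((2 * real l + 1) / (4 * pi)) * legendre l (cos \<theta>)"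
  have t: "0 \<le> t" using lam C_pos[of l] by (simp add: t_def)
  have g0: "0 < g0" unfolding g0_def by (subst gamma0_scale) (simp add: C_pos gamma0_pos[OF t])
  have r: "0 < r" unfolding r_def using gamma0_pos[OF t] gamma1_pos[OF t] by simp
  have g1: "gamma1 (C l) t = g0 * r\<^sup>2"
    unfolding g0_def r_def using C_pos[of l] gamma0_pos[OF t] gamma1_pos[OF t]
    by (subst gamma1_scale, subst gamma0_scale) simp
  have Y: "Y = of_real w" unfolding Y_def x_def w_def by (rule sph_harm_0)
  have w: "w \<noteq> 0" using P by (simp add: w_def)
  have D: "(\<integral>\<omega>. (reg_component lam a l (sph_point 0 0) \<omega>)\<^sup>2 \<partial>M) * complex_of_real ((legendre l (cos \<theta>))\<^sup>2)
      = of_real (g0 * w\<^sup>2)"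
    unfolding integral_reg_component_north_pole[OF lam] g0_def t_def w_def
    by (simp only: of_real_mult[symmetric] power_mult_distrib) simp
  have "J / of_real (g0 * w\<^sup>2) - 1 = (J - g0 * Y\<^sup>2) / of_real (g0 * w\<^sup>2)"
    using g0 w by (simp add: Y diff_divide_distrib)
  then have "cmod (J / of_real (g0 * w\<^sup>2) - 1) = cmod (J - g0 * Y\<^sup>2) / (g0 * w\<^sup>2)"
    using g0 by (simp add: norm_divide norm_mult norm_power)
  also have "cmod (J - g0 * Y\<^sup>2) \<le> r * (g0 * (cmod Y)\<^sup>2) + (1 + 1 / r) * (K * (g0 * r\<^sup>2))"
    using integral_reg_component_near_zonal[OF lam r, of l x]
    unfolding J_def g0_def Y_def K_def t_def[symmetric] g1 .
  also have "(r * (g0 * (cmod Y)\<^sup>2) + (1 + 1 / r) * (K * (g0 * r\<^sup>2))) / (g0 * w\<^sup>2) = r + q * (r\<^sup>2 + r)"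
  proof -
    have "q = K / w\<^sup>2" unfolding q_def K_def Y_def[symmetric] by (simp add: Y)
    then have "K = q * w\<^sup>2" using w by simp
    then show ?thesis using g0 r w by (simp add: Y field_simps power2_eq_square)
  qed
  finally show ?thesis
    unfolding D J_def[symmetric] using g0 by (simp add: divide_right_mono)
qed

text \<open>The prefactor \<open>C l\<close> cancels and \<open>C l / lam^2\<close> is
  \<open>1 / t^2\<close>, so everything becomes a function of the single variable
  \<open>t\<close>.\<close>

lemma ratio_reg_coeffs:
  assumes "0 < lam" "\<bar>m\<bar> \<le> int l" "m \<noteq> 0"
  defines "t \<equiv> lam / sqrt (C l)"
  shows "2 * C l / lam\<^sup>2 * ln ((\<integral>\<omega>. (cmod (reg_coeff lam a l m \<omega>))\<^sup>2 \<partial>M) / (\<integral>\<omega>. (cmod (reg_coeff lam a l 0 \<omega>))\<^sup>2 \<partial>M))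
    = 2 / t\<^sup>2 * ln (gamma1 1 t / gamma0 1 t)"
proof -
  have "(\<integral>\<omega>. (cmod (reg_coeff lam a l m \<omega>))\<^sup>2 \<partial>M) / (\<integral>\<omega>. (cmod (reg_coeff lam a l 0 \<omega>))\<^sup>2 \<partial>M)
      = gamma1 (C l) t / gamma0 (C l) t"
    using has_bochner_integral_integral_eq[OF has_bochner_integral_reg_coeff[OF assms(1,2)]]
      has_bochner_integral_integral_eq[OF has_bochner_integral_reg_coeff[OF assms(1), of 0 l]] assms(3)
    by (simp add: t_def)
  also have "\<dots> = gamma1 1 t / gamma0 1 t"
    using C_pos[of l] by (subst gamma1_scale, subst gamma0_scale) simp
  finally show ?thesis
    using C_pos[of l] assms(1) by (simp add: t_def power_divide)
qed

end

section \<open>From limits in the ratio alone to limits over all models\<close>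

lemma gaussian_harmonicsI: "gaussian_isotropic_model M T a C \<Longrightarrow> gaussian_harmonics M a C"
  by (simp add: gaussian_isotropic_model_def gaussian_harmonics_def gaussian_harmonics_axioms_def)

lemma filterlim_large_ratio:
  "filterlim (\<lambda>(M, T, a, C, lam, l). lam / sqrt (C l)) at_top (large_ratio L)"
  unfolding large_ratio_def by (rule filterlim_mono[OF filterlim_filtercomap order_refl inf_le1])

lemma reg_coeff_ratio_limit:
  assumes "m \<noteq> 0"
  shows "((\<lambda>(M :: 'w measure, T, a, C, lam, l).
      - (2 * C l / lam\<^sup>2 *
         ln ((\<integral>\<omega>. (cmod (reg_coeff lam a l m \<omega>))\<^sup>2 \<partial>M) /
             (\<integral>\<omega>. (cmod (reg_coeff lam a l 0 \<omega>))\<^sup>2 \<partial>M))))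
    \<longlongrightarrow> 1) (large_ratio {l. \<bar>m\<bar> \<le> int l})"
proof (rule Lim_transform_eventually[OF filterlim_compose[OF ln_gamma_ratio_tendsto filterlim_large_ratio]])
  have "- (2 / (lam / sqrt (C l))\<^sup>2 * ln (gamma1 1 (lam / sqrt (C l)) / gamma0 1 (lam / sqrt (C l))))
      = - (2 * C l / lam\<^sup>2 * ln ((\<integral>\<omega>. (cmod (reg_coeff lam a l m \<omega>))\<^sup>2 \<partial>M) / (\<integral>\<omega>. (cmod (reg_coeff lam a l 0 \<omega>))\<^sup>2 \<partial>M)))"
    if "gaussian_isotropic_model M T a C" "0 < lam" "\<bar>m\<bar> \<le> int l"
    for M :: "'w measure" and T a C lam l
    using gaussian_harmonics.ratio_reg_coeffs[OF gaussian_harmonicsI[OF that(1)] that(2,3) assms] by simp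
  then show "\<forall>\<^sub>F p in large_ratio {l. \<bar>m\<bar> \<le> int l}.
      - (2 / (case p of (M, T, a, C, lam, l) \<Rightarrow> lam / sqrt (C l))\<^sup>2 *
         ln (gamma1 1 (case p of (M, T, a, C, lam, l) \<Rightarrow> lam / sqrt (C l)) / gamma0 1 (case p of (M, T, a, C, lam, l) \<Rightarrow> lam / sqrt (C l))))
      = (case p of (M :: 'w measure, T, a, C, lam, l) \<Rightarrow> - (2 * C l / lam\<^sup>2 *
         ln ((\<integral>\<omega>. (cmod (reg_coeff lam a l m \<omega>))\<^sup>2 \<partial>M) / (\<integral>\<omega>. (cmod (reg_coeff lam a l 0 \<omega>))\<^sup>2 \<partial>M))))"
    \<comment> \<open>The identity holds for every value of the ratio, so 0 serves as the
      bound.\<close>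
    unfolding eventually_large_ratio by (intro exI[of _ 0]) auto
qed

text \<open>The degree is fixed because the constant \<open>q\<close> in the error bound depends on
  it, as well as on the point.\<close>

lemma reg_component_ratio_limit:
  assumes P: "legendre l (cos \<theta>) \<noteq> 0"
  shows "((\<lambda>(M :: 'w measure, T, a, C, lam, l').
      (\<integral>\<omega>. (reg_component lam a l' (sph_point \<theta> \<phi>) \<omega>)\<^sup>2 \<partial>M) /
      ((\<integral>\<omega>. (reg_component lam a l' (sph_point 0 0) \<omega>)\<^sup>2 \<partial>M) * complex_of_real ((legendre l' (cos \<theta>))\<^sup>2)))
    \<longlongrightarrow> 1) (large_ratio {l})"
proof -
  define q where "q = 2 * real l * (\<Sum>m\<in>{- int l..int l} - {0}. (cmod (sph_harm l m (sph_point \<theta> \<phi>)))\<^sup>2)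
      / (cmod (sph_harm l 0 (sph_point \<theta> \<phi>)))\<^sup>2"
  define r where "r t = sqrt (gamma1 1 t / gamma0 1 t)" for t
  have "(r \<longlongrightarrow> sqrt 0) at_top"
    unfolding r_def by (intro tendsto_real_sqrt gamma_ratio_tendsto_0)
  then have "((\<lambda>t. r t + q * ((r t)\<^sup>2 + r t)) \<longlongrightarrow> 0 + q * (0\<^sup>2 + 0)) at_top"
    by (intro tendsto_intros) simp_all
  then have lim: "((\<lambda>t. r t + q * ((r t)\<^sup>2 + r t)) \<longlongrightarrow> 0) at_top" by simp
  have "((\<lambda>p. (case p of (M :: 'w measure, T, a, C, lam, l') \<Rightarrow>
      (\<integral>\<omega>. (reg_component lam a l' (sph_point \<theta> \<phi>) \<omega>)\<^sup>2 \<partial>M) /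
      ((\<integral>\<omega>. (reg_component lam a l' (sph_point 0 0) \<omega>)\<^sup>2 \<partial>M) * complex_of_real ((legendre l' (cos \<theta>))\<^sup>2))) - 1)
    \<longlongrightarrow> 0) (large_ratio {l})"
  proof (rule Lim_null_comparison[OF _ filterlim_compose[OF lim filterlim_large_ratio]])
    have "cmod ((\<integral>\<omega>. (reg_component lam a l (sph_point \<theta> \<phi>) \<omega>)\<^sup>2 \<partial>M) /
      ((\<integral>\<omega>. (reg_component lam a l (sph_point 0 0) \<omega>)\<^sup>2 \<partial>M) * complex_of_real ((legendre l (cos \<theta>))\<^sup>2)) - 1)
      \<le> r (lam / sqrt (C l)) + q * ((r (lam / sqrt (C l)))\<^sup>2 + r (lam / sqrt (C l)))"
      if "gaussian_isotropic_model M T a C" "0 < lam" for M :: "'w measure" and T a C lam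
      unfolding r_def q_def
      by (rule gaussian_harmonics.reg_component_ratio_near_1[OF gaussian_harmonicsI[OF that(1)] that(2) P])
    then show "\<forall>\<^sub>F p in large_ratio {l}. norm ((case p of (M :: 'w measure, T, a, C, lam, l') \<Rightarrow>
      (\<integral>\<omega>. (reg_component lam a l' (sph_point \<theta> \<phi>) \<omega>)\<^sup>2 \<partial>M) /
      ((\<integral>\<omega>. (reg_component lam a l' (sph_point 0 0) \<omega>)\<^sup>2 \<partial>M) * complex_of_real ((legendre l' (cos \<theta>))\<^sup>2))) - 1)
      \<le> r (case p of (M, T, a, C, lam, l) \<Rightarrow> lam / sqrt (C l)) +
         q * ((r (case p of (M, T, a, C, lam, l) \<Rightarrow> lam / sqrt (C l)))\<^sup>2 + r (case p of (M, T, a, C, lam, l) \<Rightarrow> lam / sqrt (C l)))"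
      unfolding eventually_large_ratio by (intro exI[of _ 0]) auto
  qed
  then show ?thesis by (rule LIM_zero_cancel)
qed

theorem theorem11:
  fixes M :: "'w measure" and T :: "('w, real) field" and a :: "'w random_coeffs"
    and C :: "nat \<Rightarrow> real" and lam :: real
  assumes "gaussian_isotropic_model M T a C" and "0 < lam"
  shows
    "(random_field M (reg_field lam a) \<and>
      \<not> gaussian_field M (reg_field lam a) \<and> \<not> isotropic_field M (reg_field lam a)) \<and>
     (random_field M (reg_field_real lam a) \<and>
      \<not> gaussian_field M (reg_field_real lam a) \<and> \<not> isotropic_field M (reg_field_real lam a)) \<and>
     (\<forall>l. (\<integral>\<omega>. (reg_coeff lam a l 0 \<omega>)\<^sup>2 \<partial>M)
            = complex_of_real (gamma0 (C l) (lam / sqrt (C l)))) \<and>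
     (\<forall>l m. m \<noteq> 0 \<and> \<bar>m\<bar> \<le> int l \<longrightarrow>
        (\<integral>\<omega>. (cmod (reg_coeff lam a l m \<omega>))\<^sup>2 \<partial>M) = gamma1 (C l) (lam / sqrt (C l))) \<and>
     (\<forall>m :: int. m \<noteq> 0 \<longrightarrow>
        ((\<lambda>(M' :: 'w measure, T', a', C', lam', l).
            - (2 * C' l / lam'\<^sup>2 *
               ln ((\<integral>\<omega>. (cmod (reg_coeff lam' a' l m \<omega>))\<^sup>2 \<partial>M') /
                   (\<integral>\<omega>. (cmod (reg_coeff lam' a' l 0 \<omega>))\<^sup>2 \<partial>M'))))
          \<longlongrightarrow> 1) (large_ratio {l. \<bar>m\<bar> \<le> int l})) \<and>
     (\<forall>l \<theta> \<phi>. 0 \<le> \<theta> \<and> \<theta> \<le> pi \<and> 0 \<le> \<phi> \<and> \<phi> < 2 * pi \<and> legendre l (cos \<theta>) \<noteq> 0 \<longrightarrow>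
        ((\<lambda>(M' :: 'w measure, T', a', C', lam', l').
            (\<integral>\<omega>. (reg_component lam' a' l' (sph_point \<theta> \<phi>) \<omega>)\<^sup>2 \<partial>M') /
            ((\<integral>\<omega>. (reg_component lam' a' l' (sph_point 0 0) \<omega>)\<^sup>2 \<partial>M') *
             complex_of_real ((legendre l' (cos \<theta>))\<^sup>2)))
          \<longlongrightarrow> 1) (large_ratio {l})) \<and>
     (\<forall>l m. \<bar>m\<bar> \<le> int l \<longrightarrow>
        (\<integral>\<omega>. (reg_coeff_real lam a l 0 \<omega>)\<^sup>2 \<partial>M) = (\<integral>\<omega>. \<bar>reg_coeff_real lam a l m \<omega>\<bar>\<^sup>2 \<partial>M) \<and>
        (\<integral>\<omega>. \<bar>reg_coeff_real lam a l m \<omega>\<bar>\<^sup>2 \<partial>M) = gamma0 (C l) (lam / sqrt (C l)))"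
proof -
  interpret gaussian_harmonics M a C by (rule gaussian_harmonicsI[OF assms(1)])
  show ?thesis
    using reg_fields_not_gaussian_not_isotropic[OF assms(2)] random_field_reg[OF assms(2)]
      random_field_reg_real[OF assms(2)] integral_reg_coeff_0[OF assms(2)]
      has_bochner_integral_integral_eq[OF has_bochner_integral_reg_coeff[OF assms(2)]]
      integral_reg_coeff_real[OF assms(2)]
    by (intro conjI allI impI reg_coeff_ratio_limit reg_component_ratio_limit) simp_all
qed

end
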